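(* Let $S$ be a sub-semifield of $\mathbb{T}$ and let $\mathcal{M}$ be the toric monoid corresponding to a strongly convex rational polyhedral cone $\sigma\subseteq N_{\mathbb{R}}$. Let $E$ be a congruence on $S[\mathcal{M}]$ with a finite tropical basis and let $P$ be a prime congruence on $S[\mathcal{M}]$. Then $E\subseteq P$ if and only if there is a flag of cones $\mathcal{C}_\bullet$ contained in $\widetilde{V}(E)$ such that $P=P_{\mathcal{C}_\bullet}$.
   Context: Semirings are commutative, with $0$ and $1$, and additively idempotent ($a+a=a$); they are partially ordered by $a\le b\iff a+b=b$. $\mathbb{T}=\mathbb{R}\cup\{-\infty\}$ is the tropical semifield (addition is max, multiplication is usual addition, $0_{\mathbb T}=-\infty$). For $a\in\mathbb{R}$, $t^a$ is the corresponding element of $\mathbb{T}$, and $\log:\mathbb{T}\to\mathbb{R}\cup\{-\infty\}$ is the inverse identification, with $\log 0_{\mathbb T}=-\infty$. Toric data: $M$ is a finitely generated free abelian group, $M_{\mathbb R}=M\otimes\mathbb R$, $N_{\mathbb R}=\mathrm{Hom}(M,\mathbb R)$ with pairing $\langle v,u\rangle=v(u)$. For $\sigma\subseteq N_{\mathbb R}$ a strongly convex rational polyhedral cone, $\sigma^\vee=\{u\in M_{\mathbb R}:\langle v,u\rangle\le 0\ \forall v\in\sigma\}$, and the toric monoid corresponding to $\sigma$ is $\mathcal{M}=\sigma^\vee\cap M$. $N_{\mathbb R}(\sigma)$ is the set of monoid homomorphisms $\mathcal{M}\to(\mathbb R\cup\{-\infty\},+)$; for $x\in N_{\mathbb R}(\sigma)$,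 $u\in\mathcal M$, write $\langle x,u\rangle=x(u)$. It is the disjoint union over faces $\tau\le\sigma$ of strata $N_{\mathbb R}/\tau:=N_{\mathbb R}/\mathrm{span}(\tau)$, where the class $w$ is the homomorphism $u\mapsto\langle w,u\rangle$ if $u\in\tau^\perp$ and $u\mapsto-\infty$ if $u\in\mathcal M\setminus\tau^\perp$. For $f=\sum_u f_u\chi^u\in S[\mathcal M]$ and $(r,x)\in\mathbb R_{\ge0}\times N_{\mathbb R}(\sigma)$, $\widetilde f(r,x)=\max_{u\in\mathrm{supp}(f)}\left(r\log(f_u)+\langle x,u\rangle\right)$ (equal to $-\infty$ if $f=0$). For $E\subseteq S[\mathcal M]^2$, $\widetilde V(E)=\{w\in\mathbb R_{\ge0}\times N_{\mathbb R}(\sigma):\widetilde f(w)=\widetilde g(w)\ \forall (f,g)\in E\}$. A congruence on a semiring $A$ is an equivalence relation respecting the operations. A proper congruence $P$ is prime if $A/P$ is totally ordered and cancellative (i.e. every nonzero element $a$ satisfies $ab=ac\Rightarrow b=c$). A congruence $E$ on $S[\mathcal M]$ has a finite tropical basis if there are $(f_1,g_1),\dots,(f_r,g_r)\in E$ with $\widetilde V(E)=\widetilde V(\{(f_1,g_1),\dots,(f_r,g_r)\})$. A flag of cones is a chain $\mathcal C_\bullet=(\mathcal C_{-1}\le\mathcal C_0\le\cdots\le\mathcal C_k)$, $k\ge-1$, of (not necessarily rational) polyhedral cones in $\mathbb R_{\ge0}\times N_{\mathbb R}/\tau$ for a single face $\tau\le\sigma$, each a face of the next, with $\dim\mathcal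 C_i=i+1$ (so $\mathcal C_{-1}$ is the zero cone). It is contained in a set $X$ if every $\mathcal C_i\subseteq X$. The prime congruence $P_{\mathcal C_\bullet}$ on $S[\mathcal M]$ is defined by choosing $w_i\in\mathcal C_i\setminus\mathcal C_{i-1}$ for $0\le i\le k$ (the result does not depend on the choice): for a term $m=t^a\chi^u$ with $u\in\tau^\perp$ put $\Phi(m)=(r_ia+\langle x_i,u\rangle)_{i=0}^k\in\mathbb R^{k+1}$ where $w_i=(r_i,x_i)$; for $u\notin\tau^\perp$ put $\Phi(m)=-\infty$; for nonzero $f$ let $\Phi(f)$ be the lexicographic maximum of $\Phi$ over the terms of $f$, with $-\infty$ smallest, and $\Phi(0)=-\infty$; then $(f,g)\in P_{\mathcal C_\bullet}$ iff $\Phi(f)=\Phi(g)$. *)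

theory Defs
  imports
    "HOL-Analysis.Analysis"
    "HOL-Library.Poly_Mapping"
    "HOL-Library.Set_Algebras"
    "HOL-Library.FuncSet"
    "HOL-Library.List_Lexorder"
    "HOL-Library.Option_ord"
begin

section \<open>The tropical semifield\<close>

text \<open>The representation morphism is the logarithm, with values in the reals together with
  \<open>- \<infinity>\<close>; addition is the maximum and multiplication is addition of logarithms.\<close>

typedef trop = "{x :: ereal. x \<noteq> \<infinity>}"
  morphisms trop_log Abs_trop
  by (rule exI[of _ 0]) simp

setup_lifting type_definition_trop

instantiation trop :: comm_semiring_1
begin

lift_definition zero_trop :: trop is "- \<infinity>" by simp
lift_definition one_trop :: trop is "0" by simp
lift_definition plus_trop :: "trop \<Rightarrow> trop \<Rightarrow> trop" is max by (simp add: max_def)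
lift_definition times_trop :: "trop \<Rightarrow> trop \<Rightarrow> trop" is "(+)" by simp

instance
proof
  fix a b c :: trop
  show "a + b + c = a + (b + c)" by transfer (rule max.assoc)
  show "a + b = b + a" by transfer (rule max.commute)
  show "0 + a = a" by transfer (simp add: max_def)
  show "a * b * c = a * (b * c)" by transfer (rule add.assoc)
  show "a * b = b * a" by transfer (rule add.commute)
  show "1 * a = a" by transfer simp
  show "(a + b) * c = a * c + b * c"
    by transfer (simp add: max_def, metis add_right_mono antisym linear)
  show "0 * a = 0" by transfer simp
  show "a * 0 = 0" by transfer simp
  show "(0 :: trop) \<noteq> 1" by transfer simp
qed

end

definition sub_semifield :: "trop set \<Rightarrow> bool" where
  "sub_semifield S \<longleftrightarrow>
     0 \<in> S \<and> 1 \<in> S \<and> (\<forall>a\<in>S. \<forall>b\<in>S. a + b \<in> S \<and> a * b \<in> S) \<and>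
     (\<forall>a\<in>S. a \<noteq> 0 \<longrightarrow> (\<exists>b\<in>S. a * b = 1))"


section \<open>The lattice and its real dual\<close>

text \<open>\<open>M\<close> is the universe of the type \<open>'m\<close>; it has to be isomorphic to \<open>\<int>\<^sup>n\<close> for some
  \<open>n \<ge> 0\<close>, where \<open>\<int>\<^sup>n\<close> consists of the elements of the free abelian group \<open>nat \<Rightarrow>\<^sub>0 int\<close> that
  are supported on \<open>{..<n}\<close>.\<close>

definition fg_free_abelian_group :: "'m::ab_group_add itself \<Rightarrow> bool" where
  "fg_free_abelian_group _ \<longleftrightarrow>
     (\<exists>n (\<phi> :: 'm \<Rightarrow> nat \<Rightarrow>\<^sub>0 int). Modules.additive \<phi> \<and>
        bij_betw \<phi> UNIV {c. Poly_Mapping.keys c \<subseteq> {..<n}})"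

text \<open>\<open>N\<^sub>\<real> = Hom(M, \<real>)\<close> with the pointwise operations.\<close>

typedef (overloaded) 'm NR = "{v :: 'm::ab_group_add \<Rightarrow> real. Modules.additive v}"
  morphisms pairing Abs_NR
  by (rule exI[of _ "\<lambda>_. 0"]) (simp add: Modules.additive_def)

setup_lifting type_definition_NR

instantiation NR :: (ab_group_add) real_vector
begin

lift_definition zero_NR :: "'a NR" is "\<lambda>_. 0" by (simp add: Modules.additive_def)
lift_definition plus_NR :: "'a NR \<Rightarrow> 'a NR \<Rightarrow> 'a NR" is "\<lambda>v w u. v u + w u"
  by (simp add: Modules.additive_def)
lift_definition minus_NR :: "'a NR \<Rightarrow> 'a NR \<Rightarrow> 'a NR" is "\<lambda>v w u. v u - w u"
  by (simp add: Modules.additive_def)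
lift_definition uminus_NR :: "'a NR \<Rightarrow> 'a NR" is "\<lambda>v u. - v u"
  by (simp add: Modules.additive_def)
lift_definition scaleR_NR :: "real \<Rightarrow> 'a NR \<Rightarrow> 'a NR" is "\<lambda>c v u. c * v u"
  by (simp add: Modules.additive_def distrib_left)

instance
  by standard (transfer; simp add: algebra_simps)+

end

text \<open>Cones are finitely generated; rational means that the generators can be taken in the
  lattice \<open>N = Hom(M, \<int>)\<close>.\<close>

definition rational_polyhedral_cone :: "'m::ab_group_add NR set \<Rightarrow> bool" where
  "rational_polyhedral_cone \<sigma> \<longleftrightarrow>
     (\<exists>G. finite G \<and> (\<forall>v\<in>G. \<forall>u. pairing v u \<in> \<int>) \<and> \<sigma> = convex_cone hull G)"

definition strongly_convex :: "'m::ab_group_add NR set \<Rightarrow> bool" where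
  "strongly_convex \<sigma> \<longleftrightarrow> (\<forall>v. v \<in> \<sigma> \<and> - v \<in> \<sigma> \<longrightarrow> v = 0)"

text \<open>The library relation \<open>face_of\<close> also admits the empty set, which is not a face of a cone.\<close>

definition cone_face_of :: "'a::real_vector set \<Rightarrow> 'a set \<Rightarrow> bool" where
  "cone_face_of \<tau> \<sigma> \<longleftrightarrow> \<tau> face_of \<sigma> \<and> \<tau> \<noteq> {}"

definition toric_monoid :: "'m::ab_group_add NR set \<Rightarrow> 'm set" where
  "toric_monoid \<sigma> = {u. \<forall>v\<in>\<sigma>. pairing v u \<le> 0}"

definition perp :: "'m::ab_group_add NR set \<Rightarrow> 'm set" where
  "perp \<tau> = {u. \<forall>v\<in>\<tau>. pairing v u = 0}"


section \<open>The semiring \<open>S[\<M>]\<close> and its congruences\<close>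

definition monoid_semiring :: "trop set \<Rightarrow> 'm set \<Rightarrow> ('m::comm_monoid_add \<Rightarrow>\<^sub>0 trop) set" where
  "monoid_semiring S Mon = {f. Poly_Mapping.keys f \<subseteq> Mon \<and> (\<forall>u. Poly_Mapping.lookup f u \<in> S)}"

definition congruence_on :: "'a::comm_semiring_1 set \<Rightarrow> ('a \<times> 'a) set \<Rightarrow> bool" where
  "congruence_on A E \<longleftrightarrow> equiv A E \<and>
     (\<forall>a b c d. (a, b) \<in> E \<longrightarrow> (c, d) \<in> E \<longrightarrow> (a + c, b + d) \<in> E \<and> (a * c, b * d) \<in> E)"

text \<open>The order and the cancellation law of the quotient \<open>A/P\<close> are written on representatives:
  \<open>[a] \<le> [b]\<close> iff \<open>[a] + [b] = [b]\<close>.\<close>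

definition quot_le :: "('a::comm_semiring_1 \<times> 'a) set \<Rightarrow> 'a \<Rightarrow> 'a \<Rightarrow> bool" where
  "quot_le P a b \<longleftrightarrow> (a + b, b) \<in> P"

definition prime_congruence_on :: "'a::comm_semiring_1 set \<Rightarrow> ('a \<times> 'a) set \<Rightarrow> bool" where
  "prime_congruence_on A P \<longleftrightarrow> congruence_on A P \<and> P \<noteq> A \<times> A \<and>
     (\<forall>a\<in>A. \<forall>b\<in>A. quot_le P a b \<or> quot_le P b a) \<and>
     (\<forall>a\<in>A. \<forall>b\<in>A. \<forall>c\<in>A. (a, 0) \<notin> P \<longrightarrow> (a * b, a * c) \<in> P \<longrightarrow> (b, c) \<in> P)"


section \<open>Tropical vanishing loci\<close>

text \<open>Homomorphisms are extended by \<open>undefined\<close> outside the toric monoid.\<close>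

definition NR_of :: "'m::ab_group_add NR set \<Rightarrow> ('m \<Rightarrow> ereal) set" where
  "NR_of \<sigma> = {x \<in> toric_monoid \<sigma> \<rightarrow>\<^sub>E {y. y \<noteq> \<infinity>}. x 0 = 0 \<and>
     (\<forall>u\<in>toric_monoid \<sigma>. \<forall>u'\<in>toric_monoid \<sigma>. x (u + u') = x u + x u')}"

text \<open>A supremum over a finite set, equal to \<open>- \<infinity>\<close> if the support is empty.\<close>

definition trop_eval :: "('m \<Rightarrow>\<^sub>0 trop) \<Rightarrow> real \<times> ('m \<Rightarrow> ereal) \<Rightarrow> ereal" where
  "trop_eval f = (\<lambda>(r, x).
     SUP u\<in>Poly_Mapping.keys f. ereal r * trop_log (Poly_Mapping.lookup f u) + x u)"

definition trop_V ::
  "'m::ab_group_add NR set \<Rightarrow> (('m \<Rightarrow>\<^sub>0 trop) \<times> ('m \<Rightarrow>\<^sub>0 trop)) set \<Rightarrow> (real \<times> ('m \<Rightarrow> ereal)) set" where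
  "trop_V \<sigma> E = {w \<in> {0..} \<times> NR_of \<sigma>. \<forall>(f, g)\<in>E. trop_eval f w = trop_eval g w}"

definition has_finite_tropical_basis ::
  "'m::ab_group_add NR set \<Rightarrow> (('m \<Rightarrow>\<^sub>0 trop) \<times> ('m \<Rightarrow>\<^sub>0 trop)) set \<Rightarrow> bool" where
  "has_finite_tropical_basis \<sigma> E \<longleftrightarrow> (\<exists>B. finite B \<and> B \<subseteq> E \<and> trop_V \<sigma> E = trop_V \<sigma> B)"


section \<open>The strata\<close>

text \<open>An element of \<open>\<real> \<times> N\<^sub>\<real>/\<tau>\<close> is a pair \<open>(r, c)\<close> with \<open>c\<close> a coset of \<open>span \<tau>\<close>.
  Linear notions in this quotient are expressed through the preimage in \<open>\<real> \<times> N\<^sub>\<real>\<close> under the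
  projection: a subset is a face of another one iff this holds for the preimages, and passing to
  the preimage raises the dimension by \<open>dim \<tau>\<close>.\<close>

definition stratum_proj :: "'m::ab_group_add NR set \<Rightarrow> real \<times> 'm NR \<Rightarrow> real \<times> 'm NR set" where
  "stratum_proj \<tau> = (\<lambda>(r, w). (r, w +o span \<tau>))"

definition polyhedral_cone_in_stratum ::
  "'m::ab_group_add NR set \<Rightarrow> (real \<times> 'm NR set) set \<Rightarrow> bool" where
  "polyhedral_cone_in_stratum \<tau> C \<longleftrightarrow>
     (\<exists>G. finite G \<and> G \<subseteq> {0..} \<times> UNIV \<and> C = stratum_proj \<tau> ` (convex_cone hull G))"

definition face_in_stratum ::
  "'m::ab_group_add NR set \<Rightarrow> (real \<times> 'm NR set) set \<Rightarrow> (real \<times> 'm NR set) set \<Rightarrow> bool" where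
  "face_in_stratum \<tau> C D \<longleftrightarrow> cone_face_of (stratum_proj \<tau> -` C) (stratum_proj \<tau> -` D)"

definition dim_in_stratum :: "'m::ab_group_add NR set \<Rightarrow> (real \<times> 'm NR set) set \<Rightarrow> nat" where
  "dim_in_stratum \<tau> C = dim (stratum_proj \<tau> -` C) - dim \<tau>"

text \<open>For \<open>u\<close> orthogonal to \<open>\<tau>\<close>, all representatives of a coset have the same pairing with \<open>u\<close>.\<close>

definition coset_pairing :: "'m::ab_group_add NR set \<Rightarrow> 'm \<Rightarrow> real" where
  "coset_pairing c u = pairing (SOME w. w \<in> c) u"

lemma coset_pairing_eq:
  assumes "u \<in> perp \<tau>"
  shows "coset_pairing (w +o span \<tau>) u = pairing w u"
proof -
  have lin: "pairing v u = 0" if "v \<in> span \<tau>" for v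
    using that
  proof (induction rule: span_induct)
    case base
    show ?case by (simp add: subspace_def zero_NR.rep_eq plus_NR.rep_eq scaleR_NR.rep_eq)
  next
    case (step v)
    then show ?case using assms by (simp add: perp_def)
  qed
  have "w + 0 \<in> w +o span \<tau>" by (rule set_plus_intro2) (rule span_zero)
  then have "(SOME w'. w' \<in> w +o span \<tau>) \<in> w +o span \<tau>" by (rule someI)
  then obtain v where "v \<in> span \<tau>" "(SOME w'. w' \<in> w +o span \<tau>) = w + v"
    by (auto simp: elt_set_plus_def)
  then show ?thesis by (simp add: coset_pairing_def plus_NR.rep_eq lin)
qed

definition stratum_incl ::
  "'m::ab_group_add NR set \<Rightarrow> 'm NR set \<Rightarrow> real \<times> 'm NR set \<Rightarrow> real \<times> ('m \<Rightarrow> ereal)" where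
  "stratum_incl \<sigma> \<tau> = (\<lambda>(r, c).
     (r, \<lambda>u\<in>toric_monoid \<sigma>. if u \<in> perp \<tau> then ereal (coset_pairing c u) else - \<infinity>))"


section \<open>Flags of cones and their prime congruences\<close>

text \<open>A flag \<open>C\<^sub>-\<^sub>1 \<le> C\<^sub>0 \<le> \<dots> \<le> C\<^sub>k\<close> is the nonempty list \<open>Cs\<close> of length \<open>k + 2\<close>
  with \<open>Cs ! j = C\<^sub>j\<^sub>-\<^sub>1\<close>.\<close>

definition flag_of_cones ::
  "'m::ab_group_add NR set \<Rightarrow> 'm NR set \<Rightarrow> (real \<times> 'm NR set) set list \<Rightarrow> bool" where
  "flag_of_cones \<sigma> \<tau> Cs \<longleftrightarrow> cone_face_of \<tau> \<sigma> \<and> Cs \<noteq> [] \<and>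
     (\<forall>j<length Cs. polyhedral_cone_in_stratum \<tau> (Cs ! j) \<and> dim_in_stratum \<tau> (Cs ! j) = j) \<and>
     (\<forall>j. Suc j < length Cs \<longrightarrow> face_in_stratum \<tau> (Cs ! j) (Cs ! Suc j))"

definition flag_contained_in ::
  "'m::ab_group_add NR set \<Rightarrow> 'm NR set \<Rightarrow> (real \<times> 'm NR set) set list \<Rightarrow> (real \<times> ('m \<Rightarrow> ereal)) set \<Rightarrow> bool" where
  "flag_contained_in \<sigma> \<tau> Cs X \<longleftrightarrow> (\<forall>C\<in>set Cs. stratum_incl \<sigma> \<tau> ` C \<subseteq> X)"

text \<open>\<open>None\<close> plays the role of \<open>- \<infinity>\<close>: it is the least element of \<open>real list option\<close>, and
  lists are ordered lexicographically.  All lists below have the same length as \<open>ws\<close>.\<close>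

definition flag_Phi_term ::
  "'m::ab_group_add NR set \<Rightarrow> (real \<times> 'm NR set) list \<Rightarrow> real \<Rightarrow> 'm \<Rightarrow> real list option" where
  "flag_Phi_term \<tau> ws a u =
     (if u \<in> perp \<tau> then Some (map (\<lambda>(r, c). r * a + coset_pairing c u) ws) else None)"

definition flag_Phi ::
  "'m::ab_group_add NR set \<Rightarrow> (real \<times> 'm NR set) list \<Rightarrow> ('m \<Rightarrow>\<^sub>0 trop) \<Rightarrow> real list option" where
  "flag_Phi \<tau> ws f = Max (insert None
     ((\<lambda>u. flag_Phi_term \<tau> ws (real_of_ereal (trop_log (Poly_Mapping.lookup f u))) u) `
        Poly_Mapping.keys f))"

definition flag_points :: "(real \<times> 'm::ab_group_add NR set) set list \<Rightarrow> (real \<times> 'm NR set) list" where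
  "flag_points Cs = (SOME ws. length ws + 1 = length Cs \<and>
     (\<forall>i<length ws. ws ! i \<in> Cs ! Suc i - Cs ! i))"

definition flag_congruence ::
  "trop set \<Rightarrow> 'm::ab_group_add NR set \<Rightarrow> 'm NR set \<Rightarrow> (real \<times> 'm NR set) set list \<Rightarrow>
   (('m \<Rightarrow>\<^sub>0 trop) \<times> ('m \<Rightarrow>\<^sub>0 trop)) set" where
  "flag_congruence S \<sigma> \<tau> Cs =
     {(f, g). f \<in> monoid_semiring S (toric_monoid \<sigma>) \<and> g \<in> monoid_semiring S (toric_monoid \<sigma>) \<and>
        flag_Phi \<tau> (flag_points Cs) f = flag_Phi \<tau> (flag_points Cs) g}"

end

theory Submission
  imports Defs
begin

text \<open>
  A prime congruence \<open>P\<close> totally orders the classes of the monomials \<open>t\<^sup>a \<chi>\<^sup>u\<close>, and a sum is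
  congruent to its largest term, so \<open>P\<close> is nothing but this order. The exponents \<open>u\<close> for which
  \<open>\<chi>\<^sup>u\<close> is not congruent to \<open>0\<close> form a face of the toric monoid (\<open>live_add_iff\<close>), and such a face
  is the orthogonal complement of a face \<open>\<tau>\<close> of \<open>\<sigma>\<close> (\<open>monoid_face_cut_out\<close>); this \<open>\<tau>\<close> names the
  stratum. On the remaining terms, cancellation extends the order to a total preorder on the group
  that they generate (\<open>group_order\<close>).

  The main point is that such a preorder is lexicographic: there are points \<open>w\<^sub>0, \<dots>, w\<^sub>k\<close> of
  \<open>\<real> \<times> N\<^sub>\<real>\<close> such that \<open>(a, u)\<close> is nonnegative iff the list of the numbers \<open>r\<^sub>i a + \<langle>x\<^sub>i, u\<rangle>\<close> is
  lexicographically nonnegative (\<open>lexicographic_representation\<close>). The terms are regarded as elements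
  of the dual of \<open>\<real> \<times> N\<^sub>\<real>\<close>. The convex cone that the nonnegative terms generate does not contain
  \<open>- g\<close> for a strictly positive term \<open>g\<close>: by simultaneous Diophantine approximation a real relation
  would give integral relations up to arbitrarily small scalars, which an archimedean argument
  excludes (\<open>positive_relation_trivial\<close>). By Zorn's lemma the cone therefore extends to the cone of a
  total preorder of the whole vector space (\<open>convex_cone_total_extension\<close>). A totally preordered
  vector space of finite dimension with an order unit \<open>e\<close> has the monotone functional
  \<open>v \<mapsto> sup {t. t e \<le> v}\<close>, and recursion on the kernel gives the lexicographic list of functionals
  (\<open>lexicographic_functionals\<close>), each of which is evaluation at a point \<open>w\<^sub>i\<close>.

  To compare such lists of points with flags of cones, \<open>w\<^sub>i\<close> is replaced by
  \<open>w'\<^sub>i = \<Sum>\<^sub>j\<^sub>\<le>\<^sub>i C\<^sup>i\<^sup>-\<^sup>j w\<^sub>j\<close>. This does not change the lexicographic order, and if \<open>C\<close> is large enough,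
  then for finitely many given pairs of terms the lexicographic comparison implies the comparison
  at every point of the cone spanned by the \<open>w'\<^sub>i\<close> (\<open>compatible_perturb\<close>). Applied to the scalar \<open>(1, 0)\<close>, the same
  argument moves the points into \<open>\<real>\<^sub>\<ge>\<^sub>0 \<times> N\<^sub>\<real>\<close>. Both directions use the perturbation.
  Let \<open>E \<subseteq> P\<close>. With the finitely many terms of a finite tropical basis, \<open>f\<close> and \<open>g\<close> in the basis
  have equivalent leading terms, which compute \<open>f\<close> and \<open>g\<close> at all points of the cones spanned by
  \<open>w'\<^sub>0, \<dots>, w'\<^sub>i\<close>. So these cones lie in the vanishing locus, and they form a flag since the \<open>w'\<^sub>i\<close>
  are linearly independent modulo the span of \<open>\<tau>\<close>. Conversely, given a flag in the vanishing locus and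
  \<open>(f, g) \<in> E\<close>, the points \<open>w'\<^sub>i\<close> formed from points \<open>w\<^sub>i\<close> of the flag lie in its largest cone. There \<open>f\<close> and
  \<open>g\<close> take the same values, which are the values of their leading terms; so the leading terms agree
  at all \<open>w'\<^sub>i\<close> and hence at all \<open>w\<^sub>i\<close>.
\<close>

section \<open>Lexicographic signs of lists of reals\<close>

text \<open>The first nonzero entry, if there is one, is positive. Stated through indices, since the changes
  of points below are given by triangular sums over indices.\<close>

definition lex_nonneg :: "real list \<Rightarrow> bool" where
  "lex_nonneg xs \<longleftrightarrow> (\<forall>i<length xs. (\<forall>j<i. xs ! j = 0) \<longrightarrow> 0 \<le> xs ! i)"

lemma lex_nonneg_Nil [simp]: "lex_nonneg []"
  by (simp add: lex_nonneg_def)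

lemma lex_nonneg_Cons: "lex_nonneg (x # xs) \<longleftrightarrow> 0 < x \<or> x = 0 \<and> lex_nonneg xs"
  by (cases x "0::real" rule: linorder_cases) (simp_all add: lex_nonneg_def All_less_Suc2)

lemma map_le_map_iff_lex_nonneg:
  fixes f g :: "'a \<Rightarrow> real"
  shows "map f ws \<le> map g ws \<longleftrightarrow> lex_nonneg (map (\<lambda>w. g w - f w) ws)"
  by (induction ws) (auto simp: lex_nonneg_Cons)

text \<open>A lower triangular change with positive diagonal multiplies the first nonzero entry by a positive
  number and does not move its position.\<close>

lemma lex_nonneg_triangular:
  assumes len: "length ys = length zs"
    and c: "\<And>i. i < length zs \<Longrightarrow> 0 < c i i"
    and ys: "\<And>i. i < length zs \<Longrightarrow> ys ! i = (\<Sum>j\<le>i. c i j * zs ! j)"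
  shows "lex_nonneg ys \<longleftrightarrow> lex_nonneg zs"
proof -
  have diag: "ys ! i = c i i * zs ! i" if "i < length zs" "\<forall>j<i. zs ! j = 0" for i
  proof -
    have "(\<Sum>j<i. c i j * zs ! j) = 0" using that by (intro sum.neutral) auto
    then show ?thesis using ys[OF that(1)] by (simp add: lessThan_Suc_atMost[symmetric])
  qed
  have prefix: "(\<forall>j<i. ys ! j = 0) \<longleftrightarrow> (\<forall>j<i. zs ! j = 0)" if "i \<le> length zs" for i
    using that
  proof (induction i)
    case (Suc i)
    then show ?case using diag[of i] c[of i] by (auto simp: less_Suc_eq)
  qed simp
  have "0 \<le> ys ! i \<longleftrightarrow> 0 \<le> zs ! i" if "i < length zs" "\<forall>j<i. zs ! j = 0" for i
    using diag[OF that] c[OF that(1)] by (simp add: zero_le_mult_iff)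
  then show ?thesis
    unfolding lex_nonneg_def len using prefix[OF less_imp_le] by auto
qed

text \<open>The sum is a polynomial in \<open>C\<close> whose leading coefficient is the first nonzero entry of the list.\<close>

lemma eventually_nonneg_of_lex_nonneg:
  assumes "lex_nonneg ds" and "i < length ds"
  shows "eventually (\<lambda>C. 0 \<le> (\<Sum>j\<le>i. C ^ (i - j) * ds ! j)) at_top"
proof (cases "\<forall>j\<le>i. ds ! j = 0")
  case True
  then show ?thesis by simp
next
  case False
  define p where "p i C = (\<Sum>j\<le>i. C ^ (i - j) * ds ! j)" for i and C :: real
  have p_Suc: "p (Suc i) C = C * p i C + ds ! Suc i" for i C
    by (simp add: p_def sum_distrib_left mult.assoc[symmetric] Suc_diff_le)
  define k where "k = (LEAST j. ds ! j \<noteq> 0)"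
  obtain j where j: "j \<le> i" "ds ! j \<noteq> 0" using False by auto
  have k0: "ds ! k \<noteq> 0" unfolding k_def by (rule LeastI[of _ j]) (rule j)
  have "k \<le> j" unfolding k_def by (rule Least_le) (rule j)
  with j have ki: "k \<le> i" by simp
  have below: "ds ! j = 0" if "j < k" for j
    using not_less_Least[of j "\<lambda>j. ds ! j \<noteq> 0"] that by (auto simp: k_def)
  have kpos: "0 < ds ! k"
  proof -
    have "k < length ds" using ki assms(2) by simp
    with below assms(1) have "0 \<le> ds ! k" by (simp add: lex_nonneg_def)
    with k0 show ?thesis by simp
  qed
  have "eventually (\<lambda>C. ds ! k \<le> p i C) at_top"
    using ki
  proof (induction i rule: dec_induct)
    case base
    have "(\<Sum>j<k. C ^ (k - j) * ds ! j) = 0" for C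
      using below by (intro sum.neutral) auto
    then show ?case by (simp add: p_def lessThan_Suc_atMost[symmetric])
  next
    case (step n)
    have "eventually (\<lambda>C. max 0 ((ds ! k - ds ! Suc n) / ds ! k) \<le> C) at_top"
      by (rule eventually_ge_at_top)
    with step.IH show ?case
    proof eventually_elim
      case (elim C)
      then have "ds ! k - ds ! Suc n \<le> C * ds ! k" using kpos by (simp add: field_simps)
      also have "\<dots> \<le> C * p n C" using elim by (intro mult_left_mono) auto
      finally show ?case by (simp add: p_Suc)
    qed
  qed
  then show ?thesis
    by eventually_elim (use kpos in \<open>simp add: p_def\<close>)
qed

section \<open>Convex cones and lexicographic functionals\<close>

lemma convex_cone_hull_image_eq:
  fixes x :: "'i \<Rightarrow> 'v::real_vector"
  assumes fin: "finite I"
  shows "convex_cone hull (x ` I) = {\<Sum>i\<in>I. c i *\<^sub>R x i | c. \<forall>i. 0 \<le> c i}" (is "_ = ?C")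
proof
  have "convex_cone ?C"
    unfolding convex_cone_iff
  proof (intro conjI ballI allI impI)
    show "0 \<in> ?C" by (rule CollectI, rule exI[of _ "\<lambda>_. 0"]) simp
  next
    fix v w assume "v \<in> ?C" "w \<in> ?C"
    then obtain c d where cd: "\<forall>i. 0 \<le> c i" "\<forall>i. 0 \<le> d i"
      and "v = (\<Sum>i\<in>I. c i *\<^sub>R x i)" "w = (\<Sum>i\<in>I. d i *\<^sub>R x i)" by blast
    then have "v + w = (\<Sum>i\<in>I. (c i + d i) *\<^sub>R x i)" "\<forall>i. 0 \<le> c i + d i"
      by (auto simp: scaleR_add_left sum.distrib)
    then show "v + w \<in> ?C" by (auto intro!: exI[of _ "\<lambda>i. c i + d i"])
  next
    fix v and t :: real assume "v \<in> ?C" "0 \<le> t"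
    then obtain c where c: "\<forall>i. 0 \<le> c i" "v = (\<Sum>i\<in>I. c i *\<^sub>R x i)" by blast
    then show "t *\<^sub>R v \<in> ?C"
      using \<open>0 \<le> t\<close> by (auto simp: scaleR_sum_right intro!: exI[of _ "\<lambda>i. t * c i"])
  qed
  moreover have "x ` I \<subseteq> ?C"
  proof
    fix v assume "v \<in> x ` I"
    then obtain k where k: "k \<in> I" "v = x k" by blast
    have "(\<Sum>i\<in>I. (if i = k then 1 else 0) *\<^sub>R x i) = (\<Sum>i\<in>I. if i = k then x i else 0)"
      by (intro sum.cong) auto
    with k fin have "v = (\<Sum>i\<in>I. (if i = k then 1 else 0) *\<^sub>R x i)" by simp
    then show "v \<in> ?C" by (auto intro!: exI[of _ "\<lambda>i. if i = k then 1 else 0"])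
  qed
  ultimately show "convex_cone hull (x ` I) \<subseteq> ?C" by (intro hull_minimal)
  show "?C \<subseteq> convex_cone hull (x ` I)"
  proof
    fix v assume "v \<in> ?C"
    then obtain c where c: "\<forall>i. 0 \<le> c i" and v: "v = (\<Sum>i\<in>I. c i *\<^sub>R x i)" by blast
    have "(\<Sum>i\<in>J. c i *\<^sub>R x i) \<in> convex_cone hull (x ` I)" if "J \<subseteq> I" for J
      using finite_subset[OF that fin] that
    proof (induction J)
      case empty
      then show ?case by (simp add: convex_cone_hull_contains_0)
    next
      case (insert i J)
      moreover have "c i *\<^sub>R x i \<in> convex_cone hull (x ` I)"
        using c insert.prems by (intro convex_cone_hull_mul hull_inc) auto
      ultimately show ?case by (simp add: convex_cone_hull_add)
    qed
    then show "v \<in> convex_cone hull (x ` I)" by (simp add: v)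
  qed
qed

lemma convex_cone_hull_finite_subset:
  fixes X :: "'v::real_vector set"
  assumes "v \<in> convex_cone hull X"
  shows "\<exists>F. finite F \<and> F \<subseteq> X \<and> v \<in> convex_cone hull F"
  using assms
proof (rule hull_induct)
  fix x assume "x \<in> X"
  then show "\<exists>F. finite F \<and> F \<subseteq> X \<and> x \<in> convex_cone hull F"
    by (intro exI[of _ "{x}"]) (simp add: hull_inc)
next
  show "convex_cone {v. \<exists>F. finite F \<and> F \<subseteq> X \<and> v \<in> convex_cone hull F}"
    unfolding convex_cone_iff[of "{v. _ v}"] mem_Collect_eq
  proof (intro conjI ballI allI impI, goal_cases)
    case 1
    show ?case by (intro exI[of _ "{}"]) simp
  next
    case (2 v w)
    then obtain F G where FG: "finite F" "F \<subseteq> X" "finite G" "G \<subseteq> X"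
      and "v \<in> convex_cone hull F" "w \<in> convex_cone hull G" by blast
    then have "v \<in> convex_cone hull (F \<union> G)" "w \<in> convex_cone hull (F \<union> G)"
      by (meson hull_mono in_mono sup_ge1 sup_ge2)+
    with FG show ?case
      by (intro exI[of _ "F \<union> G"]) (simp add: convex_cone_hull_add)
  next
    case (3 v t)
    then show ?case by (blast intro: convex_cone_hull_mul)
  qed
qed

text \<open>A convex cone \<open>K\<close> that is maximal among those avoiding \<open>- X\<close> is total: if \<open>v \<notin> K\<close>, then the cone
  generated by \<open>K\<close> and \<open>v\<close> contains some \<open>- x = c v + k\<close> with \<open>c > 0\<close>, and so \<open>- v = (x + k) / c\<close>
  lies in \<open>K\<close>.\<close>

lemma convex_cone_total_extension:
  fixes K0 :: "'v::real_vector set"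
  assumes K0: "convex_cone K0" and X: "X \<subseteq> K0" "\<And>x. x \<in> X \<Longrightarrow> - x \<notin> K0"
  obtains K where "convex_cone K" "K0 \<subseteq> K" "\<And>x. x \<in> X \<Longrightarrow> - x \<notin> K" "\<And>v. v \<in> K \<or> - v \<in> K"
proof -
  let ?A = "{K. convex_cone K \<and> K0 \<subseteq> K \<and> (\<forall>x\<in>X. - x \<notin> K)}"
  have "\<exists>M\<in>?A. \<forall>K\<in>?A. M \<subseteq> K \<longrightarrow> K = M"
  proof (rule subset_Zorn_nonempty)
    show "?A \<noteq> {}" using K0 X by blast
  next
    fix \<C> assume ne: "\<C> \<noteq> {}" and chain: "subset.chain ?A \<C>"
    then have mem: "convex_cone K" "K0 \<subseteq> K" "\<forall>x\<in>X. - x \<notin> K" if "K \<in> \<C>" for K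
      using that by (auto simp: subset.chain_def)
    have "convex_cone (\<Union>\<C>)"
      unfolding convex_cone_iff
    proof (intro conjI ballI allI impI)
      show "0 \<in> \<Union>\<C>" using ne mem(1) convex_cone_contains_0 by blast
    next
      fix v w assume "v \<in> \<Union>\<C>" "w \<in> \<Union>\<C>"
      then obtain K L where KL: "K \<in> \<C>" "L \<in> \<C>" "v \<in> K" "w \<in> L" by blast
      then have "K \<subseteq> L \<or> L \<subseteq> K" using chain by (auto simp: subset_chain_def)
      with KL mem(1) show "v + w \<in> \<Union>\<C>" by (meson UnionI convex_cone_add subsetD)
    next
      fix v and t :: real assume "v \<in> \<Union>\<C>" "0 \<le> t"
      then show "t *\<^sub>R v \<in> \<Union>\<C>" using mem(1) convex_cone_scaleR by blast
    qed
    with ne mem show "\<Union>\<C> \<in> ?A" by blast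
  qed
  then obtain K where KA: "K \<in> ?A" and max: "\<forall>L\<in>?A. K \<subseteq> L \<longrightarrow> L = K" by (elim bexE)
  from KA have K: "convex_cone K" "K0 \<subseteq> K" "\<And>x. x \<in> X \<Longrightarrow> - x \<notin> K" by simp_all
  have "- v \<in> K" if v: "v \<notin> K" for v
  proof -
    let ?L = "convex_cone hull (insert v K)"
    have sub: "K \<subseteq> ?L" "v \<in> ?L" by (auto intro: hull_inc)
    have "?L \<notin> ?A" using max sub v by auto
    then obtain x where x: "x \<in> X" "- x \<in> ?L"
      using sub(1) K(2) convex_cone_convex_cone_hull by auto
    have hullK: "convex_cone hull K = K" using K(1) by (rule hull_same)
    have "?L = (\<Union>y\<in>convex_cone hull {v}. \<Union>z\<in>K. {y + z})"
      using convex_cone_hull_Un[of "{v}" K] hullK by simp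
    moreover have "convex_cone hull {v} = {c *\<^sub>R v | c. 0 \<le> c}"
      using convex_cone_hull_image_eq[of "{v}" id] by (auto intro: exI[of _ "\<lambda>_. _"])
    ultimately obtain c k where ck: "0 \<le> c" "k \<in> K" "- x = c *\<^sub>R v + k" using x(2) by auto
    have "c \<noteq> 0" using ck K(3)[OF x(1)] by auto
    with ck have "0 < c" by simp
    have "x = - (c *\<^sub>R v + k)" using ck(3) by (metis minus_minus)
    then have "c *\<^sub>R (- v) = x + k" by simp
    then have "(1 / c) *\<^sub>R (x + k) = (1 / c) *\<^sub>R c *\<^sub>R (- v)" by simp
    then have "- v = (1 / c) *\<^sub>R (x + k)" using \<open>0 < c\<close> by simp
    moreover have "x + k \<in> K" using x(1) X(1) K(1,2) ck(2) by (blast intro: convex_cone_add)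
    ultimately show ?thesis using K(1) \<open>0 < c\<close> convex_cone_scaleR[of K "1/c"] by simp
  qed
  with K that show ?thesis by blast
qed

text \<open>Write \<open>v \<le> w\<close> for \<open>w - v \<in> K\<close>. The sum \<open>e\<close> of the absolute values of the generators \<open>B\<close> is an order
  unit, and the functional sends \<open>v\<close> to the supremum of all \<open>t\<close> with \<open>t e \<le> v\<close>. Linearity is proved
  through the relation \<open>R v r\<close>, which says that \<open>r\<close> separates the \<open>t\<close> with \<open>t e \<le> v\<close> from those with
  \<open>v \<le> t e\<close>: such an \<open>r\<close> is unique, and the relation is visibly compatible with the vector space
  operations.\<close>

lemma monotone_functional_exists:
  fixes K :: "'v::real_vector set"
  assumes K: "convex_cone K" and total: "\<And>v. v \<in> span B \<Longrightarrow> v \<in> K \<or> - v \<in> K"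
    and fin: "finite B" and nontriv: "\<not> span B \<subseteq> K"
  obtains \<phi> where "linear \<phi>" "\<And>v. v \<in> span B \<Longrightarrow> v \<in> K \<Longrightarrow> (0::real) \<le> \<phi> v"
    "\<exists>e\<in>span B. \<phi> e = 1"
proof -
  note add = convex_cone_add[OF K] and scale = convex_cone_scaleR[OF K]
  define b' where "b' b = (if b \<in> K then b else - b)" for b
  define e where "e = (\<Sum>b\<in>B. b' b)"
  have b'_K: "b' b \<in> K" if "b \<in> B" for b
    using total[of b] that by (auto simp: b'_def span_base)
  have e_span: "e \<in> span B"
    unfolding e_def b'_def by (intro span_sum) (auto simp: span_base span_neg)
  have sum_K: "sum b' J \<in> K" if "J \<subseteq> B" for J
    using finite_subset[OF that fin] that b'_K
    by (induction J) (auto simp: convex_cone_contains_0[OF K] add)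
  have bounded: "\<exists>t. t *\<^sub>R e - v \<in> K \<and> t *\<^sub>R e + v \<in> K" if "v \<in> span B" for v
    using that
  proof (induction rule: span_induct)
    case base
    show ?case
    proof (rule subspaceI, simp_all, goal_cases)
      case 1
      show ?case by (rule exI[of _ 0]) (simp add: convex_cone_contains_0[OF K])
    next
      case (2 x y)
      then obtain s t where "s *\<^sub>R e - x \<in> K" "s *\<^sub>R e + x \<in> K" "t *\<^sub>R e - y \<in> K" "t *\<^sub>R e + y \<in> K"
        by blast
      then have "(s *\<^sub>R e - x) + (t *\<^sub>R e - y) \<in> K" "(s *\<^sub>R e + x) + (t *\<^sub>R e + y) \<in> K"
        by (auto intro: add)
      then show ?case by (intro exI[of _ "s + t"]) (simp add: algebra_simps)
    next
      case (3 c x)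
      then obtain s where s: "s *\<^sub>R e - x \<in> K" "s *\<^sub>R e + x \<in> K" by blast
      then have 1: "\<bar>c\<bar> *\<^sub>R (s *\<^sub>R e - x) \<in> K" "\<bar>c\<bar> *\<^sub>R (s *\<^sub>R e + x) \<in> K"
        by (auto intro: scale)
      show ?case
      proof (cases "0 \<le> c")
        case True
        with 1 show ?thesis by (intro exI[of _ "\<bar>c\<bar> * s"]) (simp add: algebra_simps)
      next
        case False
        then have "(\<bar>c\<bar> * s) *\<^sub>R e - c *\<^sub>R x = \<bar>c\<bar> *\<^sub>R (s *\<^sub>R e + x)"
          "(\<bar>c\<bar> * s) *\<^sub>R e + c *\<^sub>R x = \<bar>c\<bar> *\<^sub>R (s *\<^sub>R e - x)"
          by (simp_all add: algebra_simps)
        with 1 show ?thesis by metis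
      qed
    qed
  next
    case (step b)
    have "e = b' b + sum b' (B - {b})"
      using step fin by (simp add: e_def sum.remove)
    moreover have "sum b' (B - {b}) \<in> K" by (rule sum_K) auto
    moreover have "e \<in> K" unfolding e_def by (rule sum_K) auto
    ultimately have "e - b' b \<in> K" "e + b' b \<in> K" using b'_K[OF step] by (auto intro: add)
    then show ?case by (intro exI[of _ 1]) (auto simp: b'_def split: if_splits)
  qed
  have e_K: "e \<in> K" unfolding e_def by (rule sum_K) auto
  have neg_e: "t *\<^sub>R e \<notin> K" if "t < 0" for t
  proof
    assume "t *\<^sub>R e \<in> K"
    then have "(1 / \<bar>t\<bar>) *\<^sub>R t *\<^sub>R e \<in> K" by (rule scale[rotated]) simp
    with that have me: "- e \<in> K" by simp
    have "v \<in> K" if v: "v \<in> span B" for v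
    proof -
      obtain s where s: "s *\<^sub>R e + v \<in> K" using bounded[OF v] by blast
      have "(- s) *\<^sub>R e \<in> K"
        using scale[of "\<bar>s\<bar>" "e"] scale[of "\<bar>s\<bar>" "- e"] e_K me by (cases "0 \<le> s") auto
      from add[OF s this] show ?thesis by simp
    qed
    with nontriv show False by blast
  qed
  define R where "R v r \<longleftrightarrow> (\<forall>t<r. v - t *\<^sub>R e \<in> K) \<and> (\<forall>t>r. t *\<^sub>R e - v \<in> K)" for v r
  \<comment> \<open>If \<open>r < s\<close>, two numbers \<open>t < t'\<close> between them give \<open>t' e \<le> v \<le> t e\<close>.\<close>
  have R_unique: "r = s" if "R v r" "R v s" for v r s
  proof (rule ccontr)
    have less: False if rs: "R v r" "R v s" "r < s" for r s
    proof -
      obtain t where t: "r < t" "t < s" using rs(3) dense by blast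
      obtain t' where t': "t < t'" "t' < s" using t(2) dense by blast
      have "(t *\<^sub>R e - v) + (v - t' *\<^sub>R e) \<in> K"
        using rs t t' by (intro add) (auto simp: R_def)
      then have "(t - t') *\<^sub>R e \<in> K" by (simp add: algebra_simps)
      with neg_e[of "t - t'"] t' show False by simp
    qed
    assume "r \<noteq> s"
    with less that show False by (meson linorder_neqE_linordered_idom)
  qed
  have R_exists: "\<exists>r. R v r" if v: "v \<in> span B" for v
  proof -
    let ?A = "{t. v - t *\<^sub>R e \<in> K}"
    obtain s where s: "s *\<^sub>R e - v \<in> K" "s *\<^sub>R e + v \<in> K" using bounded[OF v] by blast
    have ne: "- s \<in> ?A" using s by (simp add: algebra_simps)
    have "t \<le> s" if "t \<in> ?A" for t
    proof (rule ccontr)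
      assume "\<not> t \<le> s"
      have "(s *\<^sub>R e - v) + (v - t *\<^sub>R e) \<in> K" using s that by (intro add) auto
      then have "(s - t) *\<^sub>R e \<in> K" by (simp add: algebra_simps)
      with neg_e[of "s - t"] \<open>\<not> t \<le> s\<close> show False by simp
    qed
    then have bdd: "bdd_above ?A" by (auto simp: bdd_above_def)
    have "R v (Sup ?A)"
      unfolding R_def
    proof (intro conjI allI impI)
      fix t assume "t < Sup ?A"
      then obtain t' where t': "t' \<in> ?A" "t < t'" using ne less_cSup_iff[OF _ bdd] by blast
      have "(v - t' *\<^sub>R e) + (t' - t) *\<^sub>R e \<in> K" using t' by (intro add scale e_K) auto
      then show "v - t *\<^sub>R e \<in> K" by (simp add: algebra_simps)
    next
      fix t assume "Sup ?A < t"
      then have "t \<notin> ?A" using bdd by (meson cSup_upper leD)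
      moreover have "v - t *\<^sub>R e \<in> span B" by (intro span_diff v span_scale e_span)
      ultimately have "- (v - t *\<^sub>R e) \<in> K" using total by blast
      then show "t *\<^sub>R e - v \<in> K" by simp
    qed
    then show ?thesis ..
  qed
  have R_add: "R (v + w) (r + s)" if "R v r" "R w s" for v w r s
    unfolding R_def
  proof (intro conjI allI impI)
    fix t assume "t < r + s"
    then have "(v - (r - (r + s - t) / 2) *\<^sub>R e) + (w - (s - (r + s - t) / 2) *\<^sub>R e) \<in> K"
      using that by (intro add) (auto simp: R_def)
    moreover have "(v - (r - (r + s - t) / 2) *\<^sub>R e) + (w - (s - (r + s - t) / 2) *\<^sub>R e)
        = v + w - ((r - (r + s - t) / 2) + (s - (r + s - t) / 2)) *\<^sub>R e"
      by (simp only: algebra_simps)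
    moreover have "(r - (r + s - t) / 2) + (s - (r + s - t) / 2) = t" by (simp add: field_simps)
    ultimately show "v + w - t *\<^sub>R e \<in> K" by simp
  next
    fix t assume "r + s < t"
    then have "((r - (r + s - t) / 2) *\<^sub>R e - v) + ((s - (r + s - t) / 2) *\<^sub>R e - w) \<in> K"
      using that by (intro add) (auto simp: R_def)
    moreover have "((r - (r + s - t) / 2) *\<^sub>R e - v) + ((s - (r + s - t) / 2) *\<^sub>R e - w)
        = ((r - (r + s - t) / 2) + (s - (r + s - t) / 2)) *\<^sub>R e - (v + w)"
      by (simp only: algebra_simps)
    moreover have "(r - (r + s - t) / 2) + (s - (r + s - t) / 2) = t" by (simp add: field_simps)
    ultimately show "t *\<^sub>R e - (v + w) \<in> K" by simp
  qed
  have R_pos: "R (c *\<^sub>R v) (c * r)" if "R v r" "0 < c" for c v r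
    unfolding R_def
  proof (intro conjI allI impI)
    fix t assume "t < c * r"
    then have "t / c < r" using that by (simp add: field_simps)
    then have "c *\<^sub>R (v - (t / c) *\<^sub>R e) \<in> K" using that by (intro scale) (auto simp: R_def)
    then show "c *\<^sub>R v - t *\<^sub>R e \<in> K" using that by (simp add: algebra_simps)
  next
    fix t assume "c * r < t"
    then have "r < t / c" using that by (simp add: field_simps)
    then have "c *\<^sub>R ((t / c) *\<^sub>R e - v) \<in> K" using that by (intro scale) (auto simp: R_def)
    then show "t *\<^sub>R e - c *\<^sub>R v \<in> K" using that by (simp add: algebra_simps)
  qed
  have R_neg: "R (- v) (- r)" if "R v r" for v r
    unfolding R_def
  proof (intro conjI allI impI)
    fix t assume "t < - r"
    then have "r < - t" by simp
    then have "(- t) *\<^sub>R e - v \<in> K" using that unfolding R_def by blast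
    moreover have "(- t) *\<^sub>R e - v = - v - t *\<^sub>R e" by simp
    ultimately show "- v - t *\<^sub>R e \<in> K" by (simp only:)
  next
    fix t assume "- r < t"
    then have "- t < r" by simp
    then have "v - (- t) *\<^sub>R e \<in> K" using that unfolding R_def by blast
    then show "t *\<^sub>R e - - v \<in> K" by (simp add: algebra_simps)
  qed
  have R_e: "R e 1"
    unfolding R_def
  proof (intro conjI allI impI)
    fix t :: real assume "t < 1"
    then have "(1 - t) *\<^sub>R e \<in> K" by (intro scale e_K) auto
    then show "e - t *\<^sub>R e \<in> K" by (simp add: algebra_simps)
  next
    fix t :: real assume "1 < t"
    then have "(t - 1) *\<^sub>R e \<in> K" by (intro scale e_K) auto
    then show "t *\<^sub>R e - e \<in> K" by (simp add: algebra_simps)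
  qed
  have R_0: "R 0 0"
    using R_add[OF R_e R_neg[OF R_e]] by simp
  have R_scale: "R (c *\<^sub>R v) (c * r)" if "R v r" for c v r
  proof (cases c "0::real" rule: linorder_cases)
    case less
    then show ?thesis using R_neg[OF R_pos[OF that, of "- c"]] by simp
  next
    case equal
    then show ?thesis using R_0 by simp
  next
    case greater
    then show ?thesis using R_pos[OF that] by blast
  qed
  obtain B0 where B0: "B0 \<subseteq> B" "independent B0" "B \<subseteq> span B0"
    by (rule maximal_independent_subset)
  have span_B0: "span B0 = span B"
    using B0 by (metis span_mono span_span subset_antisym)
  define r where "r v = (SOME r. R v r)" for v
  obtain \<phi> :: "'v \<Rightarrow> real" where \<phi>: "linear \<phi>" "\<And>b. b \<in> B0 \<Longrightarrow> \<phi> b = r b"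
    using linear_independent_extend[OF B0(2), of r] by blast
  have R_\<phi>: "R v (\<phi> v)" if "v \<in> span B" for v
    using that unfolding span_B0[symmetric]
  proof (induction rule: span_induct)
    case base
    show ?case
      by (rule subspaceI)
        (auto simp: linear_0[OF \<phi>(1)] linear_add[OF \<phi>(1)] linear_scale[OF \<phi>(1)] R_0 R_add R_scale)
  next
    case (step b)
    then have "b \<in> span B" using B0(1) by (auto intro: span_base)
    then show ?case unfolding \<phi>(2)[OF step] r_def by (rule someI_ex[OF R_exists])
  qed
  show ?thesis
  proof (rule that)
    show "linear \<phi>" by (rule \<phi>)
    show "\<exists>e\<in>span B. \<phi> e = 1" using R_unique[OF R_\<phi>[OF e_span] R_e] e_span by blast
    show "0 \<le> \<phi> v" if "v \<in> span B" "v \<in> K" for v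
    proof (rule ccontr)
      assume "\<not> 0 \<le> \<phi> v"
      then have "(\<phi> v / 2) *\<^sub>R e - v \<in> K" using R_\<phi>[OF that(1)] by (simp add: R_def)
      from add[OF this that(2)] have "(\<phi> v / 2) *\<^sub>R e \<in> K" by simp
      with neg_e[of "\<phi> v / 2"] \<open>\<not> 0 \<le> \<phi> v\<close> show False by simp
    qed
  qed
qed

text \<open>The number of generators replaces the dimension as the measure of the recursion below, because the
  ambient type need not have finite dimension. The projection along a generator \<open>b\<close> with \<open>\<phi> b \<noteq> 0\<close> maps
  the span onto the kernel and kills \<open>b\<close>.\<close>

lemma span_Int_kernel:
  fixes \<phi> :: "'v::real_vector \<Rightarrow> real"
  assumes \<phi>: "linear \<phi>" and fin: "finite B" and nz: "\<exists>e\<in>span B. \<phi> e \<noteq> 0"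
  obtains B' where "finite B'" "card B' < card B" "span B' = {v \<in> span B. \<phi> v = 0}"
proof -
  obtain b where b: "b \<in> B" "\<phi> b \<noteq> 0"
    using nz linear_eq_0_on_span[OF \<phi>] by blast
  define \<pi> where "\<pi> v = v - (\<phi> v / \<phi> b) *\<^sub>R b" for v
  have lin: "linear \<pi>"
    by (rule linearI)
      (simp_all add: \<pi>_def linear_add[OF \<phi>] linear_scale[OF \<phi>] algebra_simps add_divide_distrib)
  have ker: "\<phi> (\<pi> v) = 0" for v
    using b by (simp add: \<pi>_def linear_diff[OF \<phi>] linear_scale[OF \<phi>])
  have "\<pi> b = 0" using b by (simp add: \<pi>_def)
  then have "\<pi> ` B = insert 0 (\<pi> ` (B - {b}))" using b by (metis image_insert insert_Diff)
  then have "span (\<pi> ` (B - {b})) = span (\<pi> ` B)" by simp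
  also have "\<dots> = \<pi> ` span B" by (rule linear_span_image[OF lin])
  also have "\<dots> = {v \<in> span B. \<phi> v = 0}"
  proof (intro equalityI subsetI)
    fix v assume "v \<in> \<pi> ` span B"
    then show "v \<in> {v \<in> span B. \<phi> v = 0}"
      using b ker by (auto simp: \<pi>_def intro: span_diff span_scale span_base)
  next
    fix v assume v: "v \<in> {v \<in> span B. \<phi> v = 0}"
    then have "v = \<pi> v" by (simp add: \<pi>_def)
    with v show "v \<in> \<pi> ` span B" by blast
  qed
  finally have "span (\<pi> ` (B - {b})) = {v \<in> span B. \<phi> v = 0}" .
  moreover have "card (\<pi> ` (B - {b})) < card B"
    using card_image_le[of "B - {b}" \<pi>] fin b card_Diff1_less[OF fin b(1)] by auto
  ultimately show ?thesis using fin that[of "\<pi> ` (B - {b})"] by auto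
qed

text \<open>By recursion on the kernel of a monotone functional: the order is decided by the first functional
  that does not vanish on \<open>v\<close>. The vectors \<open>es\<close> record that every functional of the list is nonzero on
  the common kernel of its predecessors; this triangularity later gives the dimensions of the cones of
  a flag.\<close>

lemma lexicographic_functionals:
  fixes K :: "'v::real_vector set"
  assumes "finite B" "convex_cone K" and "\<And>v. v \<in> span B \<Longrightarrow> v \<in> K \<or> - v \<in> K"
  shows "\<exists>fs es. length es = length fs \<and> set es \<subseteq> span B \<and> (\<forall>f\<in>set fs. linear (f :: 'v \<Rightarrow> real)) \<and>
    (\<forall>i<length fs. (fs ! i) (es ! i) \<noteq> 0 \<and> (\<forall>j<i. (fs ! j) (es ! i) = 0)) \<and>
    (\<forall>v\<in>span B. v \<in> K \<longleftrightarrow> lex_nonneg (map (\<lambda>f. f v) fs))"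
  using assms
proof (induction "card B" arbitrary: B rule: less_induct)
  case less
  show ?case
  proof (cases "span B \<subseteq> K")
    case True
    then show ?thesis by (intro exI[of _ "[]"]) auto
  next
    case False
    obtain \<phi> where \<phi>: "linear \<phi>" "\<And>v. v \<in> span B \<Longrightarrow> v \<in> K \<Longrightarrow> (0::real) \<le> \<phi> v"
      and "\<exists>e\<in>span B. \<phi> e = 1"
      using monotone_functional_exists[OF less.prems(2,3,1) False] by metis
    then obtain e where e: "e \<in> span B" "\<phi> e \<noteq> 0" by force
    obtain B' where B': "finite B'" "card B' < card B" "span B' = {v \<in> span B. \<phi> v = 0}"
      by (rule span_Int_kernel[OF \<phi>(1) less.prems(1)]) (use e in blast)
    obtain fs es where IH: "length es = length fs" "set es \<subseteq> span B'"
      "\<forall>f\<in>set fs. linear (f :: 'v \<Rightarrow> real)"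
      "\<forall>i<length fs. (fs ! i) (es ! i) \<noteq> 0 \<and> (\<forall>j<i. (fs ! j) (es ! i) = 0)"
      "\<forall>v\<in>span B'. v \<in> K \<longleftrightarrow> lex_nonneg (map (\<lambda>f. f v) fs)"
      using less.hyps[OF B'(2,1) less.prems(2)] less.prems(3) B'(3) by auto
    have "v \<in> K \<longleftrightarrow> 0 < \<phi> v \<or> \<phi> v = 0 \<and> lex_nonneg (map (\<lambda>f. f v) fs)" if v: "v \<in> span B" for v
    proof (cases "\<phi> v" "0::real" rule: linorder_cases)
      case less
      then show ?thesis using \<phi>(2)[OF v] by auto
    next
      case equal
      then show ?thesis using IH(5) v B'(3) by auto
    next
      case greater
      then have "\<not> - v \<in> K"
        using \<phi>(2)[of "- v"] v by (auto simp: linear_neg[OF \<phi>(1)] span_neg)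
      with less.prems(3)[OF v] greater show ?thesis by auto
    qed
    moreover have "((\<phi> # fs) ! i) ((e # es) ! i) \<noteq> 0 \<and> (\<forall>j<i. ((\<phi> # fs) ! j) ((e # es) ! i) = 0)"
      if "i < length (\<phi> # fs)" for i
    proof (cases i)
      case 0
      then show ?thesis using e by simp
    next
      case (Suc k)
      then have "es ! k \<in> set es" using that IH(1) by simp
      then have "\<phi> (es ! k) = 0" using IH(2) B'(3) by auto
      then show ?thesis using that Suc IH(4) by (simp add: All_less_Suc2)
    qed
    moreover have "set (e # es) \<subseteq> span B" using IH(2) B'(3) e(1) by auto
    ultimately show ?thesis
      using IH(1,3) \<phi>(1)
      by (intro exI[of _ "\<phi> # fs"] exI[of _ "e # es"]) (simp add: lex_nonneg_Cons)
  qed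
qed

section \<open>Terms as functionals on \<open>\<real> \<times> N\<^sub>\<real>\<close>\<close>

text \<open>The dual of \<open>\<real> \<times> N\<^sub>\<real>\<close> is the vector space in which the terms live and in which their cones are
  formed. It has to be a type, so that it can be an instance of \<open>real_vector\<close>.\<close>

typedef (overloaded) 'v dual = "{f :: 'v::real_vector \<Rightarrow> real. linear f}"
  morphisms dual_apply Abs_dual
  by (rule exI[of _ "\<lambda>_. 0"]) (simp add: linear_zero)

setup_lifting type_definition_dual

instantiation dual :: (real_vector) real_vector
begin

lift_definition zero_dual :: "'a dual" is "\<lambda>_. 0" by (rule linear_zero)
lift_definition plus_dual :: "'a dual \<Rightarrow> 'a dual \<Rightarrow> 'a dual" is "\<lambda>f g w. f w + g w"
  by (rule linear_compose_add)
lift_definition minus_dual :: "'a dual \<Rightarrow> 'a dual \<Rightarrow> 'a dual" is "\<lambda>f g w. f w - g w"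
  by (rule linear_compose_sub)
lift_definition uminus_dual :: "'a dual \<Rightarrow> 'a dual" is "\<lambda>f w. - f w"
  by (rule linear_compose_neg)
lift_definition scaleR_dual :: "real \<Rightarrow> 'a dual \<Rightarrow> 'a dual" is "\<lambda>c f w. c * f w"
  by (simp add: linear_iff algebra_simps)

instance
  by standard (transfer; simp add: algebra_simps)+

end

lemma dual_apply_sum: "dual_apply (\<Sum>i\<in>I. f i) w = (\<Sum>i\<in>I. dual_apply (f i) w)"
  by (induction I rule: infinite_finite_induct) (simp_all add: zero_dual.rep_eq plus_dual.rep_eq)

lemma linear_dual_apply: "linear (dual_apply e)"
  using dual_apply by blast

lemma pairing_add [simp]: "pairing x (u + v) = pairing x u + pairing x v"
  using pairing[of x] by (simp add: Modules.additive_def)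

lemma pairing_zero [simp]: "pairing x 0 = 0"
  using pairing[of x] by (simp add: Modules.additive.zero)

lemma pairing_uminus [simp]: "pairing x (- u) = - pairing x u"
  using pairing[of x] by (simp add: Modules.additive.minus)

lemma pairing_diff [simp]: "pairing x (u - v) = pairing x u - pairing x v"
  using pairing[of x] by (simp add: Modules.additive.diff)

lemma pairing_sum: "pairing x (\<Sum>i\<in>I. u i) = (\<Sum>i\<in>I. pairing x (u i))"
  using pairing[of x] by (simp add: Modules.additive.sum)

text \<open>The linear form \<open>r a + \<langle>x, u\<rangle>\<close> in the point \<open>(r, x)\<close>, for the term \<open>t\<^sup>a \<chi>\<^sup>u\<close> encoded as \<open>(a, u)\<close>.\<close>

definition weight :: "real \<times> 'm::ab_group_add \<Rightarrow> real \<times> 'm NR \<Rightarrow> real" where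
  "weight g w = fst w * fst g + pairing (snd w) (snd g)"

lemma linear_weight: "linear (weight g)"
  by (rule linearI)
    (simp_all add: weight_def plus_NR.rep_eq scaleR_NR.rep_eq algebra_simps)

lemma weight_add: "weight (g + h) w = weight g w + weight h w"
  and weight_diff: "weight (g - h) w = weight g w - weight h w"
  and weight_uminus: "weight (- g) w = - weight g w"
  by (simp_all add: weight_def algebra_simps)

lift_definition weight_dual :: "real \<times> 'm::ab_group_add \<Rightarrow> (real \<times> 'm NR) dual" is weight
  by (rule linear_weight)

lemma weight_dual_uminus: "weight_dual (- g) = - weight_dual g"
  by transfer (simp add: weight_uminus fun_eq_iff)

lemma weight_dual_add: "weight_dual (g + h) = weight_dual g + weight_dual h"
  by transfer (simp add: weight_add fun_eq_iff)

lemma weight_dual_split: "weight_dual (a, u) = a *\<^sub>R weight_dual (1, 0) + weight_dual (0, u)"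
  by transfer (simp add: weight_def fun_eq_iff)

text \<open>Integrality of the coordinates serves the approximation argument; the expansion of \<open>pairing x u\<close> puts
  all terms into the span of finitely many elements of the dual of \<open>\<real> \<times> N\<^sub>\<real>\<close>.\<close>

lemma lattice_coordinates:
  assumes "fg_free_abelian_group TYPE('m::ab_group_add)"
  obtains n and coord :: "nat \<Rightarrow> 'm::ab_group_add \<Rightarrow> int" and b :: "nat \<Rightarrow> 'm" where
    "\<And>i. Modules.additive (coord i)"
    "\<And>u. (\<And>i. i < n \<Longrightarrow> coord i u = 0) \<Longrightarrow> u = 0"
    "\<And>x u. pairing x u = (\<Sum>i<n. real_of_int (coord i u) * pairing x (b i))"
proof -
  obtain n and \<phi> :: "'m \<Rightarrow> nat \<Rightarrow>\<^sub>0 int" where add: "Modules.additive \<phi>"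
    and bij: "bij_betw \<phi> UNIV {c. Poly_Mapping.keys c \<subseteq> {..<n}}"
    using assms by (auto simp: fg_free_abelian_group_def)
  interpret \<phi>: Modules.additive \<phi> by (rule add)
  have inj: "inj \<phi>" using bij by (simp add: bij_betw_def)
  have keys: "Poly_Mapping.keys (\<phi> u) \<subseteq> {..<n}" for u
    using bij by (auto simp: bij_betw_def)
  have single: "\<phi> (inv \<phi> (Poly_Mapping.single i k)) = Poly_Mapping.single i k" if "i < n" for i k
  proof (rule f_inv_into_f)
    have "Poly_Mapping.single i k \<in> {c. Poly_Mapping.keys c \<subseteq> {..<n}}" using that by simp
    then show "Poly_Mapping.single i k \<in> range \<phi>" using bij by (simp add: bij_betw_def)
  qed
  define coord where "coord i u = Poly_Mapping.lookup (\<phi> u) i" for i u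
  have zero_outside: "coord i u = 0" if "\<not> i < n" for i u
    using keys[of u] that by (force simp: coord_def in_keys_iff)
  have decomp: "u = (\<Sum>i<n. inv \<phi> (Poly_Mapping.single i (coord i u)))" for u
  proof -
    have "\<phi> (\<Sum>i<n. inv \<phi> (Poly_Mapping.single i (coord i u)))
        = (\<Sum>i<n. Poly_Mapping.single i (coord i u))"
      unfolding \<phi>.sum by (intro sum.cong) (simp_all add: single)
    also have "\<dots> = \<phi> u"
    proof (rule poly_mapping_eqI)
      fix k
      have "Poly_Mapping.lookup (\<Sum>i<n. Poly_Mapping.single i (coord i u)) k
          = (\<Sum>i<n. if i = k then coord k u else 0)"
        unfolding lookup_sum by (intro sum.cong) (simp_all add: lookup_single when_def)
      also have "\<dots> = coord k u" using zero_outside by simp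
      finally show "Poly_Mapping.lookup (\<Sum>i<n. Poly_Mapping.single i (coord i u)) k
          = Poly_Mapping.lookup (\<phi> u) k" by (simp add: coord_def)
    qed
    finally show ?thesis using inj by (simp add: inj_eq)
  qed
  show ?thesis
  proof
    show "Modules.additive (coord i)" for i
      by unfold_locales (simp add: coord_def \<phi>.add lookup_add)
    show "u = 0" if "\<And>i. i < n \<Longrightarrow> coord i u = 0" for u
    proof -
      have "\<phi> u = \<phi> 0"
        using that zero_outside by (intro poly_mapping_eqI) (metis coord_def \<phi>.zero lookup_zero)
      with inj show ?thesis by (simp add: inj_eq)
    qed
    show "pairing x u = (\<Sum>i<n. real_of_int (coord i u)
      * pairing x (inv \<phi> (Poly_Mapping.single i 1)))" for x u
    proof -
      have scale: "pairing x (inv \<phi> (Poly_Mapping.single i k))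
          = real_of_int k * pairing x (inv \<phi> (Poly_Mapping.single i 1))" if "i < n" for i k
      proof -
        define h where "h k = pairing x (inv \<phi> (Poly_Mapping.single i k))" for k :: int
        have h_add: "h (k + l) = h k + h l" for k l
        proof -
          have "\<phi> (inv \<phi> (Poly_Mapping.single i (k + l))) = Poly_Mapping.single i (k + l)"
            by (rule single[OF that])
          also have "\<dots> = \<phi> (inv \<phi> (Poly_Mapping.single i k) + inv \<phi> (Poly_Mapping.single i l))"
            by (simp only: \<phi>.add single[OF that] single_add)
          finally have "\<phi> (inv \<phi> (Poly_Mapping.single i (k + l)))
              = \<phi> (inv \<phi> (Poly_Mapping.single i k) + inv \<phi> (Poly_Mapping.single i l))" .
          with inj have "inv \<phi> (Poly_Mapping.single i (k + l))
              = inv \<phi> (Poly_Mapping.single i k) + inv \<phi> (Poly_Mapping.single i l)"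
            by (simp only: inj_eq)
          then show ?thesis by (simp add: h_def)
        qed
        have h0: "h 0 = 0" using h_add[of 0 0] by simp
        have hm: "h (k - 1) = h k - h 1" for k using h_add[of "k - 1" 1] by simp
        have "h k = real_of_int k * h 1"
          by (induction k rule: int_induct[of _ 0]) (simp_all add: h0 h_add hm algebra_simps)
        then show ?thesis by (simp add: h_def)
      qed
      have "pairing x u = (\<Sum>i<n. pairing x (inv \<phi> (Poly_Mapping.single i (coord i u))))"
        using decomp[of u] pairing_sum by metis
      also have "\<dots> = (\<Sum>i<n. real_of_int (coord i u) * pairing x (inv \<phi> (Poly_Mapping.single i 1)))"
        by (intro sum.cong refl scale) simp
      finally show ?thesis .
    qed
  qed
qed

section \<open>Total preorders on groups of terms\<close>

lemma simultaneous_approximation: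
  fixes c :: "'i \<Rightarrow> real"
  assumes "finite J" and "0 < \<epsilon>"
  obtains q :: int and p :: "'i \<Rightarrow> int" where "0 < q" "\<And>i. i \<in> J \<Longrightarrow> \<bar>q * c i - p i\<bar> < \<epsilon>"
proof -
  obtain h where h: "bij_betw h {0..<card J} J"
    using ex_bij_betw_nat_finite[OF assms(1)] by blast
  obtain N where N: "inverse (real (Suc N)) < \<epsilon>" using reals_Archimedean[OF assms(2)] by blast
  obtain q p where q: "0 < q"
    and p: "\<And>i. i < card J \<Longrightarrow> \<bar>of_int q * (c \<circ> h) i - of_int (p i)\<bar> < 1 / real (Suc N)"
    using Dirichlet_approx_simult[of "Suc N" "card J" "c \<circ> h"] by (metis zero_less_Suc)
  show ?thesis
  proof
    show "0 < q" by (rule q)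
    fix i assume "i \<in> J"
    then have "i \<in> h ` {0..<card J}" using h by (simp add: bij_betw_def)
    then obtain k where k: "k < card J" "h k = i" by auto
    then have "the_inv_into {0..<card J} h i = k"
      using h by (auto simp: bij_betw_def intro: the_inv_into_f_f)
    with p[OF k(1)] k N show "\<bar>of_int q * c i - of_int ((p \<circ> the_inv_into {0..<card J} h) i)\<bar> < \<epsilon>"
      by (simp add: inverse_eq_divide)
  qed
qed

text \<open>\<open>Q\<close> is the set of nonnegative elements of a total preorder on the group \<open>G\<close> of terms. The last
  assumption says that the preorder coarsens the order of the scalars.\<close>

locale group_order =
  fixes G Q :: "(real \<times> 'm::ab_group_add) set"
  assumes fg: "fg_free_abelian_group TYPE('m)"
    and G_zero: "0 \<in> G"
    and G_diff: "\<And>g h. g \<in> G \<Longrightarrow> h \<in> G \<Longrightarrow> g - h \<in> G"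
    and Q_subset: "Q \<subseteq> G"
    and Q_total: "\<And>g. g \<in> G \<Longrightarrow> g \<in> Q \<or> - g \<in> Q"
    and Q_add: "\<And>g h. g \<in> Q \<Longrightarrow> h \<in> Q \<Longrightarrow> g + h \<in> Q"
    and Q_scalar: "\<And>a. (a, 0) \<in> G \<Longrightarrow> 0 \<le> a \<Longrightarrow> (a, 0) \<in> Q"
begin

lemma Q_zero: "0 \<in> Q"
  using Q_scalar[of 0] G_zero by (simp add: zero_prod_def)

lemma Q_sum: "(\<And>i. i \<in> I \<Longrightarrow> h i \<in> Q) \<Longrightarrow> sum h I \<in> Q"
  by (induction I rule: infinite_finite_induct) (simp_all add: Q_zero Q_add)

text \<open>A real relation with positive coefficients among the exponents is turned into an integral relation:
  after simultaneous approximation, every coordinate of the integral combination of the exponents is an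
  integer of absolute value less than \<open>1\<close>. The scalars need not be integral, so only a small bound
  \<open>\<delta>\<close> survives for them.\<close>

lemma small_integral_combination:
  fixes J :: "(real \<times> 'm) set"
  assumes fin: "finite J" and c: "\<And>i. i \<in> J \<Longrightarrow> 0 < c i"
    and rel: "\<And>x. (\<Sum>i\<in>J. c i * pairing x (snd i)) = 0" and nonpos: "(\<Sum>i\<in>J. c i * fst i) \<le> 0"
    and \<delta>: "0 < \<delta>"
  shows "\<exists>a (p :: real \<times> 'm \<Rightarrow> nat). (\<forall>i\<in>J. 0 < p i) \<and> (\<Sum>i\<in>J. \<Sum>_<p i. i) = (a, 0) \<and> a < \<delta>"
proof -
  obtain n and coord :: "nat \<Rightarrow> 'm \<Rightarrow> int" and b :: "nat \<Rightarrow> 'm" where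
    coord: "\<And>i. Modules.additive (coord i)"
    and coord_0: "\<And>u. (\<And>i. i < n \<Longrightarrow> coord i u = 0) \<Longrightarrow> u = 0"
    using lattice_coordinates[OF fg] by metis
  define size where "size i = \<bar>fst i\<bar> + (\<Sum>k<n. \<bar>real_of_int (coord k (snd i))\<bar>)" for i :: "real \<times> 'm"
  define T where "T = 1 + (\<Sum>i\<in>J. size i)"
  have T: "1 \<le> T" unfolding T_def size_def by (simp add: sum_nonneg)
  define \<epsilon> where "\<epsilon> = Min (insert (1 / T) (insert (\<delta> / T) (c ` J)))"
  have "0 < \<epsilon>" unfolding \<epsilon>_def using fin c T \<delta> by (subst Min_gr_iff) auto
  moreover have "\<epsilon> \<le> 1 / T" "\<epsilon> \<le> \<delta> / T" "\<And>i. i \<in> J \<Longrightarrow> \<epsilon> \<le> c i"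
    unfolding \<epsilon>_def using fin by (intro Min_le; simp)+
  ultimately have \<epsilon>: "0 < \<epsilon>" "\<epsilon> \<le> 1 / T" "\<epsilon> \<le> \<delta> / T" "\<And>i. i \<in> J \<Longrightarrow> \<epsilon> \<le> c i"
    by blast+
  obtain q p where q: "0 < q" and p: "\<And>i. i \<in> J \<Longrightarrow> \<bar>of_int q * c i - of_int (p i)\<bar> < \<epsilon>"
    using simultaneous_approximation[OF fin \<epsilon>(1), of c] by blast
  have p_pos: "0 < p i" if "i \<in> J" for i
  proof -
    have "1 * c i \<le> of_int q * c i" using q c[OF that] by (intro mult_right_mono) auto
    with p[OF that] \<epsilon>(4)[OF that] have "0 < real_of_int (p i)" by linarith
    then show ?thesis by simp
  qed
  \<comment> \<open>Replacing the weights \<open>q c\<close> by the integers \<open>p\<close> changes every coordinate of the relation by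
    less than \<open>\<epsilon> T\<close>.\<close>
  have near: "(\<Sum>i\<in>J. real_of_int (p i) * y i) < q * (\<Sum>i\<in>J. c i * y i) + \<epsilon> * T"
    if "\<And>i. i \<in> J \<Longrightarrow> \<bar>y i\<bar> \<le> size i" for y :: "real \<times> 'm \<Rightarrow> real"
  proof -
    have "(\<Sum>i\<in>J. real_of_int (p i) * y i) - q * (\<Sum>i\<in>J. c i * y i)
        = (\<Sum>i\<in>J. (real_of_int (p i) - q * c i) * y i)"
      by (simp add: sum_distrib_left sum_subtractf[symmetric] algebra_simps)
    also have "\<dots> \<le> (\<Sum>i\<in>J. \<epsilon> * size i)"
    proof (rule sum_mono)
      fix i assume i: "i \<in> J"
      have "(real_of_int (p i) - q * c i) * y i \<le> \<bar>real_of_int (p i) - q * c i\<bar> * \<bar>y i\<bar>"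
        by (metis abs_ge_self abs_mult)
      also have "\<dots> \<le> \<epsilon> * size i"
        using p[OF i] that[OF i] \<epsilon>(1) by (intro mult_mono) auto
      finally show "(real_of_int (p i) - q * c i) * y i \<le> \<epsilon> * size i" .
    qed
    also have "\<dots> = \<epsilon> * (T - 1)" by (simp add: T_def sum_distrib_left)
    also have "\<dots> < \<epsilon> * T" using \<epsilon>(1) by simp
    finally show ?thesis by simp
  qed
  have \<epsilon>T: "\<epsilon> * T \<le> 1" "\<epsilon> * T \<le> \<delta>" using \<epsilon>(2,3) T by (simp_all add: field_simps)
  define a where "a = (\<Sum>i\<in>J. real_of_int (p i) * fst i)"
  have a: "a < \<delta>"
  proof -
    have "a < q * (\<Sum>i\<in>J. c i * fst i) + \<epsilon> * T"
      unfolding a_def by (rule near) (simp add: size_def sum_nonneg)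
    moreover have "q * (\<Sum>i\<in>J. c i * fst i) \<le> 0" using q nonpos by (simp add: mult_le_0_iff)
    ultimately show ?thesis using \<epsilon>T by linarith
  qed
  have "(\<Sum>i\<in>J. \<Sum>_<nat (p i). snd i) = 0"
  proof (rule coord_0)
    fix k assume k: "k < n"
    define x where "x = Abs_NR (\<lambda>u. real_of_int (coord k u))"
    have x: "pairing x u = coord k u" for u
    proof -
      interpret Modules.additive "coord k" by (rule coord)
      have "Modules.additive (\<lambda>u. real_of_int (coord k u))" by unfold_locales (simp add: add)
      then show ?thesis by (simp add: x_def Abs_NR_inverse)
    qed
    have size_k: "\<bar>real_of_int (coord k (snd i))\<bar> \<le> size i" for i
      using member_le_sum[of k "{..<n}" "\<lambda>k. \<bar>real_of_int (coord k (snd i))\<bar>"] k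
      by (simp add: size_def)
    have rel_k: "(\<Sum>i\<in>J. c i * real_of_int (coord k (snd i))) = 0"
      using rel[of x] by (simp add: x)
    have "(\<Sum>i\<in>J. real_of_int (p i) * coord k (snd i)) < 1"
      using near[of "\<lambda>i. coord k (snd i)"] size_k rel_k \<epsilon>T by simp
    moreover have "(\<Sum>i\<in>J. real_of_int (p i) * - coord k (snd i)) < 1"
      using near[of "\<lambda>i. - coord k (snd i)"] size_k rel_k \<epsilon>T by (simp add: sum_negf)
    ultimately have "real_of_int \<bar>\<Sum>i\<in>J. p i * coord k (snd i)\<bar> < 1" by (simp add: sum_negf)
    then have "(\<Sum>i\<in>J. p i * coord k (snd i)) = 0" by linarith
    then have "real_of_int (\<Sum>i\<in>J. p i * coord k (snd i)) = 0" by simp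
    also have "real_of_int (\<Sum>i\<in>J. p i * coord k (snd i)) = pairing x (\<Sum>i\<in>J. \<Sum>_<nat (p i). snd i)"
      using p_pos by (simp add: pairing_sum x less_imp_le)
    finally show "coord k (\<Sum>i\<in>J. \<Sum>_<nat (p i). snd i) = 0" by (simp add: x)
  qed
  then have "(\<Sum>i\<in>J. \<Sum>_<nat (p i). i) = (a, 0)"
    using p_pos by (simp add: prod_eq_iff fst_sum snd_sum a_def less_imp_le)
  moreover have "\<forall>i\<in>J. 0 < nat (p i)" using p_pos by simp
  ultimately have "(\<forall>i\<in>J. 0 < (\<lambda>i. nat (p i)) i) \<and> (\<Sum>i\<in>J. \<Sum>_<(\<lambda>i. nat (p i)) i. i) = (a, 0) \<and> a < \<delta>"
    using a by simp
  then show ?thesis by (intro exI)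
qed

text \<open>Some integral combination of \<open>J\<close> is a scalar \<open>a\<close>, and it dominates \<open>g\<close>; so it suffices to show that
  \<open>a \<le> 0\<close> holds in the preorder. If the real number \<open>a\<close> is positive, a second combination yields a scalar
  \<open>a'\<close> so small that \<open>N a' < a\<close>, where \<open>N\<close> is the number of summands of the first combination. As \<open>a'\<close>
  dominates every element of \<open>J\<close>, the scalar \<open>N a'\<close> dominates \<open>a\<close>, so the positive number \<open>d = a - N a'\<close>
  is equivalent to \<open>0\<close>, and then so are all its multiples and, by the archimedean property, \<open>a\<close>.\<close>

lemma positive_relation_trivial:
  fixes J :: "(real \<times> 'm) set"
  assumes fin: "finite J" and J: "J \<subseteq> Q" and c: "\<And>i. i \<in> J \<Longrightarrow> 0 < c i"
    and rel: "\<And>x. (\<Sum>i\<in>J. c i * pairing x (snd i)) = 0" and nonpos: "(\<Sum>i\<in>J. c i * fst i) \<le> 0"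
    and g: "g \<in> J"
  shows "- g \<in> Q"
proof -
  have comb: "\<exists>a (p :: real \<times> 'm \<Rightarrow> nat). (\<forall>i\<in>J. 0 < p i) \<and> (\<Sum>i\<in>J. \<Sum>_<p i. i) = (a, 0) \<and> a < \<delta>" if "0 < \<delta>" for \<delta>
    by (rule small_integral_combination[OF fin c rel nonpos that])
  have bound: "(\<Sum>i\<in>J. \<Sum>_<p i. i) - h \<in> Q" if p: "\<forall>i\<in>J. 0 < p i" and h: "h \<in> J"
    for p :: "real \<times> 'm \<Rightarrow> nat" and h
  proof -
    obtain m where m: "p h = Suc m" using p h by (cases "p h") auto
    have "(\<Sum>i\<in>J. \<Sum>_<p i. i) - h = (\<Sum>i\<in>J - {h}. \<Sum>_<p i. i) + (\<Sum>_<m. h)"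
      using fin h m by (simp add: sum.remove)
    also have "\<dots> \<in> Q" using J h by (intro Q_add Q_sum) auto
    finally show ?thesis .
  qed
  obtain a and p :: "real \<times> 'm \<Rightarrow> nat" where p: "\<forall>i\<in>J. 0 < p i" and a: "(\<Sum>i\<in>J. \<Sum>_<p i. i) = (a, 0)"
    using comb[OF zero_less_one] by blast
  have "(a, 0) \<in> Q" unfolding a[symmetric] using J by (intro Q_sum) auto
  with Q_subset have aG: "(a, 0) \<in> G" by blast
  have "(- a, 0) \<in> Q"
  proof (cases "a \<le> 0")
    case True
    have "(- a, 0) \<in> G" using G_diff[OF G_zero aG] by (simp add: zero_prod_def)
    with True show ?thesis by (intro Q_scalar) auto
  next
    case False
    define N where "N = (\<Sum>i\<in>J. p i)"
    have "p g \<le> N" unfolding N_def using fin g by (intro member_le_sum) auto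
    moreover have "0 < p g" using p g by blast
    ultimately have N: "0 < N" by simp
    have "0 < a / N" using False N by simp
    then obtain a' and p' :: "real \<times> 'm \<Rightarrow> nat" where p': "\<forall>i\<in>J. 0 < p' i" and a': "(\<Sum>i\<in>J. \<Sum>_<p' i. i) = (a', 0)"
      and less: "a' < a / N"
      using comb by blast
    define d where "d = a - N * a'"
    have d: "0 < d" using less N by (simp add: d_def field_simps)
    have "(\<Sum>i\<in>J. \<Sum>_<p i. (a', 0) - i) \<in> Q"
      using bound[OF p'] unfolding a' by (intro Q_sum) auto
    also have "(\<Sum>i\<in>J. \<Sum>_<p i. (a', 0) - i) = (- d, 0)"
      using a by (simp add: sum_subtractf prod_eq_iff fst_sum snd_sum d_def N_def sum_distrib_right)
    finally have dQ: "(- d, 0) \<in> Q" .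
    obtain m :: nat where m: "a < m * d" using reals_Archimedean3[OF d] by blast
    have mQ: "(\<Sum>_<m. (- d, 0)) \<in> Q" using dQ by (intro Q_sum) auto
    have eq: "(\<Sum>_<m. (- d, 0 :: 'm)) = (- (m * d), 0)" by (simp add: prod_eq_iff fst_sum snd_sum)
    have "(0 - (a, 0)) - (- (m * d), 0 :: 'm) \<in> G"
      using mQ Q_subset unfolding eq by (intro G_diff G_zero aG) auto
    then have "(m * d - a, 0) \<in> G" by (simp add: zero_prod_def)
    then have "(m * d - a, 0) \<in> Q" using m by (intro Q_scalar) auto
    from Q_add[OF mQ this] show ?thesis by (simp add: eq)
  qed
  from Q_add[OF this bound[OF p g]] have "(- a, 0) + ((a, 0) - g) \<in> Q" unfolding a .
  also have "(- a, 0) + ((a, 0) - g) = - g" by (simp add: prod_eq_iff)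
  finally show ?thesis .
qed

text \<open>A point of the cone is a nonnegative combination of finitely many generators, so membership would be a
  positive relation that involves \<open>g\<close>. The generator \<open>(1, 0)\<close> makes the first coordinates of the points
  obtained later lexicographically nonnegative; its coefficient turns the equation between the scalars
  into an inequality.\<close>

lemma positive_not_in_negative_cone:
  assumes g: "g \<in> Q" "- g \<notin> Q"
  shows "- weight_dual g \<notin> convex_cone hull (weight_dual ` insert (1, 0) Q)"
proof
  assume "- weight_dual g \<in> convex_cone hull (weight_dual ` insert (1, 0) Q)"
  then obtain F where "finite F" "F \<subseteq> weight_dual ` insert (1, 0) Q"
    and F: "- weight_dual g \<in> convex_cone hull F"
    using convex_cone_hull_finite_subset by blast
  then obtain J where J: "finite J" "J \<subseteq> insert (1, 0) Q" "F = weight_dual ` J"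
    using finite_subset_image by metis
  from F obtain c where c: "\<forall>i. 0 \<le> c i" and "- weight_dual g = (\<Sum>i\<in>J. c i *\<^sub>R weight_dual i)"
    unfolding J(3) convex_cone_hull_image_eq[OF J(1)] by blast
  then have "dual_apply (- weight_dual g) w = dual_apply (\<Sum>i\<in>J. c i *\<^sub>R weight_dual i) w" for w by simp
  then have rel: "- weight g w = (\<Sum>i\<in>J. c i * weight i w)" for w
    by (simp add: dual_apply_sum uminus_dual.rep_eq scaleR_dual.rep_eq weight_dual.rep_eq)
  \<comment> \<open>Split off the generator \<open>(1, 0)\<close>, whose coefficient only contributes to the scalars.\<close>
  define J0 where "J0 = J - {(1, 0)}"
  define c1 where "c1 = (if (1, 0) \<in> J then c (1, 0) else 0)"
  have J0: "finite J0" "J0 \<subseteq> Q" using J by (auto simp: J0_def)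
  have c1: "0 \<le> c1" using c by (simp add: c1_def)
  \<comment> \<open>Evaluation at \<open>(0, x)\<close> gives the relation among the exponents, evaluation at \<open>(1, 0)\<close> the
      inequality for the scalars.\<close>
  have rel0: "- weight g w = (\<Sum>i\<in>J0. c i * weight i w) + c1 * fst w" for w
    unfolding rel J0_def c1_def using J(1) by (auto simp: sum.remove weight_def)
  define c' where "c' i = (if i \<in> J0 then c i else 0) + (if i = g then 1 else 0)" for i
  define J' where "J' = {i \<in> insert g J0. 0 < c' i}"
  have sum': "(\<Sum>i\<in>J'. c' i * y i) = (\<Sum>i\<in>J0. c i * y i) + y g" for y :: "real \<times> 'm \<Rightarrow> real"
  proof -
    have "(\<Sum>i\<in>J'. c' i * y i) = (\<Sum>i\<in>insert g J0. c' i * y i)"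
      using J0 c by (intro sum.mono_neutral_left) (auto simp: J'_def c'_def not_less intro: antisym)
    also have "\<dots> = (\<Sum>i\<in>insert g J0. if i \<in> J0 then c i * y i else 0)
        + (\<Sum>i\<in>insert g J0. if i = g then y i else 0)"
      unfolding sum.distrib[symmetric] by (intro sum.cong) (auto simp: c'_def algebra_simps)
    also have "(\<Sum>i\<in>insert g J0. if i \<in> J0 then c i * y i else 0) = (\<Sum>i\<in>J0. c i * y i)"
      using J0 by (intro sum.mono_neutral_cong_right) auto
    finally show ?thesis using J0 by simp
  qed
  have "- g \<in> Q"
  proof (rule positive_relation_trivial[of J' c'])
    show "finite J'" "J' \<subseteq> Q" using J0 g by (auto simp: J'_def)
    show "0 < c' i" if "i \<in> J'" for i using that by (simp add: J'_def)
    show "(\<Sum>i\<in>J'. c' i * pairing x (snd i)) = 0" for x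
      using rel0[of "(0, x)"] by (simp add: sum' weight_def)
    show "(\<Sum>i\<in>J'. c' i * fst i) \<le> 0"
      using rel0[of "(1, 0)"] c1 by (simp add: sum' weight_def zero_NR.rep_eq)
    have "0 \<le> c g" using c by blast
    then have "0 < c' g" by (simp add: c'_def)
    then show "g \<in> J'" by (simp add: J'_def)
  qed
  with g show False by blast
qed

lemma finite_dual_basis:
  obtains B where "finite B" "B \<subseteq> weight_dual ` (UNIV \<times> snd ` G)"
    "span B = span (weight_dual ` (UNIV \<times> snd ` G))"
proof -
  obtain n and coord :: "nat \<Rightarrow> 'm \<Rightarrow> int" and b :: "nat \<Rightarrow> 'm" where
    b: "\<And>x u. pairing x u = (\<Sum>i<n. real_of_int (coord i u) * pairing x (b i))"
    using lattice_coordinates[OF fg] by metis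
  let ?F = "insert (weight_dual (1, 0)) ((\<lambda>i. weight_dual (0, b i)) ` {..<n})"
  have "weight_dual (a, u) \<in> span ?F" for a u
  proof -
    have "dual_apply (weight_dual (0, u)) = dual_apply (\<Sum>i<n. real_of_int (coord i u) *\<^sub>R weight_dual (0, b i))"
      by (rule ext)
        (simp add: dual_apply_sum scaleR_dual.rep_eq weight_dual.rep_eq weight_def b[of _ u])
    then have "weight_dual (0, u) = (\<Sum>i<n. real_of_int (coord i u) *\<^sub>R weight_dual (0, b i))"
      by (simp add: dual_apply_inject)
    also have "\<dots> \<in> span ?F" by (intro span_sum span_scale span_base) auto
    finally show ?thesis
      unfolding weight_dual_split[of a u] by (intro span_add span_scale) (auto intro: span_base)
  qed
  then have sub: "weight_dual ` (UNIV \<times> snd ` G) \<subseteq> span ?F" by auto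
  obtain B where B: "B \<subseteq> weight_dual ` (UNIV \<times> snd ` G)" "independent B"
    "weight_dual ` (UNIV \<times> snd ` G) \<subseteq> span B"
    by (rule maximal_independent_subset)
  have "finite B"
    using independent_span_bound[of ?F B] B sub by blast
  moreover have "span B = span (weight_dual ` (UNIV \<times> snd ` G))"
    using B by (metis span_mono span_span subset_antisym)
  ultimately show ?thesis using that B by blast
qed

text \<open>The functionals \<open>\<psi>s\<close> are the elements of the dual on which the lexicographic list is triangular. They lie in
  the span of the terms with exponents in the projection of \<open>G\<close>, which is why they vanish on the
  directions orthogonal to these exponents.\<close>

theorem lexicographic_representation:
  obtains ws :: "(real \<times> 'm NR) list" and \<psi>s :: "(real \<times> 'm NR \<Rightarrow> real) list" where
    "length \<psi>s = length ws"
    "\<And>\<psi>. \<psi> \<in> set \<psi>s \<Longrightarrow> linear \<psi>"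
    "\<And>\<psi> s. \<psi> \<in> set \<psi>s \<Longrightarrow> (\<And>g. g \<in> G \<Longrightarrow> pairing s (snd g) = 0) \<Longrightarrow> \<psi> (0, s) = 0"
    "\<And>i. i < length ws \<Longrightarrow> (\<psi>s ! i) (ws ! i) \<noteq> 0"
    "\<And>i j. i < length ws \<Longrightarrow> j < i \<Longrightarrow> (\<psi>s ! i) (ws ! j) = 0"
    "\<And>g. g \<in> G \<Longrightarrow> g \<in> Q \<longleftrightarrow> lex_nonneg (map (weight g) ws)"
    "lex_nonneg (map fst ws)"
proof -
  let ?K0 = "convex_cone hull (weight_dual ` insert (1, 0) Q)"
  let ?X = "weight_dual ` {g \<in> Q. - g \<notin> Q}"
  have "?X \<subseteq> ?K0" by (auto intro: hull_inc)
  then obtain K where K: "convex_cone K" "?K0 \<subseteq> K" "\<And>x. x \<in> ?X \<Longrightarrow> - x \<notin> K" "\<And>v. v \<in> K \<or> - v \<in> K"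
    using convex_cone_total_extension[of ?K0 ?X] positive_not_in_negative_cone
      convex_cone_convex_cone_hull by blast
  have K_Q: "weight_dual g \<in> K \<longleftrightarrow> g \<in> Q" if "g \<in> G" for g
  proof
    assume gK: "weight_dual g \<in> K"
    show "g \<in> Q"
    proof (rule ccontr)
      assume "g \<notin> Q"
      with Q_total[OF that] have "weight_dual (- g) \<in> ?X" by auto
      from K(3)[OF this] gK show False by (simp add: weight_dual_uminus)
    qed
  next
    assume "g \<in> Q"
    then show "weight_dual g \<in> K" using K(2) by (auto intro: hull_inc)
  qed
  let ?W = "span (weight_dual ` (UNIV \<times> snd ` G))"
  obtain B where B: "finite B" "span B = ?W" using finite_dual_basis by metis
  obtain fs es where len: "length es = length fs" and es: "set es \<subseteq> ?W"
    and lin: "\<forall>f\<in>set fs. linear f"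
    and tri: "\<forall>i<length fs. (fs ! i) (es ! i) \<noteq> 0 \<and> (\<forall>j<i. (fs ! j) (es ! i) = (0::real))"
    and lex: "\<forall>v\<in>?W. v \<in> K \<longleftrightarrow> lex_nonneg (map (\<lambda>f. f v) fs)"
    using lexicographic_functionals[OF B(1) K(1)] K(4) unfolding B(2) by blast
  \<comment> \<open>Functionals on the dual are evaluations at points, at least on the span of the terms.\<close>
  define point where "point f = (f (weight_dual (1, 0)), Abs_NR (\<lambda>u. f (weight_dual (0, u))))"
    for f :: "(real \<times> 'm NR) dual \<Rightarrow> real"
  have point: "f (weight_dual g) = weight g (point f)" if "linear f" for f g
  proof -
    have "Modules.additive (\<lambda>u. f (weight_dual (0, u)))"
      using weight_dual_add[of "(0, x)" "(0, y)" for x y :: 'm]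
      by unfold_locales (simp add: linear_add[OF that, symmetric] del: pairing_add)
    then have "pairing (snd (point f)) u = f (weight_dual (0, u))" for u
      by (simp add: point_def Abs_NR_inverse)
    then show ?thesis
      using weight_dual_split[of "fst g" "snd g"]
      by (simp add: weight_def point_def linear_add[OF that] linear_scale[OF that])
  qed
  have apply_point: "f e = dual_apply e (point f)" if "linear f" "e \<in> ?W" for f e
    using that(2)
  proof (induction rule: span_induct)
    case base
    show ?case
      by (rule subspaceI) (simp_all add: linear_0[OF that(1)] linear_add[OF that(1)]
          linear_scale[OF that(1)] zero_dual.rep_eq plus_dual.rep_eq scaleR_dual.rep_eq)
  next
    case (step e)
    then show ?case using point[OF that(1)] by (auto simp: weight_dual.rep_eq)
  qed
  have vanish: "dual_apply e (0, s) = 0"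
    if "e \<in> ?W" "\<And>g. g \<in> G \<Longrightarrow> pairing s (snd g) = 0" for e s
    using that(1)
  proof (induction rule: span_induct)
    case base
    show ?case
      by (rule subspaceI) (simp_all add: zero_dual.rep_eq plus_dual.rep_eq scaleR_dual.rep_eq)
  next
    case (step e)
    then show ?case using that(2) by (auto simp: weight_dual.rep_eq weight_def)
  qed
  have W: "weight_dual (a, snd g) \<in> ?W" if "g \<in> G" for a g
    using that by (auto intro: span_base)
  show ?thesis
  proof (rule that[of "map dual_apply es" "map point fs"])
    show "length (map dual_apply es) = length (map point fs)" using len by simp
    show "linear \<psi>" if "\<psi> \<in> set (map dual_apply es)" for \<psi>
      using that linear_dual_apply by auto
    show "\<psi> (0, s) = 0"
      if "\<psi> \<in> set (map dual_apply es)" "\<And>g. g \<in> G \<Longrightarrow> pairing s (snd g) = 0" for \<psi> s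
      using that vanish es by auto
    show "(map dual_apply es ! i) (map point fs ! i) \<noteq> 0" if "i < length (map point fs)" for i
    proof -
      have "fs ! i \<in> set fs" "es ! i \<in> set es" using that len by auto
      then have "(fs ! i) (es ! i) = dual_apply (es ! i) (point (fs ! i))"
        using lin es by (intro apply_point) auto
      then show ?thesis using that tri len by auto
    qed
    show "(map dual_apply es ! i) (map point fs ! j) = 0" if "i < length (map point fs)" "j < i" for i j
    proof -
      have "fs ! j \<in> set fs" "es ! i \<in> set es" using that len by auto
      then have "(fs ! j) (es ! i) = dual_apply (es ! i) (point (fs ! j))"
        using lin es by (intro apply_point) auto
      then show ?thesis using that tri len by auto
    qed
    show "g \<in> Q \<longleftrightarrow> lex_nonneg (map (weight g) (map point fs))" if "g \<in> G" for g
    proof -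
      have "map (weight g) (map point fs) = map (\<lambda>f. f (weight_dual g)) fs"
        using lin point by auto
      moreover have "weight_dual g \<in> ?W" using W[OF that, of "fst g"] by simp
      then have "g \<in> Q \<longleftrightarrow> lex_nonneg (map (\<lambda>f. f (weight_dual g)) fs)"
        using lex K_Q[OF that] by blast
      ultimately show ?thesis by (simp only:)
    qed
    show "lex_nonneg (map fst (map point fs))"
    proof -
      have "weight_dual (1, 0) \<in> K" using K(2) by (auto intro: hull_inc)
      moreover have "weight_dual (1, 0) \<in> ?W" using W[OF G_zero, of 1] by simp
      ultimately have "lex_nonneg (map (\<lambda>f. f (weight_dual (1, 0))) fs)" using lex by blast
      then show ?thesis by (simp add: point_def comp_def)
    qed
  qed
qed

end

section \<open>Tropical coefficients and monomials\<close>

abbreviation trop_of :: "real \<Rightarrow> trop" where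
  "trop_of a \<equiv> Abs_trop (ereal a)"

lemma trop_log_trop_of [simp]: "trop_log (trop_of a) = ereal a"
  by (simp add: Abs_trop_inverse)

lemma trop_of_add: "trop_of a + trop_of b = trop_of (max a b)"
  by (cases "a \<le> b") (simp_all add: trop_log_inject[symmetric] plus_trop.rep_eq max_def)

lemma trop_of_mult: "trop_of a * trop_of b = trop_of (a + b)"
  by (simp add: trop_log_inject[symmetric] times_trop.rep_eq)

lemma trop_of_0: "trop_of 0 = 1"
  by (simp add: trop_log_inject[symmetric] one_trop.rep_eq zero_ereal_def)

lemma trop_of_nonzero [simp]: "trop_of a \<noteq> 0"
  by (simp add: trop_log_inject[symmetric] zero_trop.rep_eq)

lemma trop_of_log:
  assumes "x \<noteq> 0"
  shows "trop_of (real_of_ereal (trop_log x)) = x"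
proof -
  have "trop_log x \<noteq> \<infinity>" using trop_log[of x] by simp
  moreover have "trop_log x \<noteq> - \<infinity>" using assms by (simp add: trop_log_inject[symmetric] zero_trop.rep_eq)
  ultimately have "ereal (real_of_ereal (trop_log x)) = trop_log x" by (cases "trop_log x") simp_all
  then show ?thesis by (simp add: trop_log_inverse)
qed

lemma trop_add_idem: "x + x = (x :: trop)"
  by (simp add: trop_log_inject[symmetric] plus_trop.rep_eq)

definition exponents :: "trop set \<Rightarrow> real set" where
  "exponents S = {a. trop_of a \<in> S}"

lemma
  assumes S: "sub_semifield S"
  shows exponents_0: "0 \<in> exponents S"
    and exponents_add: "a \<in> exponents S \<Longrightarrow> b \<in> exponents S \<Longrightarrow> a + b \<in> exponents S"
    and exponents_uminus: "a \<in> exponents S \<Longrightarrow> - a \<in> exponents S"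
proof -
  show "0 \<in> exponents S" using S by (simp add: exponents_def trop_of_0 sub_semifield_def)
  show "a + b \<in> exponents S" if "a \<in> exponents S" "b \<in> exponents S"
    using that S by (auto simp: exponents_def trop_of_mult[symmetric] sub_semifield_def)
  show "- a \<in> exponents S" if "a \<in> exponents S"
  proof -
    have "trop_of a \<in> S" using that by (simp add: exponents_def)
    then obtain b where b: "b \<in> S" "trop_of a * b = 1"
      using S trop_of_nonzero[of a] unfolding sub_semifield_def by blast
    have "b \<noteq> 0" using b(2) by (metis mult_zero_right zero_neq_one)
    define c where "c = real_of_ereal (trop_log b)"
    have c: "b = trop_of c" using trop_of_log[OF \<open>b \<noteq> 0\<close>] by (simp add: c_def)
    have "trop_log (trop_of (a + c)) = trop_log (trop_of 0)"
      using b(2) by (simp add: c trop_of_mult trop_of_0)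
    then have "c = - a" by simp
    with b(1) show ?thesis by (simp add: exponents_def c)
  qed
qed

definition monomial :: "real \<times> 'm \<Rightarrow> ('m::comm_monoid_add \<Rightarrow>\<^sub>0 trop)" where
  "monomial g = Poly_Mapping.single (snd g) (trop_of (fst g))"

definition terms :: "('m::comm_monoid_add \<Rightarrow>\<^sub>0 trop) \<Rightarrow> (real \<times> 'm) set" where
  "terms f = (\<lambda>u. (real_of_ereal (trop_log (Poly_Mapping.lookup f u)), u)) ` Poly_Mapping.keys f"

lemma finite_terms [simp]: "finite (terms f)"
  by (simp add: terms_def)

lemma snd_terms: "snd ` terms f = Poly_Mapping.keys f"
  by (simp add: terms_def image_image)

lemma terms_lookup: "g \<in> terms f \<Longrightarrow> Poly_Mapping.lookup f (snd g) = trop_of (fst g)"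
  by (auto simp: terms_def trop_of_log in_keys_iff)

lemma monomial_add: "monomial (g + h) = monomial g * monomial h"
  by (simp add: monomial_def mult_single trop_of_mult)

lemma monomial_0: "monomial 0 = 1"
  by (simp add: monomial_def trop_of_0)

lemma poly_add_idem: "f + f = (f :: 'm \<Rightarrow>\<^sub>0 trop)"
  by (rule poly_mapping_eqI) (simp add: lookup_add trop_add_idem)

lemma sum_terms: "(\<Sum>g\<in>terms f. monomial g) = f"
proof -
  have "inj_on snd (terms f)" by (auto simp: terms_def inj_on_def)
  then have "(\<Sum>g\<in>terms f. monomial g)
      = (\<Sum>u\<in>Poly_Mapping.keys f. Poly_Mapping.single u (Poly_Mapping.lookup f u))"
    unfolding snd_terms[symmetric]
    by (simp add: sum.reindex) (rule sum.cong, simp_all add: terms_lookup monomial_def)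
  also have "\<dots> = f"
  proof (rule poly_mapping_eqI)
    fix k
    have "Poly_Mapping.lookup (\<Sum>u\<in>Poly_Mapping.keys f. Poly_Mapping.single u (Poly_Mapping.lookup f u)) k
        = (\<Sum>u\<in>Poly_Mapping.keys f. if u = k then Poly_Mapping.lookup f k else 0)"
      unfolding lookup_sum by (intro sum.cong) (simp_all add: lookup_single when_def)
    also have "\<dots> = Poly_Mapping.lookup f k" by (simp add: in_keys_iff)
    finally show "Poly_Mapping.lookup (\<Sum>u\<in>Poly_Mapping.keys f.
      Poly_Mapping.single u (Poly_Mapping.lookup f u)) k = Poly_Mapping.lookup f k" .
  qed
  finally show ?thesis .
qed

lemma monomial_add_leading: "g \<in> terms f \<Longrightarrow> monomial g + f = f"
  by (rule poly_mapping_eqI)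
    (auto simp: lookup_add monomial_def lookup_single when_def terms_lookup[of g f, symmetric] trop_add_idem)

lemma terms_subset:
  assumes "f \<in> monoid_semiring S Mon"
  shows "terms f \<subseteq> exponents S \<times> Mon"
proof
  fix g assume g: "g \<in> terms f"
  then have "snd g \<in> Poly_Mapping.keys f" using snd_terms by blast
  then have "snd g \<in> Mon" using assms by (auto simp: monoid_semiring_def)
  moreover have "trop_of (fst g) \<in> S"
    using terms_lookup[OF g] assms unfolding monoid_semiring_def by (metis (mono_tags, lifting) mem_Collect_eq)
  ultimately show "g \<in> exponents S \<times> Mon" by (cases g) (simp add: exponents_def)
qed

lemma monomial_in_semiring:
  assumes "sub_semifield S" and "g \<in> exponents S \<times> Mon"
  shows "monomial g \<in> monoid_semiring S Mon"
  using assms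
  by (auto simp: monoid_semiring_def monomial_def lookup_single when_def exponents_def sub_semifield_def)

lemma monomial_le: "a \<le> b \<Longrightarrow> monomial (a, u) + monomial (b, u) = monomial (b, u)"
  by (simp add: monomial_def single_add[symmetric] trop_of_add max_def)

section \<open>Prime congruences as preorders on terms\<close>

text \<open>In the quotient by a congruence of an additively idempotent semiring, \<open>quot_le\<close> is a preorder on
  representatives for which addition is the supremum.\<close>

locale idem_congruence =
  fixes A :: "'a::comm_semiring_1 set" and P :: "('a \<times> 'a) set"
  assumes cong: "congruence_on A P" and idem: "\<And>a. a + a = (a :: 'a)"
begin

lemma sym: "(a, b) \<in> P \<Longrightarrow> (b, a) \<in> P"
  using cong by (auto simp: congruence_on_def equiv_def dest: symD)

lemma trans: "(a, b) \<in> P \<Longrightarrow> (b, c) \<in> P \<Longrightarrow> (a, c) \<in> P"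
  using cong unfolding congruence_on_def equiv_def by (blast dest: transD)

lemma refl: "a \<in> A \<Longrightarrow> (a, a) \<in> P"
  using cong by (auto simp: congruence_on_def equiv_def refl_on_def)

lemma carrier: "(a, b) \<in> P \<Longrightarrow> a \<in> A \<and> b \<in> A"
  using cong by (auto simp: congruence_on_def equiv_def refl_on_def)

lemma add: "(a, b) \<in> P \<Longrightarrow> (c, d) \<in> P \<Longrightarrow> (a + c, b + d) \<in> P"
  and mult: "(a, b) \<in> P \<Longrightarrow> (c, d) \<in> P \<Longrightarrow> (a * c, b * d) \<in> P"
  using cong by (auto simp: congruence_on_def)

lemma le_trans:
  assumes "a \<in> A" "quot_le P a b" "quot_le P b c"
  shows "quot_le P a c"
proof -
  have "(a + c, a + (b + c)) \<in> P"
    using assms by (intro add refl sym[of "b + c"]) (auto simp: quot_le_def)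
  moreover have "((a + b) + c, b + c) \<in> P"
    using assms carrier by (intro add refl) (auto simp: quot_le_def)
  ultimately show ?thesis
    using assms unfolding quot_le_def by (metis trans add.assoc)
qed

lemma le_antisym: "quot_le P a b \<Longrightarrow> quot_le P b a \<Longrightarrow> (a, b) \<in> P"
  unfolding quot_le_def by (metis trans sym add.commute)

lemma le_mult: "c \<in> A \<Longrightarrow> quot_le P a b \<Longrightarrow> quot_le P (c * a) (c * b)"
  unfolding quot_le_def distrib_left[symmetric] by (intro mult refl)

lemma cong_imp_le:
  assumes "(a, b) \<in> P"
  shows "quot_le P a b"
proof -
  have "(a + b, b + b) \<in> P" using assms carrier by (intro add refl) auto
  then show ?thesis by (simp add: quot_le_def idem)
qed

lemma sum_le:
  assumes "m \<in> A" and "\<And>i. i \<in> I \<Longrightarrow> h i \<in> A" and "\<And>i. i \<in> I \<Longrightarrow> quot_le P (h i) m" and "finite I"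
  shows "quot_le P (sum h I) m"
  using assms(4,2,3)
proof (induction I)
  case empty
  then show ?case by (simp add: quot_le_def refl assms(1))
next
  case (insert i I)
  then have "(h i + (sum h I + m), h i + m) \<in> P" "(h i + m, m) \<in> P"
    by (auto simp: quot_le_def intro: add refl)
  then show ?case using insert.hyps trans by (auto simp: quot_le_def add.assoc)
qed

end

locale prime_monoid_congruence =
  fixes S :: "trop set" and Mon :: "'m::ab_group_add set" and P :: "(('m \<Rightarrow>\<^sub>0 trop) \<times> ('m \<Rightarrow>\<^sub>0 trop)) set"
  assumes S: "sub_semifield S" and Mon_0: "0 \<in> Mon"
    and Mon_add: "\<And>u v. u \<in> Mon \<Longrightarrow> v \<in> Mon \<Longrightarrow> u + v \<in> Mon"
    and prime: "prime_congruence_on (monoid_semiring S Mon) P"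
begin

abbreviation "A \<equiv> monoid_semiring S Mon"

sublocale idem_congruence A P
  using prime by unfold_locales (simp_all add: prime_congruence_on_def poly_add_idem)

lemma cancel: "a \<in> A \<Longrightarrow> b \<in> A \<Longrightarrow> c \<in> A \<Longrightarrow> (a, 0) \<notin> P \<Longrightarrow> (a * b, a * c) \<in> P \<Longrightarrow> (b, c) \<in> P"
  using prime unfolding prime_congruence_on_def by metis

lemma total: "a \<in> A \<Longrightarrow> b \<in> A \<Longrightarrow> quot_le P a b \<or> quot_le P b a"
  using prime unfolding prime_congruence_on_def by blast

lemma zero_in: "0 \<in> A"
  using S by (simp add: monoid_semiring_def sub_semifield_def)

lemma monomial_in: "g \<in> exponents S \<times> Mon \<Longrightarrow> monomial g \<in> A"
  by (rule monomial_in_semiring[OF S])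

lemma zero_mult: "a \<in> A \<Longrightarrow> (b, 0) \<in> P \<Longrightarrow> (a * b, 0) \<in> P"
  using mult[OF refl[of a], of b 0] by simp

definition live :: "'m set" where
  "live = {u \<in> Mon. (monomial (0, u), 0) \<notin> P}"

lemma monomial_shift_zero:
  assumes "(monomial (b, u), 0) \<in> P" "c \<in> exponents S"
  shows "(monomial (c + b, u), 0) \<in> P"
proof -
  have "monomial (c, 0) \<in> A" using assms(2) Mon_0 by (intro monomial_in) simp
  from zero_mult[OF this assms(1)] have "(monomial ((c, 0) + (b, u)), 0) \<in> P" by (simp only: monomial_add)
  then show ?thesis by simp
qed

text \<open>Coefficients are invertible, so only the exponent decides whether a monomial is congruent to \<open>0\<close>.\<close>

lemma monomial_live_iff:
  assumes "a \<in> exponents S" "u \<in> Mon"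
  shows "(monomial (a, u), 0) \<notin> P \<longleftrightarrow> u \<in> live"
proof -
  have "(monomial (a, u), 0) \<in> P \<longleftrightarrow> (monomial (0, u), 0) \<in> P"
    using monomial_shift_zero[of a u "- a"] monomial_shift_zero[of 0 u a]
      exponents_uminus[OF S assms(1)] assms(1) by force
  with assms(2) show ?thesis by (simp add: live_def)
qed

lemma live_0: "0 \<in> live"
proof -
  have "(monomial (0, 0), 0) \<notin> P"
  proof
    assume one: "(monomial (0, 0), 0) \<in> P"
    have zero: "(f, 0) \<in> P" if "f \<in> A" for f
      using zero_mult[OF that one] by (simp only: monomial_0 zero_prod_def[symmetric] mult_1_right)
    have "(f, g) \<in> P" if "f \<in> A" "g \<in> A" for f g
      by (rule trans[OF zero[OF that(1)] sym[OF zero[OF that(2)]]])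
    moreover have "P \<subseteq> A \<times> A" using carrier by auto
    ultimately have "P = A \<times> A" by auto
    then show False using prime by (simp add: prime_congruence_on_def)
  qed
  with Mon_0 show ?thesis by (simp add: live_def)
qed

text \<open>The quotient has no zero divisors, so the surviving exponents form a face of the monoid.\<close>

lemma live_add_iff:
  assumes "u \<in> Mon" "v \<in> Mon"
  shows "u + v \<in> live \<longleftrightarrow> u \<in> live \<and> v \<in> live"
proof -
  let ?u = "monomial (0, u)" and ?v = "monomial (0, v)"
  have in_A: "?u \<in> A" "?v \<in> A"
    using assms exponents_0[OF S] by (simp_all add: monomial_in)
  have "monomial (0, u + v) = ?u * ?v"
    using monomial_add[of "(0, u)" "(0, v)"] by simp
  then have uv: "u + v \<in> live \<longleftrightarrow> (?u * ?v, 0) \<notin> P"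
    using Mon_add[OF assms] by (simp add: live_def)
  have "(?u * ?v, 0) \<in> P" if "(?v, 0) \<in> P"
    using zero_mult[OF in_A(1) that] .
  moreover have "(?u * ?v, 0) \<in> P" if "(?u, 0) \<in> P"
    using zero_mult[OF in_A(2) that] by (simp only: mult.commute[of ?u])
  moreover have "(?v, 0) \<in> P" if "(?u * ?v, 0) \<in> P" "(?u, 0) \<notin> P"
    using cancel[OF in_A zero_in that(2)] that(1) by simp
  ultimately have "(?u * ?v, 0) \<notin> P \<longleftrightarrow> (?u, 0) \<notin> P \<and> (?v, 0) \<notin> P" by blast
  with uv assms show ?thesis by (simp add: live_def)
qed

definition live_terms :: "(real \<times> 'm) set" where
  "live_terms = exponents S \<times> live"

definition term_group :: "(real \<times> 'm) set" where
  "term_group = {g - h | g h. g \<in> live_terms \<and> h \<in> live_terms}"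

definition term_nonneg :: "(real \<times> 'm) set" where
  "term_nonneg = {g - h | g h. g \<in> live_terms \<and> h \<in> live_terms \<and> quot_le P (monomial h) (monomial g)}"

lemma live_subset: "live \<subseteq> Mon"
  by (auto simp: live_def)

lemma in_live_terms_iff: "g \<in> live_terms \<longleftrightarrow> fst g \<in> exponents S \<and> snd g \<in> live"
  by (simp add: live_terms_def mem_Times_iff)

lemma live_terms_add:
  assumes "g \<in> live_terms" "h \<in> live_terms"
  shows "g + h \<in> live_terms"
  using assms live_add_iff[of "snd g" "snd h"] live_subset exponents_add[OF S]
  by (auto simp: in_live_terms_iff)

lemma live_terms_0: "0 \<in> live_terms"
  using exponents_0[OF S] live_0 by (simp add: in_live_terms_iff)

lemma monomial_live_in: "g \<in> live_terms \<Longrightarrow> monomial g \<in> A"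
  using live_subset by (intro monomial_in) (auto simp: in_live_terms_iff mem_Times_iff)

lemma monomial_live_nonzero: "g \<in> live_terms \<Longrightarrow> (monomial g, 0) \<notin> P"
  using monomial_live_iff[of "fst g" "snd g"] live_subset by (simp add: in_live_terms_iff subset_iff)

lemma plus_in:
  assumes "a \<in> A" "b \<in> A"
  shows "a + b \<in> A"
proof -
  have "Poly_Mapping.keys (a + b) \<subseteq> Mon"
    using assms keys_add[of a b] by (auto simp: monoid_semiring_def)
  moreover have "Poly_Mapping.lookup (a + b) u \<in> S" for u
    using assms S by (simp add: lookup_add monoid_semiring_def sub_semifield_def)
  ultimately show ?thesis by (simp add: monoid_semiring_def)
qed

lemma le_cancel:
  assumes "g \<in> live_terms" "h \<in> live_terms" "k \<in> live_terms" "quot_le P (monomial (k + h)) (monomial (k + g))"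
  shows "quot_le P (monomial h) (monomial g)"
proof -
  have "(monomial k * (monomial h + monomial g), monomial k * monomial g) \<in> P"
    using assms(4) by (simp add: quot_le_def monomial_add distrib_left)
  from cancel[OF _ _ _ _ this] show ?thesis
    unfolding quot_le_def using assms(1-3) by (simp add: plus_in monomial_live_in monomial_live_nonzero)
qed

text \<open>By cancellation, the comparison of two monomials depends only on their quotient.\<close>

lemma diff_term_nonneg_iff:
  assumes "g \<in> live_terms" "h \<in> live_terms"
  shows "g - h \<in> term_nonneg \<longleftrightarrow> quot_le P (monomial h) (monomial g)"
proof
  assume "g - h \<in> term_nonneg"
  then obtain g' h' where gh': "g' \<in> live_terms" "h' \<in> live_terms" "quot_le P (monomial h') (monomial g')" "g - h = g' - h'"
    unfolding term_nonneg_def by blast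
  have eq: "g' + h = h' + g"
  proof -
    have "g' + h = (g' - h') + h + h'" by simp
    also have "\<dots> = h' + g" unfolding gh'(4)[symmetric] by simp
    finally show ?thesis .
  qed
  have "quot_le P (monomial h * monomial h') (monomial h * monomial g')"
    using gh' assms by (intro le_mult monomial_live_in)
  then have "quot_le P (monomial (h' + h)) (monomial (h' + g))"
    by (simp only: eq[symmetric] monomial_add mult.commute)
  with le_cancel[OF assms gh'(2)] show "quot_le P (monomial h) (monomial g)" by blast
next
  assume "quot_le P (monomial h) (monomial g)"
  with assms have "g - h = g - h \<and> g \<in> live_terms \<and> h \<in> live_terms \<and> quot_le P (monomial h) (monomial g)" by simp
  then show "g - h \<in> term_nonneg" unfolding term_nonneg_def by (intro CollectI exI)
qed

lemma group_order:
  assumes "fg_free_abelian_group TYPE('m)"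
  shows "group_order term_group term_nonneg"
proof
  show "fg_free_abelian_group TYPE('m)" by (rule assms)
  have "0 = (0 :: real \<times> 'm) - 0 \<and> 0 \<in> live_terms \<and> 0 \<in> live_terms" using live_terms_0 by simp
  then show "0 \<in> term_group" unfolding term_group_def by (intro CollectI exI)
  show "term_nonneg \<subseteq> term_group" by (auto simp: term_nonneg_def term_group_def)
  show "g - h \<in> term_group" if gG: "g \<in> term_group" and hG: "h \<in> term_group" for g h
  proof -
    obtain a b where "g = a - b" "a \<in> live_terms" "b \<in> live_terms" using gG unfolding term_group_def by blast
    moreover obtain c d where "h = c - d" "c \<in> live_terms" "d \<in> live_terms" using hG unfolding term_group_def by blast
    ultimately have "g - h = (a + d) - (b + c)" "a + d \<in> live_terms" "b + c \<in> live_terms"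
      by (auto simp: live_terms_add)
    then show ?thesis unfolding term_group_def by blast
  qed
  show "g \<in> term_nonneg \<or> - g \<in> term_nonneg" if gG: "g \<in> term_group" for g
  proof -
    obtain a b where ab: "g = a - b" "a \<in> live_terms" "b \<in> live_terms" using gG unfolding term_group_def by blast
    then have "quot_le P (monomial b) (monomial a) \<or> quot_le P (monomial a) (monomial b)"
      by (intro total monomial_live_in)
    then show ?thesis using ab diff_term_nonneg_iff by auto
  qed
  show "g + h \<in> term_nonneg" if gQ: "g \<in> term_nonneg" and hQ: "h \<in> term_nonneg" for g h
  proof -
    obtain a b where ab: "g = a - b" "a \<in> live_terms" "b \<in> live_terms" "quot_le P (monomial b) (monomial a)"
      using gQ unfolding term_nonneg_def by blast
    obtain c d where cd: "h = c - d" "c \<in> live_terms" "d \<in> live_terms" "quot_le P (monomial d) (monomial c)"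
      using hQ unfolding term_nonneg_def by blast
    have "quot_le P (monomial d * monomial b) (monomial d * monomial a)"
      using ab cd by (intro le_mult monomial_live_in)
    moreover have "quot_le P (monomial a * monomial d) (monomial a * monomial c)"
      using ab cd by (intro le_mult monomial_live_in)
    ultimately have "quot_le P (monomial (b + d)) (monomial (a + c))"
      using le_trans[of "monomial (b + d)"] monomial_live_in[OF live_terms_add[OF ab(3) cd(3)]]
      by (simp only: monomial_add mult.commute[of "monomial d"])
    then have "(a + c) - (b + d) \<in> term_nonneg" using ab cd by (simp add: diff_term_nonneg_iff live_terms_add)
    moreover have "g + h = (a + c) - (b + d)" by (simp add: ab(1) cd(1))
    ultimately show ?thesis by simp
  qed
  show "(a, 0) \<in> term_nonneg" if aG: "(a, 0) \<in> term_group" and nonneg: "0 \<le> a" for a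
  proof -
    obtain g h where "(a, 0) = g - h" "g \<in> live_terms" "h \<in> live_terms" using aG unfolding term_group_def by blast
    then have "a = fst g + - fst h" "fst g \<in> exponents S" "fst h \<in> exponents S"
      by (auto simp: live_terms_def prod_eq_iff)
    then have "a \<in> exponents S" using exponents_add[OF S] exponents_uminus[OF S] by blast
    then have "(a, 0) \<in> live_terms" using live_0 by (simp add: live_terms_def)
    moreover have "quot_le P (monomial (0, 0)) (monomial (a, 0))"
      unfolding quot_le_def monomial_le[OF nonneg] by (rule refl[OF monomial_live_in[OF calculation]])
    ultimately show ?thesis
      using diff_term_nonneg_iff[of "(a, 0)" 0] live_terms_0 by (simp add: zero_prod_def)
  qed
qed

lemma dead_le:
  assumes "f \<in> A" "g \<in> terms f" "g \<notin> live_terms" "m \<in> A"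
  shows "quot_le P (monomial g) m"
proof -
  have g: "g \<in> exponents S \<times> Mon" using terms_subset[OF assms(1)] assms(2) by blast
  with assms(3) have "(monomial g, 0) \<in> P"
    using monomial_live_iff[of "fst g" "snd g"] by (auto simp: in_live_terms_iff)
  from add[OF this refl[OF assms(4)]] show ?thesis by (simp add: quot_le_def)
qed

lemma terms_in_A: "f \<in> A \<Longrightarrow> g \<in> terms f \<Longrightarrow> monomial g \<in> A"
  using terms_subset monomial_in by blast

lemma cong_zero:
  assumes "f \<in> A" "terms f \<inter> live_terms = {}"
  shows "(f, 0) \<in> P"
proof -
  have "quot_le P (\<Sum>g\<in>terms f. monomial g) 0"
  proof (rule sum_le[OF zero_in])
    fix g assume "g \<in> terms f"
    then show "monomial g \<in> A" "quot_le P (monomial g) 0"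
      using assms terms_in_A dead_le zero_in by blast+
  qed simp
  then show ?thesis by (simp add: sum_terms quot_le_def)
qed

text \<open>In the totally ordered quotient a sum is the maximum of its terms.\<close>

lemma cong_leading_monomial:
  assumes "f \<in> A" "g \<in> terms f" "g \<in> live_terms"
    and "\<And>h. h \<in> terms f \<Longrightarrow> h \<in> live_terms \<Longrightarrow> quot_le P (monomial h) (monomial g)"
  shows "(f, monomial g) \<in> P"
proof (rule le_antisym)
  have "quot_le P (\<Sum>h\<in>terms f. monomial h) (monomial g)"
  proof (rule sum_le[OF monomial_live_in[OF assms(3)]])
    fix h assume h: "h \<in> terms f"
    then show "monomial h \<in> A" by (rule terms_in_A[OF assms(1)])
    show "quot_le P (monomial h) (monomial g)"
      using assms(4)[OF h] dead_le[OF assms(1) h _ monomial_live_in[OF assms(3)]] by blast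
  qed simp
  then show "quot_le P f (monomial g)" by (simp add: sum_terms)
  show "quot_le P (monomial g) f"
    using monomial_add_leading[OF assms(2)] refl assms(1) by (simp add: quot_le_def)
qed

lemma cong_monomial_iff:
  assumes "g \<in> live_terms" "h \<in> live_terms"
  shows "(monomial g, monomial h) \<in> P \<longleftrightarrow> g - h \<in> term_nonneg \<and> h - g \<in> term_nonneg"
  unfolding diff_term_nonneg_iff[OF assms] diff_term_nonneg_iff[OF assms(2,1)]
  using cong_imp_le[of "monomial g" "monomial h"] cong_imp_le[OF sym, of "monomial g" "monomial h"]
    le_antisym[of "monomial g" "monomial h"] by blast

end

section \<open>Faces of the toric monoid\<close>

lemma pairing_nonpos_hull:
  assumes "\<And>v. v \<in> X \<Longrightarrow> pairing v u \<le> 0" "v \<in> convex_cone hull X"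
  shows "pairing v u \<le> 0"
  using assms(2)
proof (rule hull_induct)
  show "convex_cone {v. pairing v u \<le> 0}"
    by (simp add: convex_cone_iff plus_NR.rep_eq scaleR_NR.rep_eq zero_NR.rep_eq mult_nonneg_nonpos)
qed (use assms(1) in auto)

lemma submonoid_sum:
  assumes "0 \<in> L" and "\<And>u v. u \<in> L \<Longrightarrow> v \<in> L \<Longrightarrow> u + v \<in> L" and "\<And>i. i \<in> I \<Longrightarrow> y i \<in> L"
  shows "(\<Sum>i\<in>I. y i) \<in> L"
  using assms(3) by (induction I rule: infinite_finite_induct) (simp_all add: assms(1,2))

text \<open>\<open>\<tau>\<close> consists of the points of \<open>\<sigma>\<close> on which \<open>L\<close> vanishes. Conversely, a suitable sum \<open>s\<close> of elements of
  \<open>L\<close> is so negative on all generators of \<open>\<sigma>\<close> outside \<open>\<tau>\<close> that \<open>s - u\<close> still lies in the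
  monoid, for a given \<open>u\<close> orthogonal to \<open>\<tau>\<close>. As \<open>u + (s - u) = s \<in> L\<close>, the face property gives \<open>u \<in> L\<close>.\<close>

lemma monoid_face_cut_out:
  fixes \<sigma> :: "'m::ab_group_add NR set" and L :: "'m set"
  assumes \<sigma>: "\<sigma> = convex_cone hull X" and fin: "finite X"
    and L: "L \<subseteq> toric_monoid \<sigma>" "0 \<in> L"
    and L_add: "\<And>u v. u \<in> toric_monoid \<sigma> \<Longrightarrow> v \<in> toric_monoid \<sigma> \<Longrightarrow> u + v \<in> L \<longleftrightarrow> u \<in> L \<and> v \<in> L"
  obtains \<tau> where "cone_face_of \<tau> \<sigma>" "L = toric_monoid \<sigma> \<inter> perp \<tau>"
proof -
  define \<tau> where "\<tau> = {v \<in> \<sigma>. \<forall>u\<in>L. pairing v u = 0}"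
  have \<sigma>_cone: "convex_cone \<sigma>" unfolding \<sigma> by (rule convex_cone_convex_cone_hull)
  have nonpos: "pairing v u \<le> 0" if "v \<in> \<sigma>" "u \<in> toric_monoid \<sigma>" for v u
    using that by (simp add: toric_monoid_def)
  have "\<tau> face_of \<sigma>"
    unfolding face_of_def
  proof (intro conjI ballI impI)
    show "\<tau> \<subseteq> \<sigma>" by (auto simp: \<tau>_def)
    show "convex \<tau>"
      using \<sigma>_cone unfolding \<tau>_def convex_cone_def
      by (auto simp: convex_def plus_NR.rep_eq scaleR_NR.rep_eq)
  next
    fix a b x assume ab: "a \<in> \<sigma>" "b \<in> \<sigma>" and x: "x \<in> \<tau>" "x \<in> open_segment a b"
    then obtain t where t: "0 < t" "t < 1" "x = (1 - t) *\<^sub>R a + t *\<^sub>R b" by (auto simp: in_segment)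
    have "pairing a u = 0 \<and> pairing b u = 0" if u: "u \<in> L" for u
    proof -
      have eq: "(1 - t) * pairing a u + t * pairing b u = 0"
        using x(1) u t(3) by (simp add: \<tau>_def plus_NR.rep_eq scaleR_NR.rep_eq)
      have "(1 - t) * pairing a u \<le> 0" "t * pairing b u \<le> 0"
        using t nonpos ab u L(1) by (auto intro!: mult_nonneg_nonpos)
      with eq have "(1 - t) * pairing a u = 0" "t * pairing b u = 0" by linarith+
      with t show ?thesis by simp
    qed
    with ab show "a \<in> \<tau>" "b \<in> \<tau>" by (auto simp: \<tau>_def)
  qed
  moreover have "0 \<in> \<tau>"
    using convex_cone_contains_0[OF \<sigma>_cone] by (simp add: \<tau>_def zero_NR.rep_eq)
  ultimately have face: "cone_face_of \<tau> \<sigma>" by (auto simp: cone_face_of_def)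
  have "u \<in> L" if u: "u \<in> toric_monoid \<sigma>" "u \<in> perp \<tau>" for u
  proof -
    \<comment> \<open>Each generator outside \<open>\<tau>\<close> needs its own witness; \<open>s\<close> below adds up large multiples of them.\<close>
    have "\<forall>v\<in>X - \<tau>. \<exists>w\<in>L. pairing v w < 0"
    proof
      fix v assume v: "v \<in> X - \<tau>"
      then have v\<sigma>: "v \<in> \<sigma>" by (auto simp: \<sigma> intro: hull_inc)
      with v obtain w where w: "w \<in> L" "pairing v w \<noteq> 0" by (auto simp: \<tau>_def)
      with nonpos[OF v\<sigma>, of w] L(1) show "\<exists>w\<in>L. pairing v w < 0" by force
    qed
    then obtain w where w: "\<And>v. v \<in> X - \<tau> \<Longrightarrow> w v \<in> L \<and> pairing v (w v) < 0" by metis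
    define N where "N = Max (insert 1 ((\<lambda>v. pairing v u / pairing v (w v)) ` (X - \<tau>)))"
    obtain n :: nat where n: "N \<le> n" using real_arch_simple by blast
    have Mon_0: "0 \<in> toric_monoid \<sigma>" by (simp add: toric_monoid_def)
    have L_add': "u + v \<in> L" if "u \<in> L" "v \<in> L" for u v
      using that L_add L(1) by blast
    define s where "s = (\<Sum>v\<in>X - \<tau>. \<Sum>_<n. w v)"
    have s: "s \<in> L" unfolding s_def
    proof (rule submonoid_sum[OF L(2) L_add'])
      fix v assume "v \<in> X - \<tau>"
      then have "w v \<in> L" using w by blast
      then show "(\<Sum>_<n. w v) \<in> L" by (intro submonoid_sum[OF L(2) L_add'])
    qed
    have s_bound: "pairing v s \<le> real n * pairing v (w v)" if v: "v \<in> X - \<tau>" for v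
    proof -
      have "pairing v s = real n * pairing v (w v) + (\<Sum>v'\<in>X - \<tau> - {v}. real n * pairing v (w v'))"
        using v fin by (simp add: s_def pairing_sum sum.remove)
      moreover have "(\<Sum>v'\<in>X - \<tau> - {v}. real n * pairing v (w v')) \<le> 0"
      proof (rule sum_nonpos)
        fix v' assume "v' \<in> X - \<tau> - {v}"
        then have "w v' \<in> toric_monoid \<sigma>" using w L(1) by blast
        moreover have "v \<in> \<sigma>" using v by (auto simp: \<sigma> intro: hull_inc)
        ultimately show "real n * pairing v (w v') \<le> 0"
          using nonpos by (simp add: mult_nonneg_nonpos)
      qed
      ultimately show ?thesis by simp
    qed
    have "s - u \<in> toric_monoid \<sigma>"
      unfolding toric_monoid_def
    proof (intro CollectI ballI)
      fix v assume "v \<in> \<sigma>"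
      then show "pairing v (s - u) \<le> 0"
        unfolding \<sigma>
      proof (rule pairing_nonpos_hull[rotated])
        fix v assume v: "v \<in> X"
        then have v\<sigma>: "v \<in> \<sigma>" by (auto simp: \<sigma> intro: hull_inc)
        show "pairing v (s - u) \<le> 0"
        proof (cases "v \<in> \<tau>")
          case True
          then have "pairing v u = 0" using u by (simp add: perp_def)
          with nonpos[OF v\<sigma>] s L(1) show ?thesis by auto
        next
          case False
          with v have vX: "v \<in> X - \<tau>" by simp
          have "pairing v u / pairing v (w v) \<le> N"
            unfolding N_def using fin vX by (intro Max_ge) auto
          with n have "pairing v u / pairing v (w v) \<le> n" by linarith
          then have "n * pairing v (w v) \<le> pairing v u"
            using w[OF vX] by (simp add: field_simps)
          with s_bound[OF vX] show ?thesis by simp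
        qed
      qed
    qed
    with L_add[of u "s - u"] u s show "u \<in> L" by simp
  qed
  moreover have "L \<subseteq> toric_monoid \<sigma> \<inter> perp \<tau>" using L(1) by (auto simp: perp_def \<tau>_def)
  ultimately have "L = toric_monoid \<sigma> \<inter> perp \<tau>" by blast
  with that face show ?thesis by blast
qed

section \<open>Leading terms and tropical evaluation\<close>

lemma pairing_span_perp:
  assumes "u \<in> perp \<tau>" "v \<in> span \<tau>"
  shows "pairing v u = 0"
  using assms(2)
proof (induction rule: span_induct)
  case base
  show ?case by (simp add: subspace_def zero_NR.rep_eq plus_NR.rep_eq scaleR_NR.rep_eq)
next
  case (step v)
  then show ?case using assms(1) by (simp add: perp_def)
qed

lemma stratum_proj_eq_iff:
  "stratum_proj \<tau> v = stratum_proj \<tau> w \<longleftrightarrow> fst v = fst w \<and> snd v - snd w \<in> span \<tau>"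
proof -
  have "x +o span \<tau> = y +o span \<tau> \<longleftrightarrow> x - y \<in> span \<tau>" for x y :: "'a NR"
  proof
    assume "x +o span \<tau> = y +o span \<tau>"
    moreover have "x \<in> x +o span \<tau>" by (simp add: elt_set_plus_def span_zero)
    ultimately show "x - y \<in> span \<tau>" by (auto simp: elt_set_plus_def)
  next
    assume xy: "x - y \<in> span \<tau>"
    have "x + s \<in> y +o span \<tau>" if "s \<in> span \<tau>" for s
      unfolding elt_set_plus_def using span_add[OF xy that]
      by (intro CollectI bexI[of _ "x - y + s"]) simp_all
    moreover have "y + s \<in> x +o span \<tau>" if "s \<in> span \<tau>" for s
      unfolding elt_set_plus_def using span_diff[OF that xy]
      by (intro CollectI bexI[of _ "s - (x - y)"]) simp_all
    ultimately show "x +o span \<tau> = y +o span \<tau>" by (auto simp: elt_set_plus_def)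
  qed
  then show ?thesis by (simp add: stratum_proj_def split_beta)
qed

lemma flag_Phi_term_proj:
  "flag_Phi_term \<tau> (map (stratum_proj \<tau>) ws) a u =
    (if u \<in> perp \<tau> then Some (map (weight (a, u)) ws) else None)"
  by (simp add: flag_Phi_term_def stratum_proj_def split_beta coset_pairing_eq weight_def)

lemma flag_Phi_eq:
  "flag_Phi \<tau> (map (stratum_proj \<tau>) ws) f = Max (insert None
    ((\<lambda>g. if snd g \<in> perp \<tau> then Some (map (weight g) ws) else None) ` terms f))"
  by (simp only: flag_Phi_def terms_def image_image flag_Phi_term_proj snd_conv)

text \<open>A term whose value under \<open>\<Phi>\<close> is the lexicographic maximum; it is unique only up to equality of these
  values.\<close>

definition leading :: "'m::ab_group_add NR set \<Rightarrow> (real \<times> 'm NR) list \<Rightarrow> ('m \<Rightarrow>\<^sub>0 trop) \<Rightarrow> real \<times> 'm \<Rightarrow> bool" where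
  "leading \<tau> ws f g \<longleftrightarrow> g \<in> terms f \<and> snd g \<in> perp \<tau> \<and>
    (\<forall>h\<in>terms f. snd h \<in> perp \<tau> \<longrightarrow> lex_nonneg (map (weight (g - h)) ws))"

lemma lex_le_iff: "map (weight h) ws \<le> map (weight g) ws \<longleftrightarrow> lex_nonneg (map (weight (g - h)) ws)"
  by (simp add: map_le_map_iff_lex_nonneg weight_diff fun_eq_iff cong: map_cong)

lemma flag_Phi_None:
  assumes "\<And>g. g \<in> terms f \<Longrightarrow> snd g \<notin> perp \<tau>"
  shows "flag_Phi \<tau> (map (stratum_proj \<tau>) ws) f = None"
proof -
  have "insert None ((\<lambda>g. if snd g \<in> perp \<tau> then Some (map (weight g) ws) else None) ` terms f) = {None}"
    using assms by auto
  then show ?thesis unfolding flag_Phi_eq by (simp only: Max_singleton)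
qed

lemma flag_Phi_leading:
  assumes "leading \<tau> ws f g"
  shows "flag_Phi \<tau> (map (stratum_proj \<tau>) ws) f = Some (map (weight g) ws)"
  unfolding flag_Phi_eq
proof (rule Max_eqI)
  fix y assume "y \<in> insert None ((\<lambda>g. if snd g \<in> perp \<tau> then Some (map (weight g) ws) else None) ` terms f)"
  then show "y \<le> Some (map (weight g) ws)"
    using assms by (auto simp: leading_def lex_le_iff)
qed (use assms in \<open>auto simp: leading_def\<close>)

lemma leading_exists:
  assumes "h \<in> terms f" "snd h \<in> perp \<tau>"
  shows "\<exists>g. leading \<tau> ws f g"
proof -
  let ?X = "{g \<in> terms f. snd g \<in> perp \<tau>}"
  let ?Y = "(\<lambda>g. map (weight g) ws) ` ?X"
  have "h \<in> ?X" using assms by simp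
  then have ne: "?Y \<noteq> {}" by blast
  have fin: "finite ?Y" by simp
  obtain g where g: "g \<in> ?X" "Max ?Y = map (weight g) ws" using Max_in[OF fin ne] by auto
  have "map (weight h) ws \<le> map (weight g) ws" if "h \<in> ?X" for h
    unfolding g(2)[symmetric] using that fin by (intro Max_ge) auto
  with g(1) have "leading \<tau> ws f g" by (simp add: leading_def lex_le_iff)
  then show ?thesis ..
qed

lemma trop_eval_stratum:
  assumes "snd ` terms f \<subseteq> toric_monoid \<sigma>"
  shows "trop_eval f (stratum_incl \<sigma> \<tau> (stratum_proj \<tau> w)) =
    (SUP g\<in>terms f. if snd g \<in> perp \<tau> then ereal (weight g w) else - \<infinity>)"
proof -
  have "trop_eval f (stratum_incl \<sigma> \<tau> (stratum_proj \<tau> w)) =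
    (SUP g\<in>terms f. ereal (fst w) * trop_log (Poly_Mapping.lookup f (snd g)) +
      (if snd g \<in> toric_monoid \<sigma> then if snd g \<in> perp \<tau>
        then ereal (coset_pairing (snd w +o span \<tau>) (snd g)) else - \<infinity> else undefined))"
    by (simp add: trop_eval_def stratum_incl_def stratum_proj_def split_beta restrict_def
        snd_terms[symmetric] image_image)
  also have "\<dots> = (SUP g\<in>terms f. if snd g \<in> perp \<tau> then ereal (weight g w) else - \<infinity>)"
    using assms by (intro SUP_cong) (auto simp: terms_lookup coset_pairing_eq weight_def)
  finally show ?thesis .
qed

lemma trop_eval_dead:
  assumes "snd ` terms f \<subseteq> toric_monoid \<sigma>" and "\<And>g. g \<in> terms f \<Longrightarrow> snd g \<notin> perp \<tau>"
  shows "trop_eval f (stratum_incl \<sigma> \<tau> (stratum_proj \<tau> w)) = - \<infinity>"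
  unfolding trop_eval_stratum[OF assms(1)] using assms(2)
  by (intro antisym SUP_least) auto

lemma trop_eval_max:
  assumes "snd ` terms f \<subseteq> toric_monoid \<sigma>" and "g \<in> terms f" "snd g \<in> perp \<tau>"
    and "\<And>h. h \<in> terms f \<Longrightarrow> snd h \<in> perp \<tau> \<Longrightarrow> weight h w \<le> weight g w"
  shows "trop_eval f (stratum_incl \<sigma> \<tau> (stratum_proj \<tau> w)) = ereal (weight g w)"
  unfolding trop_eval_stratum[OF assms(1)]
proof (rule antisym)
  show "(SUP h\<in>terms f. if snd h \<in> perp \<tau> then ereal (weight h w) else - \<infinity>) \<le> ereal (weight g w)"
    using assms(4) by (intro SUP_least) auto
  show "ereal (weight g w) \<le> (SUP h\<in>terms f. if snd h \<in> perp \<tau> then ereal (weight h w) else - \<infinity>)"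
    using assms(2,3) by (intro SUP_upper2[of g]) auto
qed

lemma perp_add_iff:
  assumes "\<tau> \<subseteq> \<sigma>" "u \<in> toric_monoid \<sigma>" "u' \<in> toric_monoid \<sigma>"
  shows "u + u' \<in> perp \<tau> \<longleftrightarrow> u \<in> perp \<tau> \<and> u' \<in> perp \<tau>"
proof
  assume sum: "u + u' \<in> perp \<tau>"
  have "pairing v u = 0 \<and> pairing v u' = 0" if "v \<in> \<tau>" for v
  proof -
    have "pairing v u \<le> 0" "pairing v u' \<le> 0" "pairing v u + pairing v u' = 0"
      using that assms sum by (auto simp: toric_monoid_def perp_def)
    then show ?thesis by linarith
  qed
  then show "u \<in> perp \<tau> \<and> u' \<in> perp \<tau>" by (simp add: perp_def)
qed (simp add: perp_def)

text \<open>Extending by \<open>- \<infinity>\<close> gives a homomorphism because the exponents orthogonal to \<open>\<tau>\<close> form a face of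
  the monoid.\<close>

lemma stratum_incl_mem:
  assumes "\<tau> \<subseteq> \<sigma>" "0 \<le> fst w"
  shows "stratum_incl \<sigma> \<tau> (stratum_proj \<tau> w) \<in> {0..} \<times> NR_of \<sigma>"
proof -
  have add: "u + u' \<in> toric_monoid \<sigma>" if "u \<in> toric_monoid \<sigma>" "u' \<in> toric_monoid \<sigma>" for u u'
    using that by (simp add: toric_monoid_def add_nonpos_nonpos)
  have "0 \<in> toric_monoid \<sigma>" "0 \<in> perp \<tau>" by (simp_all add: toric_monoid_def perp_def)
  then show ?thesis
    using assms(2)
    by (auto simp: NR_of_def stratum_incl_def stratum_proj_def split_beta coset_pairing_eq
        add perp_add_iff[OF assms(1)] split: if_splits)
qed

section \<open>Perturbation of lists of points\<close>

text \<open>For large \<open>C\<close>, the \<open>i\<close>-th point is, up to a positive factor, a small perturbation of the first point in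
  the direction of the second one, further perturbed by the later ones in decreasing order of magnitude.
  Only nonnegative coefficients occur, so every cone containing the given points contains the new ones.\<close>

definition perturb :: "real \<Rightarrow> 'v::real_vector list \<Rightarrow> 'v list" where
  "perturb C ws = map (\<lambda>i. \<Sum>j\<le>i. C ^ (i - j) *\<^sub>R ws ! j) [0..<length ws]"

lemma length_perturb [simp]: "length (perturb C ws) = length ws"
  by (simp add: perturb_def)

lemma nth_perturb: "i < length ws \<Longrightarrow> perturb C ws ! i = (\<Sum>j\<le>i. C ^ (i - j) *\<^sub>R ws ! j)"
  by (simp add: perturb_def)

lemma linear_perturb:
  fixes d :: "'v::real_vector \<Rightarrow> real"
  assumes "linear d" "i < length ws"
  shows "d (perturb C ws ! i) = (\<Sum>j\<le>i. C ^ (i - j) * d (ws ! j))"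
  by (simp add: nth_perturb[OF assms(2)] linear_sum[OF assms(1)] linear_scale[OF assms(1)])

lemma lex_nonneg_perturb:
  assumes "linear d" "0 < C"
  shows "lex_nonneg (map d (perturb C ws)) \<longleftrightarrow> lex_nonneg (map d ws)"
proof (rule lex_nonneg_triangular[where c = "\<lambda>i j. C ^ (i - j)"])
  fix i assume "i < length (map d ws)"
  then show "map d (perturb C ws) ! i = (\<Sum>j\<le>i. C ^ (i - j) * map d ws ! j)"
    using linear_perturb[OF assms(1), of i ws C] by simp
qed (use assms in auto)

text \<open>Finitely many functionals and points give finitely many polynomial inequalities in \<open>C\<close>, each of which
  holds for all large \<open>C\<close>.\<close>

lemma perturb_nonneg:
  fixes D :: "('v::real_vector \<Rightarrow> real) set"
  assumes "finite D" and D: "\<And>d. d \<in> D \<Longrightarrow> linear d" "\<And>d. d \<in> D \<Longrightarrow> lex_nonneg (map d ws)"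
  shows "\<exists>C>0. \<forall>d\<in>D. \<forall>w\<in>set (perturb C ws). 0 \<le> d w"
proof -
  have "eventually (\<lambda>C. \<forall>d\<in>D. \<forall>i\<in>{..<length ws}. 0 \<le> d (perturb C ws ! i)) at_top"
  proof (intro eventually_ball_finite ballI)
    fix d i assume d: "d \<in> D" and i: "i \<in> {..<length ws}"
    then have "eventually (\<lambda>C. 0 \<le> (\<Sum>j\<le>i. C ^ (i - j) * map d ws ! j)) at_top"
      using D(2) by (intro eventually_nonneg_of_lex_nonneg) auto
    then show "eventually (\<lambda>C. 0 \<le> d (perturb C ws ! i)) at_top"
      using i by (simp add: linear_perturb[OF D(1)[OF d]])
  qed (use assms in auto)
  with eventually_gt_at_top[of 0]
  have "eventually (\<lambda>C. 0 < C \<and> (\<forall>d\<in>D. \<forall>i\<in>{..<length ws}. 0 \<le> d (perturb C ws ! i))) at_top"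
    by (rule eventually_conj)
  then obtain C where "0 < C" "\<forall>d\<in>D. \<forall>i\<in>{..<length ws}. 0 \<le> d (perturb C ws ! i)"
    using eventually_happens'[OF trivial_limit_at_top_linorder] by blast
  then show ?thesis by (intro exI[of _ C]) (auto simp: in_set_conv_nth)
qed

text \<open>What the perturbation achieves for a finite set \<open>X\<close> of terms: a lexicographic inequality between two of
  them also holds between their values at \<open>w\<close>.\<close>

definition compatible :: "(real \<times> 'm::ab_group_add NR) list \<Rightarrow> (real \<times> 'm) set \<Rightarrow> real \<times> 'm NR \<Rightarrow> bool" where
  "compatible ws X w \<longleftrightarrow>
    (\<forall>s\<in>X. \<forall>t\<in>X. lex_nonneg (map (weight (s - t)) ws) \<longrightarrow> 0 \<le> weight (s - t) w)"

lemma compatible_perturb: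
  assumes "finite X"
  shows "\<exists>C>0. \<forall>w\<in>set (perturb C ws). compatible ws X w \<and> (lex_nonneg (map fst ws) \<longrightarrow> 0 \<le> fst w)"
proof -
  let ?D = "{d \<in> insert fst ((\<lambda>(s, t). weight (s - t)) ` (X \<times> X)). lex_nonneg (map d ws)}"
  have "\<exists>C>0. \<forall>d\<in>?D. \<forall>w\<in>set (perturb C ws). 0 \<le> d w"
    using assms by (intro perturb_nonneg) (auto simp: linear_weight linear_fst)
  then obtain C where C: "0 < C" "\<forall>d\<in>?D. \<forall>w\<in>set (perturb C ws). 0 \<le> d w" by blast
  show ?thesis
  proof (intro exI conjI ballI impI)
    fix w assume w: "w \<in> set (perturb C ws)"
    show "compatible ws X w"
      unfolding compatible_def
    proof (intro ballI impI)
      fix s t assume "s \<in> X" "t \<in> X" "lex_nonneg (map (weight (s - t)) ws)"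
      then have "weight (s - t) \<in> ?D" by force
      with C(2) w show "0 \<le> weight (s - t) w" by blast
    qed
    assume "lex_nonneg (map fst ws)"
    then have "fst \<in> ?D" by simp
    with C(2) w show "0 \<le> fst w" by blast
  qed (rule C(1))
qed

lemma linear_nonneg_hull:
  fixes d :: "'v::real_vector \<Rightarrow> real"
  assumes d: "linear d" and "\<And>y. y \<in> Y \<Longrightarrow> 0 \<le> d y" and "w \<in> convex_cone hull Y"
  shows "0 \<le> d w"
  using assms(3)
proof (rule hull_induct)
  show "convex_cone {w. 0 \<le> d w}"
    by (simp add: convex_cone_iff linear_0[OF d] linear_add[OF d] linear_scale[OF d])
qed (use assms(2) in auto)

lemma compatible_hull:
  assumes "\<And>y. y \<in> Y \<Longrightarrow> compatible ws X y" and "w \<in> convex_cone hull Y"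
  shows "compatible ws X w"
  unfolding compatible_def
proof (intro ballI impI)
  fix s t assume st: "s \<in> X" "t \<in> X" "lex_nonneg (map (weight (s - t)) ws)"
  show "0 \<le> weight (s - t) w"
    using assms st by (intro linear_nonneg_hull[OF linear_weight _ assms(2)]) (auto simp: compatible_def)
qed

lemma trop_eval_leading:
  assumes "snd ` terms f \<subseteq> toric_monoid \<sigma>" "leading \<tau> ws f g" "compatible ws X w" "terms f \<subseteq> X"
  shows "trop_eval f (stratum_incl \<sigma> \<tau> (stratum_proj \<tau> w)) = ereal (weight g w)"
proof (rule trop_eval_max[OF assms(1)])
  show "g \<in> terms f" "snd g \<in> perp \<tau>" using assms(2) by (simp_all add: leading_def)
  fix h assume "h \<in> terms f" "snd h \<in> perp \<tau>"
  with assms(2-4) have "0 \<le> weight (g - h) w" unfolding leading_def compatible_def by blast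
  then show "weight h w \<le> weight g w" by (simp add: weight_diff)
qed

lemma flag_Phi_cases:
  obtains "\<And>g. g \<in> terms f \<Longrightarrow> snd g \<notin> perp \<tau>" "flag_Phi \<tau> (map (stratum_proj \<tau>) ws) f = None"
  | g where "leading \<tau> ws f g" "flag_Phi \<tau> (map (stratum_proj \<tau>) ws) f = Some (map (weight g) ws)"
proof (cases "\<exists>g\<in>terms f. snd g \<in> perp \<tau>")
  case True
  then show ?thesis using leading_exists flag_Phi_leading that(2) by metis
next
  case False
  then show ?thesis using flag_Phi_None that(1) by metis
qed

text \<open>At a compatible point the leading term attains the maximum, and terms of equal lexicographic value have
  equal weight there.\<close>

lemma trop_eval_eq_of_flag_Phi_eq:
  assumes "snd ` terms f \<subseteq> toric_monoid \<sigma>" "snd ` terms g \<subseteq> toric_monoid \<sigma>"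
    and Phi: "flag_Phi \<tau> (map (stratum_proj \<tau>) ws) f = flag_Phi \<tau> (map (stratum_proj \<tau>) ws) g"
    and X: "compatible ws X w" "terms f \<subseteq> X" "terms g \<subseteq> X"
  shows "trop_eval f (stratum_incl \<sigma> \<tau> (stratum_proj \<tau> w)) =
    trop_eval g (stratum_incl \<sigma> \<tau> (stratum_proj \<tau> w))"
proof (cases rule: flag_Phi_cases[of f \<tau> ws])
  case 1
  with Phi have gN: "flag_Phi \<tau> (map (stratum_proj \<tau>) ws) g = None" by simp
  show ?thesis
  proof (cases rule: flag_Phi_cases[of g \<tau> ws])
    case g: 1
    show ?thesis using trop_eval_dead[OF assms(1) 1(1)] trop_eval_dead[OF assms(2) g(1)] by simp
  qed (use gN in simp)
next
  case (2 s)
  show ?thesis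
  proof (cases rule: flag_Phi_cases[of g \<tau> ws])
    case 1
    with 2 Phi show ?thesis by simp
  next
    case g: (2 t)
    have "map (weight s) ws = map (weight t) ws" using 2 g Phi by simp
    then have "lex_nonneg (map (weight (s - t)) ws)" "lex_nonneg (map (weight (t - s)) ws)"
      by (simp_all only: lex_le_iff[symmetric] order_refl)
    moreover have "s \<in> X" "t \<in> X" using 2(1) g(1) X by (auto simp: leading_def)
    ultimately have "0 \<le> weight (s - t) w" "0 \<le> weight (t - s) w"
      using X(1) unfolding compatible_def by blast+
    then have "weight s w = weight t w" by (simp add: weight_diff)
    then show ?thesis
      using trop_eval_leading[OF assms(1) 2(1) X(1,2)] trop_eval_leading[OF assms(2) g(1) X(1,3)] by simp
  qed
qed

text \<open>Equal values at all perturbed points mean that the weights of the two leading terms agree there, and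
  the original points are recovered triangularly from the perturbed ones. The point \<open>0\<close>, where every leading
  term has weight \<open>0\<close>, detects whether there is a term orthogonal to \<open>\<tau>\<close> at all.\<close>

lemma flag_Phi_eq_of_trop_eval_eq:
  assumes "snd ` terms f \<subseteq> toric_monoid \<sigma>" "snd ` terms g \<subseteq> toric_monoid \<sigma>"
    and X: "terms f \<subseteq> X" "terms g \<subseteq> X" and C: "0 < C"
    and compat: "\<And>w. w \<in> set (perturb C ws) \<Longrightarrow> compatible ws X w"
    and eval: "\<And>w. w \<in> insert 0 (set (perturb C ws)) \<Longrightarrow> trop_eval f (stratum_incl \<sigma> \<tau> (stratum_proj \<tau> w)) =
      trop_eval g (stratum_incl \<sigma> \<tau> (stratum_proj \<tau> w))"
  shows "flag_Phi \<tau> (map (stratum_proj \<tau>) ws) f = flag_Phi \<tau> (map (stratum_proj \<tau>) ws) g"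
proof -
  have compat0: "compatible ws X 0"
    by (simp add: compatible_def linear_0[OF linear_weight])
  show ?thesis
  proof (cases rule: flag_Phi_cases[of f \<tau> ws])
    case f: 1
    then show ?thesis
    proof (cases rule: flag_Phi_cases[of g \<tau> ws])
      case g: (2 t)
      show ?thesis
        using eval[of 0] trop_eval_dead[OF assms(1) f(1), where w = 0]
          trop_eval_leading[OF assms(2) g(1) compat0 X(2)] by simp
    qed simp
  next
    case f: (2 s)
    then show ?thesis
    proof (cases rule: flag_Phi_cases[of g \<tau> ws])
      case g: 1
      show ?thesis
        using eval[of 0] trop_eval_dead[OF assms(2) g(1), where w = 0]
          trop_eval_leading[OF assms(1) f(1) compat0 X(1)] by simp
    next
      case g: (2 t)
      have eq: "weight s w = weight t w" if "w \<in> set (perturb C ws)" for w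
        using eval[of w] that trop_eval_leading[OF assms(2) g(1) compat[OF that] X(2)]
          trop_eval_leading[OF assms(1) f(1) compat[OF that] X(1)] by simp
      then have "map (weight s) (perturb C ws) = map (weight t) (perturb C ws)" by simp
      then have "lex_nonneg (map (weight (s - t)) (perturb C ws))"
        "lex_nonneg (map (weight (t - s)) (perturb C ws))"
        by (simp_all only: lex_le_iff[symmetric] order_refl)
      then have "map (weight s) ws = map (weight t) ws"
        unfolding lex_nonneg_perturb[OF linear_weight C] lex_le_iff[symmetric] by (intro antisym)
      with f g show ?thesis by simp
    qed
  qed
qed

section \<open>Flags contained in the vanishing locus\<close>

lemma face_of_linear_zero:
  fixes \<kappa> :: "'v::real_vector \<Rightarrow> real"
  assumes S: "convex S" and \<kappa>: "linear \<kappa>" and nonneg: "\<And>x. x \<in> S \<Longrightarrow> 0 \<le> \<kappa> x"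
  shows "{x \<in> S. \<kappa> x = 0} face_of S"
  unfolding face_of_def
proof (intro conjI ballI impI)
  show "{x \<in> S. \<kappa> x = 0} \<subseteq> S" by auto
  show "convex {x \<in> S. \<kappa> x = 0}"
    using S by (auto simp: convex_def linear_add[OF \<kappa>] linear_scale[OF \<kappa>])
next
  fix a b x assume ab: "a \<in> S" "b \<in> S" and x: "x \<in> {x \<in> S. \<kappa> x = 0}" "x \<in> open_segment a b"
  then obtain t where t: "0 < t" "t < 1" "x = (1 - t) *\<^sub>R a + t *\<^sub>R b" by (auto simp: in_segment)
  have "(1 - t) * \<kappa> a + t * \<kappa> b = 0"
    using x(1) t(3) by (simp add: linear_add[OF \<kappa>] linear_scale[OF \<kappa>])
  moreover have "0 \<le> (1 - t) * \<kappa> a" "0 \<le> t * \<kappa> b" using t nonneg ab by auto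
  ultimately have "(1 - t) * \<kappa> a = 0" "t * \<kappa> b = 0" by linarith+
  with t ab show "a \<in> {x \<in> S. \<kappa> x = 0}" "b \<in> {x \<in> S. \<kappa> x = 0}" by auto
qed

lemma flag_mono:
  assumes "flag_of_cones \<sigma> \<tau> Cs" "i \<le> j" "j < length Cs"
  shows "Cs ! i \<subseteq> Cs ! j"
  using assms(2,3)
proof (induction j rule: dec_induct)
  case (step j)
  have "cone_face_of (stratum_proj \<tau> -` (Cs ! j)) (stratum_proj \<tau> -` (Cs ! Suc j))"
    using assms(1) step.prems by (auto simp: flag_of_cones_def face_in_stratum_def)
  then have sub: "stratum_proj \<tau> -` (Cs ! j) \<subseteq> stratum_proj \<tau> -` (Cs ! Suc j)"
    using face_of_imp_subset by (auto simp: cone_face_of_def)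
  have "polyhedral_cone_in_stratum \<tau> (Cs ! j)" using assms(1) step.prems by (auto simp: flag_of_cones_def)
  then have "Cs ! j \<subseteq> range (stratum_proj \<tau>)" by (auto simp: polyhedral_cone_in_stratum_def)
  with sub have "Cs ! j \<subseteq> Cs ! Suc j" by blast
  with step show ?case by auto
qed simp

text \<open>Consecutive cones of a flag differ since their dimensions do.\<close>

lemma flag_points_spec:
  assumes "flag_of_cones \<sigma> \<tau> Cs"
  shows "length (flag_points Cs) + 1 = length Cs"
    and "i < length (flag_points Cs) \<Longrightarrow> flag_points Cs ! i \<in> Cs ! Suc i - Cs ! i"
proof -
  have "\<exists>w. w \<in> Cs ! Suc i - Cs ! i" if "Suc i < length Cs" for i
  proof (rule ccontr)
    assume "\<not> ?thesis"
    moreover have "Cs ! i \<subseteq> Cs ! Suc i" using flag_mono[OF assms, of i "Suc i"] that by simp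
    ultimately have "Cs ! i = Cs ! Suc i" by blast
    moreover have "dim_in_stratum \<tau> (Cs ! i) = i" "dim_in_stratum \<tau> (Cs ! Suc i) = Suc i"
      using assms that by (auto simp: flag_of_cones_def)
    ultimately show False by simp
  qed
  then obtain w where w: "\<And>i. Suc i < length Cs \<Longrightarrow> w i \<in> Cs ! Suc i - Cs ! i" by metis
  have ne: "Cs \<noteq> []" using assms by (simp add: flag_of_cones_def)
  have "\<exists>ws. length ws + 1 = length Cs \<and> (\<forall>i<length ws. ws ! i \<in> Cs ! Suc i - Cs ! i)"
    using w ne by (intro exI[of _ "map w [0..<length Cs - 1]"]) (cases Cs; simp)
  from someI_ex[OF this]
  show "length (flag_points Cs) + 1 = length Cs"
    "i < length (flag_points Cs) \<Longrightarrow> flag_points Cs ! i \<in> Cs ! Suc i - Cs ! i"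
    unfolding flag_points_def by blast+
qed

lemma snd_terms_subset: "f \<in> monoid_semiring S Mon \<Longrightarrow> snd ` terms f \<subseteq> Mon"
  using terms_subset by fastforce

text \<open>The largest cone of the flag contains the chosen points and hence their perturbations, so the members of
  a pair in \<open>E\<close> take equal values at the perturbed points.\<close>

lemma subset_flag_congruence:
  assumes flag: "flag_of_cones \<sigma> \<tau> Cs" and cont: "flag_contained_in \<sigma> \<tau> Cs (trop_V \<sigma> E)"
    and E: "E \<subseteq> monoid_semiring S (toric_monoid \<sigma>) \<times> monoid_semiring S (toric_monoid \<sigma>)"
  shows "E \<subseteq> flag_congruence S \<sigma> \<tau> Cs"
proof (rule subrelI)
  fix f g assume fg: "(f, g) \<in> E"
  define n where "n = length Cs - 1"
  have ne: "Cs \<noteq> []" using flag by (simp add: flag_of_cones_def)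
  have len: "length (flag_points Cs) = n" using flag_points_spec(1)[OF flag] by (simp add: n_def)
  obtain H where H: "Cs ! n = stratum_proj \<tau> ` (convex_cone hull H)"
    using flag ne unfolding flag_of_cones_def polyhedral_cone_in_stratum_def n_def
    by (meson diff_less length_greater_0_conv less_numeral_extra(1))
  have "\<exists>w\<in>convex_cone hull H. flag_points Cs ! i = stratum_proj \<tau> w" if "i < n" for i
  proof -
    have "flag_points Cs ! i \<in> Cs ! Suc i" using flag_points_spec(2)[OF flag, of i] that len by simp
    also have "\<dots> \<subseteq> Cs ! n"
      using that ne by (intro flag_mono[OF flag]) (auto simp: n_def)
    finally show ?thesis by (auto simp: H)
  qed
  then obtain w where w: "\<And>i. i < n \<Longrightarrow> w i \<in> convex_cone hull H \<and> flag_points Cs ! i = stratum_proj \<tau> (w i)"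
    by metis
  define ws where "ws = map w [0..<n]"
  have pts: "flag_points Cs = map (stratum_proj \<tau>) ws"
    using w len by (intro nth_equalityI) (auto simp: ws_def)
  obtain C where C: "0 < C" "\<forall>w\<in>set (perturb C ws). compatible ws (terms f \<union> terms g) w"
    using compatible_perturb[of "terms f \<union> terms g" ws] by auto
  have f: "f \<in> monoid_semiring S (toric_monoid \<sigma>)" and g: "g \<in> monoid_semiring S (toric_monoid \<sigma>)"
    using fg E by auto
  have hull: "v \<in> convex_cone hull H" if "v \<in> insert 0 (set (perturb C ws))" for v
  proof (cases "v = 0")
    case True
    then show ?thesis by (simp add: convex_cone_hull_contains_0)
  next
    case False
    with that obtain i where i: "i < n" "v = perturb C ws ! i"
      by (auto simp: in_set_conv_nth ws_def)
    have "v = (\<Sum>j\<le>i. C ^ (i - j) *\<^sub>R ws ! j)" using i by (simp add: nth_perturb ws_def)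
    also have "\<dots> \<in> convex_cone hull H"
    proof (rule submonoid_sum)
      fix j assume "j \<in> {..i}"
      then show "C ^ (i - j) *\<^sub>R ws ! j \<in> convex_cone hull H"
        using w[of j] i C(1) by (intro convex_cone_hull_mul) (auto simp: ws_def)
    qed (auto intro: convex_cone_hull_add convex_cone_hull_contains_0)
    finally show ?thesis .
  qed
  have "flag_Phi \<tau> (map (stratum_proj \<tau>) ws) f = flag_Phi \<tau> (map (stratum_proj \<tau>) ws) g"
  proof (rule flag_Phi_eq_of_trop_eval_eq[where C = C and X = "terms f \<union> terms g" and \<sigma> = \<sigma>])
    fix v assume "v \<in> insert 0 (set (perturb C ws))"
    from hull[OF this] have "stratum_proj \<tau> v \<in> Cs ! n" by (simp add: H)
    moreover have "Cs ! n \<in> set Cs" using ne by (simp add: n_def)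
    ultimately have "stratum_incl \<sigma> \<tau> (stratum_proj \<tau> v) \<in> trop_V \<sigma> E"
      using cont unfolding flag_contained_in_def by blast
    with fg show "trop_eval f (stratum_incl \<sigma> \<tau> (stratum_proj \<tau> v)) =
      trop_eval g (stratum_incl \<sigma> \<tau> (stratum_proj \<tau> v))"
      unfolding trop_V_def by blast
  qed (use C snd_terms_subset[OF f] snd_terms_subset[OF g] in auto)
  with f g show "(f, g) \<in> flag_congruence S \<sigma> \<tau> Cs"
    by (simp add: flag_congruence_def pts)
qed

section \<open>Flags spanned by triangular lists of points\<close>

text \<open>The functionals \<open>\<psi> i\<close> witness that the points are linearly independent modulo the span of \<open>\<tau>\<close>.\<close>

locale flag_generators =
  fixes \<tau> :: "'m::ab_group_add NR set" and us :: "(real \<times> 'm NR) list"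
    and \<psi> :: "nat \<Rightarrow> real \<times> 'm NR \<Rightarrow> real"
  assumes linear_\<psi>: "i < length us \<Longrightarrow> linear (\<psi> i)"
    and \<psi>_span: "i < length us \<Longrightarrow> s \<in> span \<tau> \<Longrightarrow> \<psi> i (0, s) = 0"
    and \<psi>_diag: "i < length us \<Longrightarrow> \<psi> i (us ! i) \<noteq> 0"
    and \<psi>_below: "i < length us \<Longrightarrow> j < i \<Longrightarrow> \<psi> i (us ! j) = 0"
    and us_nonneg: "u \<in> set us \<Longrightarrow> 0 \<le> fst u"
    and finite_dim: "\<exists>F. finite F \<and> \<tau> \<subseteq> span F"
begin

definition gen_cone :: "nat \<Rightarrow> (real \<times> 'm NR) set" where
  "gen_cone j = convex_cone hull ((!) us ` {..<j})"

text \<open>Faces and dimensions in a stratum are defined through this preimage in \<open>\<real> \<times> N\<^sub>\<real>\<close>.\<close>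

definition cone_preimage :: "nat \<Rightarrow> (real \<times> 'm NR) set" where
  "cone_preimage j = stratum_proj \<tau> -` stratum_proj \<tau> ` gen_cone j"

definition flag :: "(real \<times> 'm NR set) set list" where
  "flag = map (\<lambda>j. stratum_proj \<tau> ` gen_cone j) [0..<Suc (length us)]"

lemma length_flag [simp]: "length flag = Suc (length us)"
  by (simp add: flag_def)

lemma nth_flag: "j \<le> length us \<Longrightarrow> flag ! j = stratum_proj \<tau> ` gen_cone j"
  by (simp add: flag_def del: upt_Suc)

lemma gen_cone_eq: "gen_cone j = {\<Sum>i<j. c i *\<^sub>R us ! i | c. \<forall>i. 0 \<le> c i}"
  unfolding gen_cone_def by (rule convex_cone_hull_image_eq) simp

lemma gen_cone_SucE:
  assumes "w \<in> gen_cone (Suc j)"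
  obtains v c where "v \<in> gen_cone j" "0 \<le> c" "w = v + c *\<^sub>R us ! j"
proof -
  obtain c where c: "\<forall>i. 0 \<le> c i" "w = (\<Sum>i<Suc j. c i *\<^sub>R us ! i)"
    using assms unfolding gen_cone_eq by blast
  have "(\<Sum>i<j. c i *\<^sub>R us ! i) \<in> gen_cone j" unfolding gen_cone_eq using c(1) by blast
  then show ?thesis by (rule that[of _ "c j"]) (use c in simp_all)
qed

lemma gen_cone_mono: "gen_cone j \<subseteq> gen_cone (Suc j)"
  unfolding gen_cone_def by (intro hull_mono) auto

lemma \<psi>_gen_cone:
  assumes "j < length us" "v \<in> gen_cone j"
  shows "\<psi> j v = 0"
proof -
  obtain c where "v = (\<Sum>i<j. c i *\<^sub>R us ! i)" using assms(2) unfolding gen_cone_eq by blast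
  then show ?thesis
    using assms(1) by (simp add: linear_sum[OF linear_\<psi>] linear_scale[OF linear_\<psi>] \<psi>_below)
qed

lemma cone_preimage_iff: "w \<in> cone_preimage j \<longleftrightarrow> (\<exists>v\<in>gen_cone j. \<exists>s\<in>span \<tau>. w = v + (0, s))"
proof
  assume "w \<in> cone_preimage j"
  then obtain v where v: "v \<in> gen_cone j" "fst w = fst v" "snd w - snd v \<in> span \<tau>"
    by (auto simp: cone_preimage_def stratum_proj_eq_iff)
  then have "w = v + (0, snd w - snd v)" by (simp add: prod_eq_iff)
  with v show "\<exists>v\<in>gen_cone j. \<exists>s\<in>span \<tau>. w = v + (0, s)" by blast
next
  assume "\<exists>v\<in>gen_cone j. \<exists>s\<in>span \<tau>. w = v + (0, s)"
  then obtain v s where v: "v \<in> gen_cone j" "s \<in> span \<tau>" "w = v + (0, s)" by blast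
  then have "stratum_proj \<tau> w = stratum_proj \<tau> v" by (simp add: stratum_proj_eq_iff)
  with v(1) show "w \<in> cone_preimage j" by (auto simp: cone_preimage_def)
qed

lemma convex_cone_preimage: "convex_cone (cone_preimage j)"
proof -
  have cone: "convex_cone (gen_cone j)" unfolding gen_cone_def by (rule convex_cone_convex_cone_hull)
  have "0 = 0 + (0 :: real, 0 :: 'm NR)" by (simp add: prod_eq_iff)
  with convex_cone_contains_0[OF cone] span_zero have "0 \<in> cone_preimage j" unfolding cone_preimage_iff by blast
  moreover have "x + y \<in> cone_preimage j" if xD: "x \<in> cone_preimage j" and yD: "y \<in> cone_preimage j" for x y
  proof -
    obtain v s where "v \<in> gen_cone j" "s \<in> span \<tau>" "x = v + (0, s)" using xD unfolding cone_preimage_iff by blast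
    moreover obtain v' s' where "v' \<in> gen_cone j" "s' \<in> span \<tau>" "y = v' + (0, s')"
      using yD unfolding cone_preimage_iff by blast
    ultimately have "v + v' \<in> gen_cone j" "s + s' \<in> span \<tau>" "x + y = (v + v') + (0, s + s')"
      using convex_cone_add[OF cone] by (auto simp: span_add prod_eq_iff)
    then show ?thesis unfolding cone_preimage_iff by blast
  qed
  moreover have "c *\<^sub>R x \<in> cone_preimage j" if xD: "x \<in> cone_preimage j" and c: "0 \<le> c" for x c
  proof -
    obtain v s where "v \<in> gen_cone j" "s \<in> span \<tau>" "x = v + (0, s)" using xD unfolding cone_preimage_iff by blast
    then have "c *\<^sub>R v \<in> gen_cone j" "c *\<^sub>R s \<in> span \<tau>" "c *\<^sub>R x = c *\<^sub>R v + (0, c *\<^sub>R s)"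
      using convex_cone_scaleR[OF cone c] by (auto simp: span_scale scaleR_right_distrib)
    then show ?thesis unfolding cone_preimage_iff by blast
  qed
  ultimately show ?thesis by (simp add: convex_cone_iff)
qed

text \<open>\<open>\<psi> j\<close>, normalised at the new generator, is the coefficient of that generator.\<close>

lemma cone_preimage_kernel:
  assumes j: "j < length us"
  shows "cone_preimage j = {w \<in> cone_preimage (Suc j). \<psi> j w / \<psi> j (us ! j) = 0}"
    and "w \<in> cone_preimage (Suc j) \<Longrightarrow> 0 \<le> \<psi> j w / \<psi> j (us ! j)"
proof -
  note lin = linear_\<psi>[OF j]
  have val: "\<psi> j (v + c *\<^sub>R us ! j + (0, s)) = c * \<psi> j (us ! j)" if "v \<in> gen_cone j" "s \<in> span \<tau>" for v c s
    using \<psi>_gen_cone[OF j that(1)] \<psi>_span[OF j that(2)] by (simp add: linear_add[OF lin] linear_scale[OF lin])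
  have split: "\<exists>v\<in>gen_cone j. \<exists>s\<in>span \<tau>. \<exists>c\<ge>0. w = v + c *\<^sub>R us ! j + (0, s)" if "w \<in> cone_preimage (Suc j)" for w
    using that unfolding cone_preimage_iff by (metis gen_cone_SucE)
  show "0 \<le> \<psi> j w / \<psi> j (us ! j)" if "w \<in> cone_preimage (Suc j)"
    using split[OF that] val \<psi>_diag[OF j] by auto
  show "cone_preimage j = {w \<in> cone_preimage (Suc j). \<psi> j w / \<psi> j (us ! j) = 0}"
  proof (intro equalityI subsetI CollectI conjI)
    fix w assume w: "w \<in> cone_preimage j"
    then show "w \<in> cone_preimage (Suc j)" unfolding cone_preimage_iff using gen_cone_mono by blast
    show "\<psi> j w / \<psi> j (us ! j) = 0"
      using w val[of _ _ 0] unfolding cone_preimage_iff by auto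
  next
    fix w assume w: "w \<in> {w \<in> cone_preimage (Suc j). \<psi> j w / \<psi> j (us ! j) = 0}"
    then obtain v s c where v: "v \<in> gen_cone j" "s \<in> span \<tau>" "w = v + c *\<^sub>R us ! j + (0, s)"
      using split by blast
    with w val[OF v(1,2)] \<psi>_diag[OF j] have "c = 0" by simp
    with v show "w \<in> cone_preimage j" unfolding cone_preimage_iff by auto
  qed
qed

lemma face_cone_preimage:
  assumes j: "j < length us"
  shows "cone_face_of (cone_preimage j) (cone_preimage (Suc j))"
proof -
  have "linear (\<lambda>w. \<psi> j w / \<psi> j (us ! j))"
    by (rule linearI) (simp_all add: linear_add[OF linear_\<psi>[OF j]] linear_scale[OF linear_\<psi>[OF j]] add_divide_distrib)
  moreover have "convex (cone_preimage (Suc j))" using convex_cone_preimage by (simp add: convex_cone_def)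
  ultimately have "{w \<in> cone_preimage (Suc j). \<psi> j w / \<psi> j (us ! j) = 0} face_of cone_preimage (Suc j)"
    using cone_preimage_kernel(2)[OF j] by (intro face_of_linear_zero)
  then have "cone_preimage j face_of cone_preimage (Suc j)" using cone_preimage_kernel(1)[OF j] by simp
  then show ?thesis using convex_cone_nonempty[OF convex_cone_preimage] by (simp add: cone_face_of_def)
qed

text \<open>A basis of the span of \<open>\<tau>\<close> together with the first \<open>j\<close> points is a basis of the span of the preimage.\<close>

lemma dim_cone_preimage:
  assumes "j \<le> length us"
  shows "dim (cone_preimage j) = dim \<tau> + j"
proof -
  obtain T where T: "T \<subseteq> \<tau>" "independent T" "\<tau> \<subseteq> span T"
    by (rule maximal_independent_subset)
  have fin: "finite T"
    using finite_dim T by (meson independent_span_bound subset_trans)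
  have span_T: "span T = span \<tau>" using T by (metis span_mono span_span subset_antisym)
  have dim_\<tau>: "dim \<tau> = card T" using span_T T(2) by (rule dim_eq_card)
  have lin0: "linear (Pair 0 :: 'm NR \<Rightarrow> real \<times> 'm NR)" by (rule linearI) simp_all
  define B where "B j = Pair 0 ` T \<union> (!) us ` {..<j}" for j
  have B_Suc: "B (Suc j) = insert (us ! j) (B j)" for j
    by (auto simp: B_def lessThan_Suc)
  have span0: "(0 :: real, s) \<in> span (Pair 0 ` T)" if "s \<in> span \<tau>" for s :: "'m NR"
  proof -
    have "(0 :: real, s) \<in> Pair 0 ` span T" using that by (simp add: span_T)
    then show ?thesis by (simp only: linear_span_image[OF lin0])
  qed
  have new: "us ! j \<notin> span (B j)" if j: "j < length us" for j
  proof
    assume "us ! j \<in> span (B j)"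
    moreover have "\<psi> j b = 0" if "b \<in> B j" for b
    proof -
      have "T \<subseteq> span \<tau>" using T(1) span_superset by blast
      with that show ?thesis using \<psi>_below[OF j] \<psi>_span[OF j] by (auto simp: B_def)
    qed
    ultimately have "\<psi> j (us ! j) = 0" using linear_eq_0_on_span[OF linear_\<psi>[OF j]] by blast
    with \<psi>_diag[OF j] show False by simp
  qed
  have B: "independent (B j) \<and> finite (B j) \<and> card (B j) = card T + j" if "j \<le> length us" for j
    using that
  proof (induction j)
    case 0
    have "inj (Pair 0 :: 'm NR \<Rightarrow> real \<times> 'm NR)" by (simp add: inj_on_def)
    then have "independent (Pair 0 ` T :: (real \<times> 'm NR) set)"
      using linear_independent_injective_image[OF lin0 T(2)] by (simp add: inj_on_def)
    then show ?case using fin by (simp add: B_def card_image inj_on_def)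
  next
    case (Suc j)
    then have "us ! j \<notin> span (B j)" using new by simp
    moreover from this have "us ! j \<notin> B j" using span_base by blast
    ultimately show ?case using Suc by (simp add: B_Suc independent_insertI)
  qed
  have "B j \<subseteq> cone_preimage j"
  proof
    fix b assume "b \<in> B j"
    then consider t where "t \<in> T" "b = (0, t)" | i where "i < j" "b = us ! i" by (auto simp: B_def)
    then show "b \<in> cone_preimage j"
    proof cases
      case 1
      then have "b = 0 + (0, t)" "t \<in> span \<tau>" using T(1) by (auto intro: span_base)
      then show ?thesis unfolding cone_preimage_iff gen_cone_def using convex_cone_hull_contains_0 by blast
    next
      case 2
      then have "b \<in> gen_cone j" by (auto simp: gen_cone_def intro: hull_inc)
      moreover have "b = b + (0, 0)" by (simp add: prod_eq_iff)
      ultimately show ?thesis unfolding cone_preimage_iff using span_zero by blast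
    qed
  qed
  moreover have "cone_preimage j \<subseteq> span (B j)"
  proof
    fix w assume "w \<in> cone_preimage j"
    then obtain v s where v: "v \<in> gen_cone j" "s \<in> span \<tau>" "w = v + (0, s)" unfolding cone_preimage_iff by blast
    have "gen_cone j \<subseteq> span (B j)"
      unfolding gen_cone_def by (intro hull_minimal convex_cone_span) (auto simp: B_def intro: span_base)
    moreover have "(0, s) \<in> span (B j)"
      using span0[OF v(2)] span_mono[of "Pair 0 ` T" "B j"] by (auto simp: B_def)
    ultimately show "w \<in> span (B j)" using v by (auto intro: span_add)
  qed
  ultimately have "span (B j) = span (cone_preimage j)" by (metis span_mono span_span subset_antisym)
  from dim_eq_card[OF this] B[OF assms] show ?thesis by (simp add: dim_\<tau>)
qed

lemma flag_of_cones_flag: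
  assumes "cone_face_of \<tau> \<sigma>"
  shows "flag_of_cones \<sigma> \<tau> flag"
  unfolding flag_of_cones_def
proof (intro conjI allI impI)
  show "flag \<noteq> []" by (simp add: flag_def)
  fix j
  {
    assume j: "j < length flag"
    show "polyhedral_cone_in_stratum \<tau> (flag ! j)"
      unfolding polyhedral_cone_in_stratum_def
    proof (intro exI conjI)
      show "flag ! j = stratum_proj \<tau> ` (convex_cone hull ((!) us ` {..<j}))"
        using j by (simp add: nth_flag gen_cone_def)
      show "(!) us ` {..<j} \<subseteq> {0..} \<times> UNIV"
      proof
        fix u assume "u \<in> (!) us ` {..<j}"
        then have "u \<in> set us" using j by auto
        then show "u \<in> {0..} \<times> UNIV" using us_nonneg by (simp add: mem_Times_iff)
      qed
    qed simp
    show "dim_in_stratum \<tau> (flag ! j) = j"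
      using j dim_cone_preimage[of j] by (simp add: dim_in_stratum_def nth_flag cone_preimage_def)
  next
    assume "Suc j < length flag"
    then show "face_in_stratum \<tau> (flag ! j) (flag ! Suc j)"
      using face_cone_preimage[of j] by (simp add: face_in_stratum_def nth_flag cone_preimage_def)
  }
qed (rule assms)

text \<open>Any other choice of points in the successive cones is related to the generators by a triangular
  matrix with positive diagonal, up to the span of \<open>\<tau>\<close>, and defines the same lexicographic order.\<close>

lemma flag_points_flag:
  assumes "cone_face_of \<tau> \<sigma>"
  obtains vs where "flag_points flag = map (stratum_proj \<tau>) vs"
    "\<And>d :: real \<times> 'm NR \<Rightarrow> real. linear d \<Longrightarrow> lex_nonneg (map d vs) \<longleftrightarrow> lex_nonneg (map d us)"
proof -
  note spec = flag_points_spec[OF flag_of_cones_flag[OF assms]]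
  have len: "length (flag_points flag) = length us" using spec(1) by simp
  have "\<exists>c. 0 < c i \<and> flag_points flag ! i = stratum_proj \<tau> (\<Sum>j\<le>i. c j *\<^sub>R us ! j)"
    if i: "i < length us" for i
  proof -
    have "flag_points flag ! i \<in> stratum_proj \<tau> ` gen_cone (Suc i)" "flag_points flag ! i \<notin> stratum_proj \<tau> ` gen_cone i"
      using spec(2)[of i] i len by (simp_all add: nth_flag)
    then obtain c where c: "\<forall>j. 0 \<le> c j" "flag_points flag ! i = stratum_proj \<tau> (\<Sum>j<Suc i. c j *\<^sub>R us ! j)"
      and notin: "flag_points flag ! i \<notin> stratum_proj \<tau> ` gen_cone i"
      unfolding gen_cone_eq[of "Suc i"] by blast
    have "c i \<noteq> 0"
    proof
      assume "c i = 0"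
      then have "flag_points flag ! i = stratum_proj \<tau> (\<Sum>j<i. c j *\<^sub>R us ! j)" using c(2) by simp
      moreover have "(\<Sum>j<i. c j *\<^sub>R us ! j) \<in> gen_cone i" unfolding gen_cone_eq using c(1) by blast
      ultimately show False using notin by blast
    qed
    with c(1) have "0 < c i" by (simp add: less_le)
    with c(2) show ?thesis by (auto simp: lessThan_Suc_atMost)
  qed
  then have "\<forall>i. i < length us \<longrightarrow>
      (\<exists>c. 0 < c i \<and> flag_points flag ! i = stratum_proj \<tau> (\<Sum>j\<le>i. c j *\<^sub>R us ! j))" by blast
  then obtain c where "\<forall>i. i < length us \<longrightarrow>
      0 < c i i \<and> flag_points flag ! i = stratum_proj \<tau> (\<Sum>j\<le>i. c i j *\<^sub>R us ! j)"
    unfolding choice_iff' by blast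
  then have c: "\<And>i. i < length us \<Longrightarrow> 0 < c i i"
    "\<And>i. i < length us \<Longrightarrow> flag_points flag ! i = stratum_proj \<tau> (\<Sum>j\<le>i. c i j *\<^sub>R us ! j)"
    by blast+
  define vs where "vs = map (\<lambda>i. \<Sum>j\<le>i. c i j *\<^sub>R us ! j) [0..<length us]"
  show ?thesis
  proof (rule that[of vs])
    show "flag_points flag = map (stratum_proj \<tau>) vs"
      using c len by (intro nth_equalityI) (auto simp: vs_def)
    show "lex_nonneg (map d vs) \<longleftrightarrow> lex_nonneg (map d us)" if d: "linear d" for d :: "real \<times> 'm NR \<Rightarrow> real"
    proof (rule lex_nonneg_triangular[where c = c])
      show "0 < c i i" if "i < length (map d us)" for i using that c(1) by simp
      show "map d vs ! i = (\<Sum>j\<le>i. c i j * map d us ! j)" if "i < length (map d us)" for i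
        using that by (simp add: vs_def linear_sum[OF d] linear_scale[OF d])
    qed (simp add: vs_def)
  qed
qed

lemma flag_contained:
  assumes face: "cone_face_of \<tau> \<sigma>"
    and B: "\<And>f g. (f, g) \<in> B \<Longrightarrow> snd ` terms f \<subseteq> toric_monoid \<sigma> \<and> snd ` terms g \<subseteq> toric_monoid \<sigma> \<and>
      flag_Phi \<tau> (map (stratum_proj \<tau>) ws) f = flag_Phi \<tau> (map (stratum_proj \<tau>) ws) g \<and>
      (\<forall>u\<in>set us. compatible ws (terms f \<union> terms g) u)"
  shows "flag_contained_in \<sigma> \<tau> flag (trop_V \<sigma> B)"
  unfolding flag_contained_in_def
proof (intro ballI image_subsetI)
  fix Cn x assume "Cn \<in> set flag" "x \<in> Cn"
  then obtain j w where j: "j \<le> length us" and w: "w \<in> gen_cone j" "x = stratum_proj \<tau> w"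
    by (auto simp: flag_def less_Suc_eq_le simp del: upt_Suc)
  have sub: "(!) us ` {..<j} \<subseteq> set us" using j by auto
  have "0 \<le> fst w"
  proof (rule linear_nonneg_hull[OF linear_fst])
    show "w \<in> convex_cone hull ((!) us ` {..<j})" using w(1) by (simp only: gen_cone_def)
    show "0 \<le> fst y" if "y \<in> (!) us ` {..<j}" for y using that sub by (intro us_nonneg) blast
  qed
  moreover have "\<tau> \<subseteq> \<sigma>" using face by (auto simp: cone_face_of_def dest: face_of_imp_subset)
  ultimately have "stratum_incl \<sigma> \<tau> x \<in> {0..} \<times> NR_of \<sigma>"
    unfolding w(2) by (intro stratum_incl_mem)
  moreover have "trop_eval f (stratum_incl \<sigma> \<tau> x) = trop_eval g (stratum_incl \<sigma> \<tau> x)" if fg: "(f, g) \<in> B" for f g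
  proof -
    have "compatible ws (terms f \<union> terms g) w"
    proof (rule compatible_hull)
      show "w \<in> convex_cone hull ((!) us ` {..<j})" using w(1) by (simp only: gen_cone_def)
      show "compatible ws (terms f \<union> terms g) y" if "y \<in> (!) us ` {..<j}" for y
        using that sub B[OF fg] by blast
    qed
    then show ?thesis
      unfolding w(2) using B[OF fg] by (intro trop_eval_eq_of_flag_Phi_eq[of f \<sigma> g \<tau> ws]) blast+
  qed
  ultimately show "stratum_incl \<sigma> \<tau> x \<in> trop_V \<sigma> B" by (auto simp: trop_V_def)
qed

end

section \<open>Prime congruences are flag congruences\<close>

lemma toric_monoid_0: "0 \<in> toric_monoid \<sigma>"
  by (simp add: toric_monoid_def)

lemma toric_monoid_add: "u \<in> toric_monoid \<sigma> \<Longrightarrow> v \<in> toric_monoid \<sigma> \<Longrightarrow> u + v \<in> toric_monoid \<sigma>"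
  by (simp add: toric_monoid_def add_nonpos_nonpos)

context prime_monoid_congruence
begin

text \<open>A polynomial is congruent to the monomial of its leading term, or to \<open>0\<close> if it has no surviving term, so the
  congruence of polynomials reduces to the order of their leading terms.\<close>

lemma cong_iff_flag_Phi:
  assumes live: "live = Mon \<inter> perp \<tau>"
    and lex: "\<And>g. g \<in> term_group \<Longrightarrow> g \<in> term_nonneg \<longleftrightarrow> lex_nonneg (map (weight g) ws)"
    and f: "f \<in> A" and g: "g \<in> A"
  shows "(f, g) \<in> P \<longleftrightarrow> flag_Phi \<tau> (map (stratum_proj \<tau>) ws) f = flag_Phi \<tau> (map (stratum_proj \<tau>) ws) g"
proof -
  have in_T: "t \<in> live_terms \<longleftrightarrow> snd t \<in> perp \<tau>" if "h \<in> A" "t \<in> terms h" for h t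
    using terms_subset[OF that(1)] that(2) by (auto simp: in_live_terms_iff live)
  have diff_G: "s - t \<in> term_group" if "s \<in> live_terms" "t \<in> live_terms" for s t using that unfolding term_group_def by blast
  have zero: "(h, 0) \<in> P" if h: "h \<in> A" and dead: "\<And>t. t \<in> terms h \<Longrightarrow> snd t \<notin> perp \<tau>" for h
    using in_T[OF h] dead by (intro cong_zero[OF h]) blast
  have lead: "(h, monomial t) \<in> P \<and> t \<in> live_terms" if h: "h \<in> A" and t: "leading \<tau> ws h t" for h t
  proof
    have tT: "t \<in> live_terms" using t in_T[OF h] by (auto simp: leading_def)
    then show "t \<in> live_terms" .
    show "(h, monomial t) \<in> P"
    proof (rule cong_leading_monomial[OF h _ tT])
      show "t \<in> terms h" using t by (simp add: leading_def)
      fix s assume s: "s \<in> terms h" "s \<in> live_terms"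
      then have "lex_nonneg (map (weight (t - s)) ws)"
        using t in_T[OF h s(1)] by (simp add: leading_def)
      then have "t - s \<in> term_nonneg" using lex diff_G tT s(2) by blast
      then show "quot_le P (monomial s) (monomial t)" using diff_term_nonneg_iff[OF tT s(2)] by blast
    qed
  qed
  show ?thesis
  proof (cases rule: flag_Phi_cases[of f \<tau> ws])
    case f': 1
    note f0 = zero[OF f f'(1)]
    show ?thesis
    proof (cases rule: flag_Phi_cases[of g \<tau> ws])
      case g': 1
      have "(f, g) \<in> P" by (rule trans[OF f0 sym[OF zero[OF g g'(1)]]])
      with f'(2) g'(2) show ?thesis by simp
    next
      case g': (2 t)
      have "(f, g) \<notin> P"
      proof
        assume "(f, g) \<in> P"
        from trans[OF trans[OF sym[OF conjunct1[OF lead[OF g g'(1)]]] sym[OF this]] f0]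
        show False using monomial_live_nonzero lead[OF g g'(1)] by blast
      qed
      with f'(2) g'(2) show ?thesis by simp
    qed
  next
    case f': (2 s)
    note s = lead[OF f f'(1)]
    show ?thesis
    proof (cases rule: flag_Phi_cases[of g \<tau> ws])
      case g': 1
      have "(f, g) \<notin> P"
      proof
        assume "(f, g) \<in> P"
        from trans[OF trans[OF sym[OF conjunct1[OF s]] this] zero[OF g g'(1)]]
        show False using monomial_live_nonzero s by blast
      qed
      with f'(2) g'(2) show ?thesis by simp
    next
      case g': (2 t)
      note t = lead[OF g g'(1)]
      have "(f, g) \<in> P \<longleftrightarrow> (monomial s, monomial t) \<in> P"
      proof
        assume "(f, g) \<in> P"
        from trans[OF trans[OF sym[OF conjunct1[OF s]] this] conjunct1[OF t]]
        show "(monomial s, monomial t) \<in> P" .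
      next
        assume "(monomial s, monomial t) \<in> P"
        from trans[OF trans[OF conjunct1[OF s] this] sym[OF conjunct1[OF t]]]
        show "(f, g) \<in> P" .
      qed
      also have "\<dots> \<longleftrightarrow> s - t \<in> term_nonneg \<and> t - s \<in> term_nonneg" using s t by (intro cong_monomial_iff) auto
      also have "\<dots> \<longleftrightarrow> lex_nonneg (map (weight (s - t)) ws) \<and> lex_nonneg (map (weight (t - s)) ws)"
        using lex diff_G s t by simp
      also have "\<dots> \<longleftrightarrow> map (weight s) ws = map (weight t) ws"
        unfolding lex_le_iff[symmetric] by (metis order.eq_iff)
      finally show ?thesis using f'(2) g'(2) by simp
    qed
  qed
qed

end

text \<open>The generators of the flag are the perturbations of the points that represent the order of \<open>P\<close>, where
  the constant \<open>C\<close> is adapted to the finitely many terms that occur in \<open>B\<close>.\<close>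

lemma flag_of_prime_congruence:
  fixes \<sigma> :: "'m::ab_group_add NR set"
  assumes S: "sub_semifield S" and fg: "fg_free_abelian_group TYPE('m)"
    and \<sigma>: "\<sigma> = convex_cone hull X" "finite X"
    and P: "prime_congruence_on (monoid_semiring S (toric_monoid \<sigma>)) P"
    and B: "finite B" "B \<subseteq> P"
  obtains \<tau> Cs where "flag_of_cones \<sigma> \<tau> Cs" "flag_contained_in \<sigma> \<tau> Cs (trop_V \<sigma> B)"
    "P = flag_congruence S \<sigma> \<tau> Cs"
proof -
  interpret prime_monoid_congruence S "toric_monoid \<sigma>" P
    using S P by unfold_locales (auto simp: toric_monoid_0 toric_monoid_add)
  obtain \<tau> where \<tau>: "cone_face_of \<tau> \<sigma>" "live = toric_monoid \<sigma> \<inter> perp \<tau>"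
    by (rule monoid_face_cut_out[OF \<sigma> live_subset live_0 live_add_iff])
  interpret group_order term_group term_nonneg by (rule group_order[OF fg])
  obtain ws :: "(real \<times> 'm NR) list" and \<psi>s :: "(real \<times> 'm NR \<Rightarrow> real) list" where
    len: "length \<psi>s = length ws"
    and lin: "\<And>\<psi>. \<psi> \<in> set \<psi>s \<Longrightarrow> linear \<psi>"
    and vanish: "\<And>\<psi> s. \<psi> \<in> set \<psi>s \<Longrightarrow> (\<And>g. g \<in> term_group \<Longrightarrow> pairing s (snd g) = 0) \<Longrightarrow> \<psi> (0, s) = 0"
    and diag: "\<And>i. i < length ws \<Longrightarrow> (\<psi>s ! i) (ws ! i) \<noteq> 0"
    and below: "\<And>i j. i < length ws \<Longrightarrow> j < i \<Longrightarrow> (\<psi>s ! i) (ws ! j) = 0"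
    and lex: "\<And>g. g \<in> term_group \<Longrightarrow> g \<in> term_nonneg \<longleftrightarrow> lex_nonneg (map (weight g) ws)"
    and fst_ws: "lex_nonneg (map fst ws)"
    by (rule lexicographic_representation) blast
  define Y where "Y = (\<Union>(f, g)\<in>B. terms f \<union> terms g)"
  have "finite Y" using B(1) by (auto simp: Y_def)
  then obtain C where C: "0 < C" and compat: "\<And>w. w \<in> set (perturb C ws) \<Longrightarrow> compatible ws Y w"
    and nonneg: "\<And>w. w \<in> set (perturb C ws) \<Longrightarrow> 0 \<le> fst w"
    using compatible_perturb[of Y ws] fst_ws by blast
  have span_\<tau>: "\<psi> (0, s) = 0" if "\<psi> \<in> set \<psi>s" "s \<in> span \<tau>" for \<psi> s
  proof (rule vanish[OF that(1)])
    fix g assume "g \<in> term_group"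
    then obtain t t' where "g = t - t'" "t \<in> live_terms" "t' \<in> live_terms" unfolding term_group_def by blast
    then show "pairing s (snd g) = 0"
      using pairing_span_perp[OF _ that(2)] by (simp add: in_live_terms_iff \<tau>(2))
  qed
  have \<psi>_in: "\<psi>s ! i \<in> set \<psi>s" if "i < length ws" for i using that len by simp
  have \<psi>_perturb: "(\<psi>s ! i) (perturb C ws ! j) = (\<psi>s ! i) (ws ! j)"
    if i: "i < length ws" and j: "j \<le> i" for i j
  proof -
    have "(\<Sum>k<j. C ^ (j - k) * (\<psi>s ! i) (ws ! k)) = 0"
      using i j below by (intro sum.neutral) auto
    then show ?thesis
      using linear_perturb[OF lin[OF \<psi>_in[OF i]], of j ws C] i j
      by (simp add: lessThan_Suc_atMost[symmetric])
  qed
  interpret flag_generators \<tau> "perturb C ws" "\<lambda>i. \<psi>s ! i"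
  proof (rule flag_generators.intro)
    show "linear (\<psi>s ! i)" if "i < length (perturb C ws)" for i
      using that lin \<psi>_in by simp
    show "(\<psi>s ! i) (0, s) = 0" if "i < length (perturb C ws)" "s \<in> span \<tau>" for i s
      using that span_\<tau> \<psi>_in by simp
    show "(\<psi>s ! i) (perturb C ws ! i) \<noteq> 0" if "i < length (perturb C ws)" for i
      using that \<psi>_perturb diag by simp
    show "(\<psi>s ! i) (perturb C ws ! j) = 0" if "i < length (perturb C ws)" "j < i" for i j
      using that \<psi>_perturb below by simp
    show "0 \<le> fst u" if "u \<in> set (perturb C ws)" for u by (rule nonneg[OF that])
    have "\<tau> \<subseteq> \<sigma>" using \<tau>(1) by (auto simp: cone_face_of_def dest: face_of_imp_subset)
    also have "\<sigma> \<subseteq> span X" unfolding \<sigma>(1) by (intro hull_minimal convex_cone_span span_superset)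
    finally show "\<exists>F. finite F \<and> \<tau> \<subseteq> span F" using \<sigma>(2) by blast
  qed
  obtain vs where vs: "flag_points flag = map (stratum_proj \<tau>) vs"
    and lex_vs: "\<And>d :: real \<times> 'm NR \<Rightarrow> real. linear d \<Longrightarrow>
      lex_nonneg (map d vs) \<longleftrightarrow> lex_nonneg (map d (perturb C ws))"
    by (rule flag_points_flag[OF \<tau>(1)]) blast
  have lex': "g \<in> term_nonneg \<longleftrightarrow> lex_nonneg (map (weight g) vs)" if "g \<in> term_group" for g
    unfolding lex_vs[OF linear_weight] lex_nonneg_perturb[OF linear_weight C] by (rule lex[OF that])
  have "P = flag_congruence S \<sigma> \<tau> flag"
  proof -
    have "(f, g) \<in> P \<longleftrightarrow> (f, g) \<in> flag_congruence S \<sigma> \<tau> flag" for f g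
    proof (cases "f \<in> A \<and> g \<in> A")
      case True
      then show ?thesis
        using cong_iff_flag_Phi[OF \<tau>(2) lex', of f g] by (simp add: flag_congruence_def vs)
    next
      case False
      then show ?thesis using carrier[of f g] unfolding flag_congruence_def by blast
    qed
    then show ?thesis by auto
  qed
  moreover have "flag_contained_in \<sigma> \<tau> flag (trop_V \<sigma> B)"
  proof (rule flag_contained[OF \<tau>(1)])
    fix f g assume fg: "(f, g) \<in> B"
    then have f: "f \<in> A" and g: "g \<in> A" and "(f, g) \<in> P" using B(2) carrier by auto
    then have "flag_Phi \<tau> (map (stratum_proj \<tau>) ws) f = flag_Phi \<tau> (map (stratum_proj \<tau>) ws) g"
      using cong_iff_flag_Phi[OF \<tau>(2) lex f g] by blast
    moreover have "compatible ws (terms f \<union> terms g) u" if "u \<in> set (perturb C ws)" for u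
      using compat[OF that] fg unfolding compatible_def Y_def by blast
    ultimately show "snd ` terms f \<subseteq> toric_monoid \<sigma> \<and> snd ` terms g \<subseteq> toric_monoid \<sigma> \<and>
      flag_Phi \<tau> (map (stratum_proj \<tau>) ws) f = flag_Phi \<tau> (map (stratum_proj \<tau>) ws) g \<and>
      (\<forall>u\<in>set (perturb C ws). compatible ws (terms f \<union> terms g) u)"
      using snd_terms_subset[OF f] snd_terms_subset[OF g] by blast
  qed
  ultimately show ?thesis using that flag_of_cones_flag[OF \<tau>(1)] by blast
qed

theorem theorem1p1:
  fixes S :: "trop set"
    and \<sigma> :: "'m::ab_group_add NR set"
    and E P :: "(('m \<Rightarrow>\<^sub>0 trop) \<times> ('m \<Rightarrow>\<^sub>0 trop)) set"
  assumes "sub_semifield S"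
    and "fg_free_abelian_group TYPE('m)"
    and "rational_polyhedral_cone \<sigma>" and "strongly_convex \<sigma>"
    and "congruence_on (monoid_semiring S (toric_monoid \<sigma>)) E"
    and "has_finite_tropical_basis \<sigma> E"
    and "prime_congruence_on (monoid_semiring S (toric_monoid \<sigma>)) P"
  shows "E \<subseteq> P \<longleftrightarrow>
    (\<exists>\<tau> Cs. flag_of_cones \<sigma> \<tau> Cs \<and> flag_contained_in \<sigma> \<tau> Cs (trop_V \<sigma> E) \<and>
       P = flag_congruence S \<sigma> \<tau> Cs)"
proof
  assume "E \<subseteq> P"
  obtain X where X: "\<sigma> = convex_cone hull X" "finite X"
    using assms(3) by (auto simp: rational_polyhedral_cone_def)
  obtain B where B: "finite B" "B \<subseteq> E" "trop_V \<sigma> E = trop_V \<sigma> B"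
    using assms(6) by (auto simp: has_finite_tropical_basis_def)
  with \<open>E \<subseteq> P\<close> have "B \<subseteq> P" by blast
  from flag_of_prime_congruence[OF assms(1,2) X assms(7) B(1) this]
  show "\<exists>\<tau> Cs. flag_of_cones \<sigma> \<tau> Cs \<and> flag_contained_in \<sigma> \<tau> Cs (trop_V \<sigma> E) \<and>
       P = flag_congruence S \<sigma> \<tau> Cs"
    unfolding B(3) by metis
next
  have "E \<subseteq> monoid_semiring S (toric_monoid \<sigma>) \<times> monoid_semiring S (toric_monoid \<sigma>)"
    using assms(5) by (auto simp: congruence_on_def equiv_def refl_on_def)
  moreover assume "\<exists>\<tau> Cs. flag_of_cones \<sigma> \<tau> Cs \<and> flag_contained_in \<sigma> \<tau> Cs (trop_V \<sigma> E) \<and>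
       P = flag_congruence S \<sigma> \<tau> Cs"
  ultimately show "E \<subseteq> P" using subset_flag_congruence by metis
qed

end
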